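(* Let $u$ be the weak solution of the parabolic integro-differential problem described in the context and let $\{U^n_h\}_{n=0}^N$ be the fine-grid solution produced by Algorithm 4.2 (described in the context). Then, for sufficiently small $\Delta t$, for any $n\ge1$ (with $t_n\le T$), $$\|U^n_h-u(t_n)\|\le C\,(\sqrt{\Delta t}\,H^{r-1}+h^r+\Delta t),$$ where $C>0$ is a constant independent of $h$, $H$, $\Delta t$ and $n$.
   Context: Setting. $\Omega\subset\mathbb R^d$ ($d\ge1$) is a bounded polyhedral domain with piecewise smooth boundary, $T>0$, $\mathcal H^1_0=\mathcal H^1_0(\Omega)$; $(\cdot,\cdot)$ and $\|\cdot\|$ are the $L^2(\Omega)$ inner product and norm, $\|\cdot\|_r$ the $\mathcal H^r(\Omega)$ norm. The problem is $u_t+Au+\int_0^tK(t-s)Bu(s)\,ds=f$ in $\Omega\times(0,T]$, $u=0$ on $\partial\Omega\times(0,T]$, $u(\cdot,0)=u_0$, with $K$ a (smooth or nonsmooth) memory kernel, $f$ known, $A$ a symmetric positive definite second-order elliptic operator with coefficients smooth in $x$ and $t$, and $Bu=-\nabla\cdot(\alpha(u)\nabla u+\beta(u))+\gamma(u)\cdot\nabla u+g(u)$, where $\alpha(x,u)\in\mathbb R^{d\times d}$, $\beta(x,u),\gamma(x,u)\in\mathbb R^d$, $g(x,u)\in\mathbb R$ (dependence on $x$ suppressed) are smooth and bounded together with their derivatives, and $\beta(0)=0$, $g(0)=0$. $A(\cdot,\cdot)$ is the bilinear form of $A$ on $\mathcal H^1_0\times \mathcal H^1_0$ (possible $t$-dependence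 suppressed), with $A(v,v)\ge\nu_0\|v\|_1^2$ and $|A(u,v)|\le\nu_1\|u\|_1\|v\|_1$. Set $\tilde B(w;u,v)=(\alpha(w)\nabla u+\beta(w),\nabla v)+(\gamma(w)\cdot\nabla u+g(w),v)$ and $B(u,v)=\tilde B(u;u,v)$. The weak solution $u$ satisfies $(u_t,v)+A(u,v)+\int_0^tK(t-s)B(u(s),v)\,ds=(f,v)$ for all $v\in \mathcal H^1_0$, $u(0)=u_0$. Spaces. $\{S_h\}_{0<h\le1}$ are finite-dimensional subspaces of $\mathcal H^1_0$ with $\inf_{\chi\in S_h}\{\|v-\chi\|+h\|v-\chi\|_1\}\le C h^r\|v\|_r$ for $v\in \mathcal H^r\cap \mathcal H^1_0$ ($r\ge1+\frac d2$), and $\|\nabla\chi\|_\infty\le Ch^{-d/2}\|\nabla\chi\|$ for $\chi\in S_h$, with $C$ independent of $h$. $S_H$ (coarse, mesh size $H$) and $S_h$ (fine, mesh size $h\ll H$) are two members of this family, built on triangulations $\mathcal T_H$ and $\mathcal T_h$ of $\Omega$. Time discretization. $N$ is a positive integer, $\Delta t=T/N$, $t_n=n\Delta t$, $f^n=f(t_n)$. The weights $\omega_{ni}$ satisfy $|\omega_{ni}|\le K_1$ for $1\le i\le n\le N$, $\omega_{nn}\ne0$, and $\Delta t\sum_{i=1}^n\omega_{ni}\phi(t_i)=\int_0^{t_n}K(t_n-s)\phi(s)\,ds+O(\Delta t)$. Ritz–Volterra projection and standing regularity. With $B_1(w;u,v)=(\alpha(w)\nabla u,\nabla v)+(\gamma(w)\cdot\nabla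 u,v)$, $V_hu(t)\in S_h$ is defined by $A(u-V_hu,v)+\int_0^tK(t-s)B_1(u(s);u(s)-V_hu(s),v)\,ds=0$ for all $v\in S_h$. The solution $u$ is assumed regular enough that $u,u_t$ are bounded in time with values in $\mathcal H^r\cap \mathcal H^1_0$, $\nabla u$ is bounded, $u_{tt}$ is bounded in time with values in $L^2(\Omega)$, that $\rho=u-V_hu$ satisfies $\|\rho\|+h\|\rho\|_1+\|\rho_t\|\le Ch^r$ and $\|\nabla V_hu\|_\infty+\|\nabla(V_hu)_t\|_\infty\le C$ on $[0,T]$ (and likewise with $H$ in place of $h$), and that the quadrature error for $\phi(s)=B_1(u(s);V_hu(s),v)$ and for $\phi(s)=(\beta(u(s)),\nabla v)+(g(u(s)),v)$ is at most $C\Delta t\|v\|_1$. Algorithm 4.2. Step one (coarse grid): $U^0_H=u^0_H\in S_H$, and for $1\le n\le N$ find $U^n_H\in S_H$ with $\frac1{\Delta t}(U^n_H-U^{n-1}_H,v)+A(U^n_H,v)+\Delta t\sum_{i=1}^n\omega_{ni}\tilde B(U^i_H;U^i_H,v)=(f^n,v)$ for all $v\in S_H$. Step two (fine grid): $U^0_h=u^0_h\in S_h$, and for $1\le n\le N$ find $U^n_h\in S_h$ with $\frac1{\Delta t}(U^n_h-U^{n-1}_h,v)+A(U^n_h,v)+\Delta t\sum_{i=1}^{n-1}\omega_{ni}\tilde B(U^i_h;U^i_h,v)+\Delta t\,\omega_{nn}\tilde B(U^n_H;U^n_H,v)=(f^n,v)$ for all $v\in S_h$. The initial data $u^0_h\in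 S_h$, $u^0_H\in S_H$ are appropriate approximations of $u_0$: $\|u^0_h-V_hu(0)\|_1\le Ch^r$ and $\|u^0_H-V_Hu(0)\|_1\le CH^r$. "For sufficiently small $\Delta t$" means: there is $\delta_0>0$, independent of $h$, $H$, such that the claim holds for all $\Delta t\le\delta_0$. *)

theory Defs
  imports "HOL-Analysis.Analysis" "HOL-Probability.Essential_Supremum"
begin

text \<open>
  Elements of \<open>L\<^sup>2(\<Omega>)\<close> and of the Sobolev spaces are represented by functions on the whole of
  \<open>\<real>\<^sup>d\<close>; only their values almost everywhere on \<open>\<Omega>\<close> matter.  A time-dependent element is a
  function of type \<open>real \<Rightarrow> real^'d \<Rightarrow> real\<close>, time first.
\<close>

definition polyhedral_domain :: "(real^'d) set \<Rightarrow> bool" where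
  "polyhedral_domain \<Omega> \<longleftrightarrow>
     open \<Omega> \<and> connected \<Omega> \<and> \<Omega> \<noteq> {} \<and> bounded \<Omega> \<and>
     (\<exists>F. finite F \<and> (\<forall>p\<in>F. polytope p \<and> aff_dim p = int CARD('d) - 1) \<and> frontier \<Omega> = \<Union>F)"

definition dir_deriv :: "'a::euclidean_space \<Rightarrow> ('a \<Rightarrow> 'b::real_normed_vector) \<Rightarrow> 'a \<Rightarrow> 'b" where
  "dir_deriv b f x = frechet_derivative f (at x) b"

fun iter_deriv :: "'a::euclidean_space list \<Rightarrow> ('a \<Rightarrow> 'b::real_normed_vector) \<Rightarrow> 'a \<Rightarrow> 'b" where
  "iter_deriv [] f = f"
| "iter_deriv (b # bs) f = dir_deriv b (iter_deriv bs f)"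

text \<open>\<open>C\<^sup>\<infinity>\<close> regularity; meaningful for open \<open>W\<close> only.\<close>

definition smooth_on :: "'a::euclidean_space set \<Rightarrow> ('a \<Rightarrow> 'b::real_normed_vector) \<Rightarrow> bool" where
  "smooth_on W f \<longleftrightarrow> (\<forall>bs\<in>lists Basis. iter_deriv bs f differentiable_on W)"

definition smooth_bounded_on :: "'a::euclidean_space set \<Rightarrow> ('a \<Rightarrow> 'b::real_normed_vector) \<Rightarrow> bool" where
  "smooth_bounded_on W f \<longleftrightarrow> smooth_on W f \<and> (\<forall>bs\<in>lists Basis. bounded (iter_deriv bs f ` W))"

definition smooth_near :: "'a::euclidean_space set \<Rightarrow> ('a \<Rightarrow> 'b::real_normed_vector) \<Rightarrow> bool" where
  "smooth_near S f \<longleftrightarrow> (\<exists>W. open W \<and> S \<subseteq> W \<and> smooth_on W f)"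

definition test_function :: "(real^'d) set \<Rightarrow> (real^'d \<Rightarrow> real) \<Rightarrow> bool" where
  "test_function \<Omega> \<phi> \<longleftrightarrow>
     smooth_on UNIV \<phi> \<and> compact (closure {x. \<phi> x \<noteq> 0}) \<and> closure {x. \<phi> x \<noteq> 0} \<subseteq> \<Omega>"

definition L2 :: "(real^'d) set \<Rightarrow> (real^'d \<Rightarrow> 'b::euclidean_space) set" where
  "L2 \<Omega> = {v. v \<in> borel_measurable (lebesgue_on \<Omega>) \<and>
              integrable (lebesgue_on \<Omega>) (\<lambda>x. (norm (v x))\<^sup>2)}"

definition l2_inner :: "(real^'d) set \<Rightarrow> (real^'d \<Rightarrow> 'b::euclidean_space) \<Rightarrow> (real^'d \<Rightarrow> 'b) \<Rightarrow> real" where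
  "l2_inner \<Omega> u v = (LINT x|lebesgue_on \<Omega>. u x \<bullet> v x)"

definition l2_norm :: "(real^'d) set \<Rightarrow> (real^'d \<Rightarrow> 'b::euclidean_space) \<Rightarrow> real" where
  "l2_norm \<Omega> v = sqrt (l2_inner \<Omega> v v)"

definition linf_norm :: "(real^'d) set \<Rightarrow> (real^'d \<Rightarrow> 'b::euclidean_space) \<Rightarrow> ereal" where
  "linf_norm \<Omega> v = esssup (lebesgue_on \<Omega>) (\<lambda>x. ereal (norm (v x)))"

text \<open>
  A multi-index is a function \<open>'d \<Rightarrow> nat\<close>.  For a smooth \<open>\<phi>\<close> the order of differentiation is
  irrelevant, so the quantification over all enumerations \<open>is\<close> of \<open>m\<close> is harmless.
\<close>

definition mi_order :: "('d::finite \<Rightarrow> nat) \<Rightarrow> nat" where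
  "mi_order m = (\<Sum>i\<in>UNIV. m i)"

definition weak_deriv ::
    "(real^'d) set \<Rightarrow> ('d \<Rightarrow> nat) \<Rightarrow> (real^'d \<Rightarrow> real) \<Rightarrow> (real^'d \<Rightarrow> real) \<Rightarrow> bool" where
  "weak_deriv \<Omega> m v w \<longleftrightarrow>
     w \<in> L2 \<Omega> \<and>
     (\<forall>\<phi> is. test_function \<Omega> \<phi> \<longrightarrow> (\<forall>i. count_list is i = m i) \<longrightarrow>
        l2_inner \<Omega> v (iter_deriv (map (\<lambda>i. axis i 1) is) \<phi>) = (-1) ^ mi_order m * l2_inner \<Omega> w \<phi>)"

definition wderiv :: "(real^'d) set \<Rightarrow> ('d \<Rightarrow> nat) \<Rightarrow> (real^'d \<Rightarrow> real) \<Rightarrow> real^'d \<Rightarrow> real" where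
  "wderiv \<Omega> m v = (SOME w. weak_deriv \<Omega> m v w)"

definition wgrad :: "(real^'d) set \<Rightarrow> (real^'d \<Rightarrow> real) \<Rightarrow> real^'d \<Rightarrow> real^'d" where
  "wgrad \<Omega> v x = (\<chi> i. wderiv \<Omega> (\<lambda>j. if j = i then 1 else 0) v x)"

text \<open>Square of the Sobolev--Slobodeckij seminorm of order \<open>\<sigma> \<in> (0,1)\<close>.\<close>

definition slobodeckij :: "(real^'d) set \<Rightarrow> real \<Rightarrow> (real^'d \<Rightarrow> real) \<Rightarrow> ennreal" where
  "slobodeckij \<Omega> \<sigma> w =
     (\<integral>\<^sup>+x. \<integral>\<^sup>+y. ennreal ((w x - w y)\<^sup>2 / dist x y powr (real CARD('d) + 2 * \<sigma>))
        \<partial>lebesgue_on \<Omega> \<partial>lebesgue_on \<Omega>)"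

text \<open>
  \<open>H\<^sup>r(\<Omega>)\<close> for real \<open>r \<ge> 0\<close>.  For integer \<open>r\<close> these are the usual space and the usual norm, the
  square root of the sum of the squared \<open>L\<^sup>2\<close> norms of all weak derivatives of order at most \<open>r\<close>.
\<close>

definition Hs :: "(real^'d) set \<Rightarrow> real \<Rightarrow> (real^'d \<Rightarrow> real) set" where
  "Hs \<Omega> r = {v \<in> L2 \<Omega>. \<forall>m. mi_order m \<le> nat \<lfloor>r\<rfloor> \<longrightarrow>
      (\<exists>w. weak_deriv \<Omega> m v w \<and>
           (mi_order m = nat \<lfloor>r\<rfloor> \<and> frac r \<noteq> 0 \<longrightarrow> slobodeckij \<Omega> (frac r) w < \<infinity>))}"

definition Hnorm :: "(real^'d) set \<Rightarrow> real \<Rightarrow> (real^'d \<Rightarrow> real) \<Rightarrow> real" where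
  "Hnorm \<Omega> r v = sqrt
     ((\<Sum>m | mi_order m \<le> nat \<lfloor>r\<rfloor>. (l2_norm \<Omega> (wderiv \<Omega> m v))\<^sup>2) +
      (if frac r = 0 then 0
       else \<Sum>m | mi_order m = nat \<lfloor>r\<rfloor>. enn2real (slobodeckij \<Omega> (frac r) (wderiv \<Omega> m v))))"

definition H10 :: "(real^'d) set \<Rightarrow> (real^'d \<Rightarrow> real) set" where
  "H10 \<Omega> = {v \<in> Hs \<Omega> 1. \<exists>\<phi>. (\<forall>n::nat. test_function \<Omega> (\<phi> n)) \<and>
                (\<lambda>n. Hnorm \<Omega> 1 (\<lambda>x. v x - \<phi> n x)) \<longlonglongrightarrow> 0}"

text \<open>\<open>u'\<close> is the time derivative of \<open>u\<close> on \<open>[0,T]\<close> (one-sided at the end points), the limit of the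
  difference quotients being taken in the norm \<open>N\<close>.\<close>

definition time_deriv :: "((real^'d \<Rightarrow> real) \<Rightarrow> real) \<Rightarrow> real \<Rightarrow>
    (real \<Rightarrow> real^'d \<Rightarrow> real) \<Rightarrow> (real \<Rightarrow> real^'d \<Rightarrow> real) \<Rightarrow> bool" where
  "time_deriv N T u u' \<longleftrightarrow>
     (\<forall>t\<in>{0..T}. ((\<lambda>s. N (\<lambda>x. (u s x - u t x) / (s - t) - u' t x)) \<longlongrightarrow> 0) (at t within {0..T}))"

text \<open>\<open>A v = - \<nabla>\<cdot>(a(x,t) \<nabla>v) + a\<^sub>0(x,t) v\<close>, the general symmetric second-order operator.\<close>

definition elliptic_coeffs ::
    "(real^'d) set \<Rightarrow> real \<Rightarrow> (real^'d \<Rightarrow> real \<Rightarrow> real^'d^'d) \<Rightarrow> (real^'d \<Rightarrow> real \<Rightarrow> real) \<Rightarrow> bool" where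
  "elliptic_coeffs \<Omega> T a a0 \<longleftrightarrow>
     smooth_near (closure \<Omega> \<times> {0..T}) (\<lambda>(x, t). a x t) \<and>
     smooth_near (closure \<Omega> \<times> {0..T}) (\<lambda>(x, t). a0 x t) \<and>
     (\<forall>x\<in>\<Omega>. \<forall>t\<in>{0..T}. transpose (a x t) = a x t) \<and>
     (\<exists>c>0. \<forall>x\<in>\<Omega>. \<forall>t\<in>{0..T}. \<forall>\<xi>. (a x t *v \<xi>) \<bullet> \<xi> \<ge> c * (norm \<xi>)\<^sup>2)"

definition A_form ::
    "(real^'d) set \<Rightarrow> (real^'d \<Rightarrow> real \<Rightarrow> real^'d^'d) \<Rightarrow> (real^'d \<Rightarrow> real \<Rightarrow> real) \<Rightarrow>
     real \<Rightarrow> (real^'d \<Rightarrow> real) \<Rightarrow> (real^'d \<Rightarrow> real) \<Rightarrow> real" where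
  "A_form \<Omega> a a0 t u v =
     l2_inner \<Omega> (\<lambda>x. a x t *v wgrad \<Omega> u x) (wgrad \<Omega> v) + l2_inner \<Omega> (\<lambda>x. a0 x t * u x) v"

definition B_form ::
    "(real^'d) set \<Rightarrow> (real^'d \<Rightarrow> real \<Rightarrow> real^'d^'d) \<Rightarrow> (real^'d \<Rightarrow> real \<Rightarrow> real^'d) \<Rightarrow>
     (real^'d \<Rightarrow> real \<Rightarrow> real^'d) \<Rightarrow> (real^'d \<Rightarrow> real \<Rightarrow> real) \<Rightarrow>
     (real^'d \<Rightarrow> real) \<Rightarrow> (real^'d \<Rightarrow> real) \<Rightarrow> (real^'d \<Rightarrow> real) \<Rightarrow> real" where
  "B_form \<Omega> \<alpha> \<beta> \<gamma> g w u v =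
     l2_inner \<Omega> (\<lambda>x. \<alpha> x (w x) *v wgrad \<Omega> u x + \<beta> x (w x)) (wgrad \<Omega> v) +
     l2_inner \<Omega> (\<lambda>x. \<gamma> x (w x) \<bullet> wgrad \<Omega> u x + g x (w x)) v"

definition B1_form ::
    "(real^'d) set \<Rightarrow> (real^'d \<Rightarrow> real \<Rightarrow> real^'d^'d) \<Rightarrow> (real^'d \<Rightarrow> real \<Rightarrow> real^'d) \<Rightarrow>
     (real^'d \<Rightarrow> real) \<Rightarrow> (real^'d \<Rightarrow> real) \<Rightarrow> (real^'d \<Rightarrow> real) \<Rightarrow> real" where
  "B1_form \<Omega> \<alpha> \<gamma> w u v =
     l2_inner \<Omega> (\<lambda>x. \<alpha> x (w x) *v wgrad \<Omega> u x) (wgrad \<Omega> v) +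
     l2_inner \<Omega> (\<lambda>x. \<gamma> x (w x) \<bullet> wgrad \<Omega> u x) v"

definition memory :: "(real \<Rightarrow> real) \<Rightarrow> (real \<Rightarrow> real) \<Rightarrow> real \<Rightarrow> real" where
  "memory K \<phi> t = (LINT s:{0..t}|lborel. K (t - s) * \<phi> s)"

text \<open>Here and below \<open>A\<close>, \<open>B\<close>, \<open>B1\<close> stand for the forms \<open>A_form\<close>, \<open>B_form\<close>, \<open>B1_form\<close> with their
  coefficients fixed; \<open>A\<close> takes the time as first argument.\<close>

definition weak_solution ::
    "(real^'d) set \<Rightarrow> real \<Rightarrow> (real \<Rightarrow> (real^'d \<Rightarrow> real) \<Rightarrow> (real^'d \<Rightarrow> real) \<Rightarrow> real) \<Rightarrow>
     ((real^'d \<Rightarrow> real) \<Rightarrow> (real^'d \<Rightarrow> real) \<Rightarrow> (real^'d \<Rightarrow> real) \<Rightarrow> real) \<Rightarrow> (real \<Rightarrow> real) \<Rightarrow>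
     (real \<Rightarrow> real^'d \<Rightarrow> real) \<Rightarrow> (real^'d \<Rightarrow> real) \<Rightarrow>
     (real \<Rightarrow> real^'d \<Rightarrow> real) \<Rightarrow> (real \<Rightarrow> real^'d \<Rightarrow> real) \<Rightarrow> bool" where
  "weak_solution \<Omega> T A B K f u0 u ut \<longleftrightarrow>
     (\<forall>t\<in>{0..T}. u t \<in> H10 \<Omega> \<and> ut t \<in> L2 \<Omega>) \<and>
     time_deriv (l2_norm \<Omega>) T u ut \<and>
     (\<forall>t\<in>{0<..T}. \<forall>v\<in>H10 \<Omega>.
        l2_inner \<Omega> (ut t) v + A t (u t) v + memory K (\<lambda>s. B (u s) (u s) v) t = l2_inner \<Omega> (f t) v) \<and>
     (AE x in lebesgue_on \<Omega>. u 0 x = u0 x)"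

definition fin_dim_subspace :: "(real^'d \<Rightarrow> real) set \<Rightarrow> bool" where
  "fin_dim_subspace S \<longleftrightarrow> (\<exists>E. finite E \<and> S = {v. \<exists>c. v = (\<lambda>x. \<Sum>e\<in>E. c e * e x)})"

definition fe_family :: "(real^'d) set \<Rightarrow> real \<Rightarrow> (real \<Rightarrow> (real^'d \<Rightarrow> real) set) \<Rightarrow> bool" where
  "fe_family \<Omega> r S \<longleftrightarrow>
     (\<forall>h\<in>{0<..1}. fin_dim_subspace (S h) \<and> S h \<subseteq> H10 \<Omega>) \<and>
     (\<exists>C. \<forall>h\<in>{0<..1}. \<forall>v \<in> Hs \<Omega> r \<inter> H10 \<Omega>.
        (INF \<psi>\<in>S h. l2_norm \<Omega> (\<lambda>x. v x - \<psi> x) + h * Hnorm \<Omega> 1 (\<lambda>x. v x - \<psi> x))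
          \<le> C * h powr r * Hnorm \<Omega> r v) \<and>
     (\<exists>C. \<forall>h\<in>{0<..1}. \<forall>\<psi>\<in>S h.
        linf_norm \<Omega> (wgrad \<Omega> \<psi>)
          \<le> ereal (C * h powr (- (real CARD('d) / 2)) * l2_norm \<Omega> (wgrad \<Omega> \<psi>)))"

definition ritz_volterra ::
    "real \<Rightarrow> (real \<Rightarrow> (real^'d \<Rightarrow> real) \<Rightarrow> (real^'d \<Rightarrow> real) \<Rightarrow> real) \<Rightarrow>
     ((real^'d \<Rightarrow> real) \<Rightarrow> (real^'d \<Rightarrow> real) \<Rightarrow> (real^'d \<Rightarrow> real) \<Rightarrow> real) \<Rightarrow> (real \<Rightarrow> real) \<Rightarrow>
     (real^'d \<Rightarrow> real) set \<Rightarrow> (real \<Rightarrow> real^'d \<Rightarrow> real) \<Rightarrow> (real \<Rightarrow> real^'d \<Rightarrow> real) \<Rightarrow> bool" where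
  "ritz_volterra T A B1 K S u V \<longleftrightarrow>
     (\<forall>t\<in>{0..T}. V t \<in> S \<and>
        (\<forall>v\<in>S. A t (\<lambda>x. u t x - V t x) v
                + memory K (\<lambda>s. B1 (u s) (\<lambda>x. u s x - V s x) v) t = 0))"

text \<open>\<open>ut\<close>, \<open>utt\<close> are the first two time derivatives of \<open>u\<close>.\<close>

definition regular_solution :: "(real^'d) set \<Rightarrow> real \<Rightarrow> real \<Rightarrow> (real \<Rightarrow> real^'d \<Rightarrow> real) \<Rightarrow>
    (real \<Rightarrow> real^'d \<Rightarrow> real) \<Rightarrow> (real \<Rightarrow> real^'d \<Rightarrow> real) \<Rightarrow> bool" where
  "regular_solution \<Omega> T r u ut utt \<longleftrightarrow>
     time_deriv (Hnorm \<Omega> 1) T u ut \<and> time_deriv (l2_norm \<Omega>) T ut utt \<and>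
     (\<forall>t\<in>{0..T}. u t \<in> Hs \<Omega> r \<inter> H10 \<Omega> \<and> ut t \<in> Hs \<Omega> r \<inter> H10 \<Omega> \<and> utt t \<in> L2 \<Omega>) \<and>
     (\<exists>C. \<forall>t\<in>{0..T}. Hnorm \<Omega> r (u t) \<le> C \<and> Hnorm \<Omega> r (ut t) \<le> C \<and>
        linf_norm \<Omega> (wgrad \<Omega> (u t)) \<le> ereal C \<and> l2_norm \<Omega> (utt t) \<le> C)"

text \<open>\<open>V h\<close> is the projection \<open>V\<^sub>h u\<close> and \<open>Vt h\<close> its time derivative, so that \<open>\<rho>\<^sub>t\<close> is \<open>ut - Vt h\<close>.\<close>

definition projection_bounds :: "(real^'d) set \<Rightarrow> real \<Rightarrow> real \<Rightarrow>
    (real \<Rightarrow> (real^'d \<Rightarrow> real) set) \<Rightarrow> (real \<Rightarrow> real^'d \<Rightarrow> real) \<Rightarrow> (real \<Rightarrow> real^'d \<Rightarrow> real) \<Rightarrow>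
    (real \<Rightarrow> real \<Rightarrow> real^'d \<Rightarrow> real) \<Rightarrow> (real \<Rightarrow> real \<Rightarrow> real^'d \<Rightarrow> real) \<Rightarrow> bool" where
  "projection_bounds \<Omega> T r S u ut V Vt \<longleftrightarrow>
     (\<forall>h\<in>{0<..1}. time_deriv (Hnorm \<Omega> 1) T (V h) (Vt h) \<and> (\<forall>t\<in>{0..T}. Vt h t \<in> S h)) \<and>
     (\<exists>C. \<forall>h\<in>{0<..1}. \<forall>t\<in>{0..T}.
        l2_norm \<Omega> (\<lambda>x. u t x - V h t x) + h * Hnorm \<Omega> 1 (\<lambda>x. u t x - V h t x)
          + l2_norm \<Omega> (\<lambda>x. ut t x - Vt h t x) \<le> C * h powr r \<and>
        linf_norm \<Omega> (wgrad \<Omega> (V h t)) + linf_norm \<Omega> (wgrad \<Omega> (Vt h t)) \<le> ereal C)"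

text \<open>\<open>\<omega> N n i\<close> is the weight \<open>\<omega>\<^sub>n\<^sub>i\<close> for the step \<open>\<Delta>t = T/N\<close>.\<close>

definition quad_err :: "real \<Rightarrow> (real \<Rightarrow> real) \<Rightarrow> (nat \<Rightarrow> nat \<Rightarrow> nat \<Rightarrow> real) \<Rightarrow> nat \<Rightarrow> nat \<Rightarrow>
    (real \<Rightarrow> real) \<Rightarrow> real" where
  "quad_err T K \<omega> N n \<phi> =
     \<bar>T / N * (\<Sum>i=1..n. \<omega> N n i * \<phi> (i * (T / N))) - memory K \<phi> (n * (T / N))\<bar>"

definition quadrature_weights :: "real \<Rightarrow> (real \<Rightarrow> real) \<Rightarrow> (nat \<Rightarrow> nat \<Rightarrow> nat \<Rightarrow> real) \<Rightarrow> bool" where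
  "quadrature_weights T K \<omega> \<longleftrightarrow>
     (\<exists>K1. \<forall>N n i. 1 \<le> i \<and> i \<le> n \<and> n \<le> N \<longrightarrow> \<bar>\<omega> N n i\<bar> \<le> K1) \<and>
     (\<forall>N n. 1 \<le> n \<and> n \<le> N \<longrightarrow> \<omega> N n n \<noteq> 0) \<and>
     (\<forall>\<phi>. smooth_near {0..T} \<phi> \<longrightarrow>
        (\<exists>C. \<forall>N n. 1 \<le> n \<and> n \<le> N \<longrightarrow> quad_err T K \<omega> N n \<phi> \<le> C * (T / N)))"

definition coarse_scheme ::
    "(real^'d) set \<Rightarrow> (real \<Rightarrow> (real^'d \<Rightarrow> real) \<Rightarrow> (real^'d \<Rightarrow> real) \<Rightarrow> real) \<Rightarrow>
     ((real^'d \<Rightarrow> real) \<Rightarrow> (real^'d \<Rightarrow> real) \<Rightarrow> (real^'d \<Rightarrow> real) \<Rightarrow> real) \<Rightarrow>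
     (real \<Rightarrow> real^'d \<Rightarrow> real) \<Rightarrow> (nat \<Rightarrow> nat \<Rightarrow> real) \<Rightarrow> (real^'d \<Rightarrow> real) set \<Rightarrow> real \<Rightarrow> nat \<Rightarrow>
     (real^'d \<Rightarrow> real) \<Rightarrow> (nat \<Rightarrow> real^'d \<Rightarrow> real) \<Rightarrow> bool" where
  "coarse_scheme \<Omega> A B f \<omega> SH \<Delta>t N u0H UH \<longleftrightarrow>
     UH 0 = u0H \<and>
     (\<forall>n\<in>{1..N}. UH n \<in> SH \<and> (\<forall>v\<in>SH.
        1 / \<Delta>t * l2_inner \<Omega> (\<lambda>x. UH n x - UH (n - 1) x) v + A (n * \<Delta>t) (UH n) v
          + \<Delta>t * (\<Sum>i=1..n. \<omega> n i * B (UH i) (UH i) v)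
        = l2_inner \<Omega> (f (n * \<Delta>t)) v))"

definition fine_scheme ::
    "(real^'d) set \<Rightarrow> (real \<Rightarrow> (real^'d \<Rightarrow> real) \<Rightarrow> (real^'d \<Rightarrow> real) \<Rightarrow> real) \<Rightarrow>
     ((real^'d \<Rightarrow> real) \<Rightarrow> (real^'d \<Rightarrow> real) \<Rightarrow> (real^'d \<Rightarrow> real) \<Rightarrow> real) \<Rightarrow>
     (real \<Rightarrow> real^'d \<Rightarrow> real) \<Rightarrow> (nat \<Rightarrow> nat \<Rightarrow> real) \<Rightarrow> (real^'d \<Rightarrow> real) set \<Rightarrow> real \<Rightarrow> nat \<Rightarrow>
     (nat \<Rightarrow> real^'d \<Rightarrow> real) \<Rightarrow> (real^'d \<Rightarrow> real) \<Rightarrow> (nat \<Rightarrow> real^'d \<Rightarrow> real) \<Rightarrow> bool" where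
  "fine_scheme \<Omega> A B f \<omega> Sh \<Delta>t N UH u0h Uh \<longleftrightarrow>
     Uh 0 = u0h \<and>
     (\<forall>n\<in>{1..N}. Uh n \<in> Sh \<and> (\<forall>v\<in>Sh.
        1 / \<Delta>t * l2_inner \<Omega> (\<lambda>x. Uh n x - Uh (n - 1) x) v + A (n * \<Delta>t) (Uh n) v
          + \<Delta>t * (\<Sum>i=1..n-1. \<omega> n i * B (Uh i) (Uh i) v)
          + \<Delta>t * \<omega> n n * B (UH n) (UH n) v
        = l2_inner \<Omega> (f (n * \<Delta>t)) v))"

end

theory Submission
  imports Defs
begin

text \<open>
  The error splits as \<open>U\<^sub>n - u(t\<^sub>n) = \<theta>\<^sub>n - (u - V\<^sub>h u)(t\<^sub>n)\<close>, where \<open>V\<^sub>h u\<close> is the Ritz--Volterra projection, whose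
  error is known, and \<open>\<theta>\<^sub>n = U\<^sub>n - V\<^sub>h u(t\<^sub>n)\<close> lies in the discrete space.  The projection is designed so that
  inserting it into the weak form leaves a residual of size \<open>\<Delta>t + h\<^sup>r\<close> in the dual of \<open>H\<^sup>1\<close>
  (\<open>projection_equation\<close>, \<open>consistency\<close>).  The nonlinear form is Lipschitz in its arguments as long as one
  of the two gradients compared is bounded, and the gradient of the projection is
  (\<open>B_form_lipschitz\<close>, \<open>form_error\<close>).  Testing the error equation with \<open>\<theta>\<^sub>n\<close> therefore gives, with
  \<open>\<eta> = \<Delta>t + h\<^sup>r\<close>,
  \<open>(\<parallel>\<theta>\<^sub>n\<parallel>\<^sup>2 - \<parallel>\<theta>\<^sub>n\<^sub>-\<^sub>1\<parallel>\<^sup>2)/2 + \<nu>\<^sub>0 \<Delta>t \<parallel>\<theta>\<^sub>n\<parallel>\<^sub>1\<^sup>2 \<le> c \<Delta>t \<parallel>\<theta>\<^sub>n\<parallel>\<^sub>1 (\<eta> + \<Delta>t \<Sum>\<^sub>i\<^sub><\<^sub>n \<parallel>\<theta>\<^sub>i\<parallel>\<^sub>1 + \<Delta>t z\<^sub>n)\<close>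
  (\<open>energy_step\<close>), where \<open>\<Delta>t z\<^sub>n\<close> comes from the last summand of the memory term.  A discrete Gronwall
  argument bounds \<open>\<parallel>\<theta>\<^sub>n\<parallel>\<^sup>2 + \<nu>\<^sub>0 \<Delta>t \<Sum> \<parallel>\<theta>\<^sub>i\<parallel>\<^sub>1\<^sup>2\<close> by a multiple of
  \<open>\<parallel>\<theta>\<^sub>0\<parallel>\<^sup>2 + \<eta>\<^sup>2 + \<Delta>t\<^sup>2 \<cdot> \<Delta>t \<Sum> z\<^sub>i\<^sup>2\<close> (\<open>discrete_energy_bound\<close>).

  On the coarse grid the last summand is implicit, \<open>z\<^sub>n = \<parallel>\<theta>\<^sub>n\<parallel>\<^sub>1\<close>, and coercivity absorbs it once \<open>\<Delta>t\<close> is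
  small; this bounds \<open>\<Delta>t \<Sum> \<parallel>\<theta>\<^sub>i\<parallel>\<^sub>1\<^sup>2\<close> for the coarse solution (\<open>coarse_stability\<close>).  On the fine grid the last
  summand is evaluated at the coarse solution, so \<open>z\<^sub>n\<close> is at most a multiple of one plus the coarse \<open>H\<^sup>1\<close>
  error, and the stability of the coarse scheme suffices: the result is \<open>\<parallel>\<theta>\<^sub>n\<parallel> \<le> C (\<Delta>t + h\<^sup>r)\<close>
  (\<open>fine_error\<close>).  The argument thus yields the error bound even without the term \<open>\<surd>\<Delta>t H\<^sup>r\<^sup>-\<^sup>1\<close>.

  Everything rests on weak gradients being linear almost everywhere.  They are arbitrary choices among
  functions that satisfy the same integral identities, so linearity follows from the fundamental lemma
  of the calculus of variations (\<open>fundamental_lemma_of_variations\<close>); its test functions are products of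
  functions \<open>exp(-1/x)\<close> of the coordinates.  Time derivatives exist as limits of difference quotients
  in \<open>L\<^sup>2\<close> only, so the mean value theorem is applied to scalar products with a fixed function
  (\<open>difference_quotient_error\<close>).
\<close>


section \<open>Smooth test functions from the flat exponential\<close>

text \<open>
  The functions \<open>p(1/x) exp(-1/x)\<close>, \<open>p\<close> a polynomial, extended by zero to \<open>x \<le> 0\<close>.  Differentiation
  maps this family to itself, so smoothness needs no separate treatment of higher derivatives.
\<close>

definition flat :: "real poly \<Rightarrow> real \<Rightarrow> real" where
  "flat p x = (if x > 0 then poly p (1 / x) * exp (- (1 / x)) else 0)"

lemma poly_times_exp_minus_tendsto_0:
  fixes p :: "real poly"
  shows "((\<lambda>y. poly p y * exp (- y)) \<longlongrightarrow> 0) at_top"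
proof -
  have "((\<lambda>y. \<Sum>i\<le>degree p. coeff p i * (y ^ i / exp y)) \<longlongrightarrow> (\<Sum>i\<le>degree p. coeff p i * 0)) at_top"
    by (intro tendsto_intros tendsto_power_div_exp_0)
  moreover have "(\<lambda>y. \<Sum>i\<le>degree p. coeff p i * (y ^ i / exp y)) = (\<lambda>y. poly p y * exp (- y))"
    by (rule ext) (simp add: poly_altdef sum_distrib_right exp_minus divide_inverse mult.assoc)
  ultimately show ?thesis by simp
qed

lemma flat_tendsto_0: "(flat p \<longlongrightarrow> 0) (at_right 0)"
proof -
  have "((\<lambda>x. poly p (inverse x) * exp (- inverse x)) \<longlongrightarrow> 0) (at_right 0)"
    by (rule filterlim_compose[OF poly_times_exp_minus_tendsto_0 filterlim_inverse_at_top_right])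
  moreover have "eventually (\<lambda>x. poly p (inverse x) * exp (- inverse x) = flat p x) (at_right (0::real))"
    using eventually_at_right_less by (eventually_elim) (simp add: flat_def inverse_eq_divide)
  ultimately show ?thesis
    by (rule Lim_transform_eventually)
qed

lemma flat_has_derivative:
  "(flat p has_real_derivative flat ([:0, 0, 1:] * (p - pderiv p)) x) (at x)"
proof -
  consider "x > 0" | "x < 0" | "x = 0" by linarith
  then show ?thesis
  proof cases
    case 1
    have "((\<lambda>x. poly p (1 / x) * exp (- (1 / x))) has_real_derivative
            flat ([:0, 0, 1:] * (p - pderiv p)) x) (at x)"
      using 1
      by (auto intro!: derivative_eq_intros simp: flat_def power2_eq_square field_simps)
    then show ?thesis
      by (rule has_field_derivative_transform_within_open[where S = "{0<..}"]) (use 1 in \<open>auto simp: flat_def\<close>)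
  next
    case 2
    have "((\<lambda>x. 0) has_real_derivative flat ([:0, 0, 1:] * (p - pderiv p)) x) (at x)"
      using 2 by (auto simp: flat_def)
    then show ?thesis
      by (rule has_field_derivative_transform_within_open[where S = "{..<0}"]) (use 2 in \<open>auto simp: flat_def\<close>)
  next
    case 3
    have "((\<lambda>h. flat p h / h) \<longlongrightarrow> 0) (at_left 0)"
      by (rule Lim_transform_eventually[OF tendsto_const])
         (auto simp: eventually_at_filter flat_def)
    moreover have "((\<lambda>h. flat p h / h) \<longlongrightarrow> 0) (at_right 0)"
      by (rule Lim_transform_eventually[OF flat_tendsto_0[of "pCons 0 p"]])
         (auto simp: eventually_at_right flat_def intro!: exI[of _ 1])
    ultimately have "((\<lambda>h. flat p h / h) \<longlongrightarrow> 0) (at 0)"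
      using filterlim_split_at by blast
    then show ?thesis
      using 3 by (simp add: DERIV_def flat_def)
  qed
qed

text \<open>
  The algebra generated by the constants and the functions \<open>x \<mapsto> flat p (c \<bullet> x + d)\<close>.  It is closed under
  directional derivatives, and hence consists of smooth functions.
\<close>

inductive_set flat_algebra :: "('a::euclidean_space \<Rightarrow> real) set" where
  flat: "(\<lambda>x. flat p (c \<bullet> x + d)) \<in> flat_algebra"
| const: "(\<lambda>x. k) \<in> flat_algebra"
| add: "f \<in> flat_algebra \<Longrightarrow> g \<in> flat_algebra \<Longrightarrow> (\<lambda>x. f x + g x) \<in> flat_algebra"
| mult: "f \<in> flat_algebra \<Longrightarrow> g \<in> flat_algebra \<Longrightarrow> (\<lambda>x. f x * g x) \<in> flat_algebra"

lemma flat_algebra_has_derivative: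
  assumes "f \<in> flat_algebra"
  shows "\<exists>D. (\<forall>x. (f has_derivative D x) (at x)) \<and> (\<forall>b. (\<lambda>x. D x b) \<in> flat_algebra)"
  using assms
proof induction
  case (flat p c d)
  let ?q = "[:0, 0, 1:] * (p - pderiv p)"
  have "((\<lambda>x. flat p (c \<bullet> x + d)) has_derivative (\<lambda>h. flat ?q (c \<bullet> x + d) * (c \<bullet> h))) (at x)" for x
  proof -
    have "((\<lambda>x. c \<bullet> x + d) has_derivative (\<lambda>h. c \<bullet> h)) (at x)"
      by (auto intro!: derivative_eq_intros)
    from has_derivative_compose[OF this, of "flat p" "(*) (flat ?q (c \<bullet> x + d))"]
      flat_has_derivative[of p "c \<bullet> x + d"]
    show ?thesis by (simp add: has_field_derivative_def)
  qed
  then show ?case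
    by (intro exI[of _ "\<lambda>x h. flat ?q (c \<bullet> x + d) * (c \<bullet> h)"])
       (auto intro: flat_algebra.intros)
next
  case (const k)
  show ?case
    by (intro exI[of _ "\<lambda>x h. 0"]) (auto intro: flat_algebra.intros)
next
  case (add f g)
  then obtain D E where "\<And>x. (f has_derivative D x) (at x)" "\<And>b. (\<lambda>x. D x b) \<in> flat_algebra"
    "\<And>x. (g has_derivative E x) (at x)" "\<And>b. (\<lambda>x. E x b) \<in> flat_algebra"
    by metis
  then show ?case
    by (intro exI[of _ "\<lambda>x h. D x h + E x h"])
       (auto intro!: derivative_intros intro: flat_algebra.intros)
next
  case (mult f g)
  then obtain D E where "\<And>x. (f has_derivative D x) (at x)" "\<And>b. (\<lambda>x. D x b) \<in> flat_algebra"
    "\<And>x. (g has_derivative E x) (at x)" "\<And>b. (\<lambda>x. E x b) \<in> flat_algebra"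
    by metis
  with mult.hyps show ?case
    by (intro exI[of _ "\<lambda>x h. f x * E x h + D x h * g x"] conjI allI
        has_derivative_mult flat_algebra.add flat_algebra.mult)
qed

lemma flat_algebra_dir_deriv: "f \<in> flat_algebra \<Longrightarrow> dir_deriv b f \<in> flat_algebra"
proof -
  assume "f \<in> flat_algebra"
  from flat_algebra_has_derivative[OF this] obtain D where
    D: "\<And>x. (f has_derivative D x) (at x)" "\<And>b. (\<lambda>x. D x b) \<in> flat_algebra"
    by metis
  then have "dir_deriv b f = (\<lambda>x. D x b)"
    by (metis dir_deriv_def frechet_derivative_at)
  with D show ?thesis by simp
qed

lemma flat_algebra_iter_deriv: "f \<in> flat_algebra \<Longrightarrow> iter_deriv bs f \<in> flat_algebra"
  by (induction bs) (auto intro: flat_algebra_dir_deriv)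

lemma flat_algebra_smooth:
  assumes "f \<in> flat_algebra"
  shows "smooth_on UNIV f"
  unfolding smooth_on_def
proof
  fix bs :: "'a list"
  obtain D where "\<And>x. (iter_deriv bs f has_derivative D x) (at x)"
    using flat_algebra_has_derivative[OF flat_algebra_iter_deriv[OF assms]] by metis
  then show "iter_deriv bs f differentiable_on UNIV"
    unfolding differentiable_on_def differentiable_def by blast
qed

lemma smooth_on_imp_differentiable_on: "smooth_on W f \<Longrightarrow> f differentiable_on W"
  unfolding smooth_on_def using lists.Nil by fastforce

lemma flat_algebra_prod:
  "finite I \<Longrightarrow> (\<And>i. i \<in> I \<Longrightarrow> f i \<in> flat_algebra) \<Longrightarrow> (\<lambda>x. \<Prod>i\<in>I. f i x) \<in> flat_algebra"
  by (induction I rule: finite_induct) (auto intro: flat_algebra.intros)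

text \<open>
  A smooth function with values in \<open>[0,1]\<close> that is nonzero exactly on the open box from \<open>l\<close> to \<open>u\<close>.
  Since \<open>flat 1 (k y) = exp(-1/(k y))\<close> tends to 1 for every \<open>y > 0\<close>, it tends to the indicator of the box
  as \<open>k\<close> grows: rescaling the argument replaces the usual smooth cut-off.
\<close>

definition box_bump :: "real^'d \<Rightarrow> real^'d \<Rightarrow> real \<Rightarrow> real^'d \<Rightarrow> real" where
  "box_bump l u k x = (\<Prod>i\<in>UNIV. flat 1 (k * (x $ i - l $ i)) * flat 1 (k * (u $ i - x $ i)))"

lemma flat_1_bounds: "0 \<le> flat 1 x" "flat 1 x \<le> 1"
  by (auto simp: flat_def)

lemma box_bump_bounds: "0 \<le> box_bump l u k x" "box_bump l u k x \<le> 1"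
  unfolding box_bump_def
  by (auto intro!: prod_nonneg prod_le_1 mult_le_one simp: flat_1_bounds)

lemma box_bump_nonzero:
  assumes "k > 0"
  shows "{x. box_bump l u k x \<noteq> 0} = box l u"
  using assms by (auto simp: box_bump_def flat_def mem_box_cart zero_less_mult_iff)

lemma box_bump_in_flat_algebra: "box_bump l u k \<in> flat_algebra"
proof -
  have *: "(\<lambda>x. flat 1 (k * (x $ i - l $ i))) \<in> flat_algebra" for i
  proof -
    have "(\<lambda>x. flat 1 (k * (x $ i - l $ i))) = (\<lambda>x. flat 1 (axis i k \<bullet> x + - k * l $ i))"
      by (auto simp: inner_axis' algebra_simps)
    then show ?thesis by (simp only: flat_algebra.flat)
  qed
  have **: "(\<lambda>x. flat 1 (k * (u $ i - x $ i))) \<in> flat_algebra" for i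
  proof -
    have "(\<lambda>x. flat 1 (k * (u $ i - x $ i))) = (\<lambda>x. flat 1 (axis i (-k) \<bullet> x + k * u $ i))"
      by (auto simp: inner_axis' algebra_simps)
    then show ?thesis by (simp only: flat_algebra.flat)
  qed
  show ?thesis
    unfolding box_bump_def[abs_def]
    by (intro flat_algebra_prod flat_algebra.mult * **) auto
qed

lemma box_bump_test_function:
  assumes "k > 0" "cbox l u \<subseteq> \<Omega>"
  shows "test_function \<Omega> (box_bump l u k)"
proof -
  have "closure (box l u) \<subseteq> cbox l u"
    by (simp add: box_subset_cbox closure_minimal closed_cbox)
  with assms show ?thesis
    unfolding test_function_def box_bump_nonzero[OF assms(1)]
    using bounded_box compact_closure
    by (auto intro: flat_algebra_smooth box_bump_in_flat_algebra)
qed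

lemma box_bump_tendsto: "(\<lambda>k. box_bump l u (real (Suc k)) x) \<longlonglongrightarrow> indicator (box l u) x"
proof -
  have *: "(\<lambda>k. flat 1 (real (Suc k) * y)) \<longlonglongrightarrow> (if y > 0 then 1 else 0)" for y
  proof (cases "y > 0")
    case True
    have "(\<lambda>k. exp (- (1 / y * inverse (real (Suc k))))) \<longlonglongrightarrow> exp (- (1 / y * 0))"
      by (intro tendsto_intros LIMSEQ_inverse_real_of_nat)
    moreover have "flat 1 (real (Suc k) * y) = exp (- (1 / y * inverse (real (Suc k))))" for k
      using True by (simp add: flat_def zero_less_mult_iff inverse_eq_divide mult.commute del: of_nat_Suc)
    ultimately show ?thesis
      using True by simp
  next
    case False
    then show ?thesis
      by (simp add: flat_def zero_less_mult_iff del: of_nat_Suc)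
  qed
  have "(\<lambda>k. box_bump l u (real (Suc k)) x) \<longlonglongrightarrow>
          (\<Prod>i\<in>UNIV. (if x $ i - l $ i > 0 then 1 else 0) * (if u $ i - x $ i > 0 then 1 else 0))"
    unfolding box_bump_def by (intro tendsto_prod tendsto_mult *)
  also have "(\<Prod>i\<in>UNIV. (if x $ i - l $ i > 0 then 1 else 0) * (if u $ i - x $ i > 0 then 1 else 0))
      = (indicator (box l u) x :: real)"
    by (auto simp: indicator_def mem_box_cart)
  finally show ?thesis .
qed

section \<open>The space \<open>L\<^sup>2\<close>\<close>

lemma L2D:
  assumes "v \<in> L2 \<Omega>"
  shows "v \<in> borel_measurable (lebesgue_on \<Omega>)" "integrable (lebesgue_on \<Omega>) (\<lambda>x. (norm (v x))\<^sup>2)"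
  using assms by (auto simp: L2_def)

lemma L2_inner_integrable:
  fixes u v :: "real^'d \<Rightarrow> 'b::euclidean_space"
  assumes "u \<in> L2 \<Omega>" "v \<in> L2 \<Omega>"
  shows "integrable (lebesgue_on \<Omega>) (\<lambda>x. u x \<bullet> v x)"
proof (rule Bochner_Integration.integrable_bound)
  show "integrable (lebesgue_on \<Omega>) (\<lambda>x. (norm (u x))\<^sup>2 + (norm (v x))\<^sup>2)"
    using assms by (intro Bochner_Integration.integrable_add L2D)
  show "(\<lambda>x. u x \<bullet> v x) \<in> borel_measurable (lebesgue_on \<Omega>)"
    using assms[THEN L2D(1)] by simp
  have "norm (p \<bullet> q) \<le> norm ((norm p)\<^sup>2 + (norm q)\<^sup>2)" for p q :: 'b
  proof -
    have "\<bar>p \<bullet> q\<bar> \<le> norm p * norm q" by (rule Cauchy_Schwarz_ineq2)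
    also have "\<dots> \<le> (norm p)\<^sup>2 + (norm q)\<^sup>2"
      using sum_squares_bound[of "norm p" "norm q"] norm_ge_zero[of p] norm_ge_zero[of q]
        mult_nonneg_nonneg[OF norm_ge_zero[of p] norm_ge_zero[of q]] by linarith
    finally show ?thesis by simp
  qed
  then show "AE x in lebesgue_on \<Omega>. norm (u x \<bullet> v x) \<le> norm ((norm (u x))\<^sup>2 + (norm (v x))\<^sup>2)"
    by simp
qed

lemma l2_norm_nonneg: "0 \<le> l2_norm \<Omega> v"
  unfolding l2_norm_def l2_inner_def by (auto intro!: Bochner_Integration.integral_nonneg)

lemma l2_norm_power2: "(l2_norm \<Omega> v)\<^sup>2 = l2_inner \<Omega> v v"
  unfolding l2_norm_def l2_inner_def by (auto intro!: Bochner_Integration.integral_nonneg)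

lemma l2_inner_self: "l2_inner \<Omega> v v = (LINT x|lebesgue_on \<Omega>. (norm (v x))\<^sup>2)"
  by (simp add: l2_inner_def power2_norm_eq_inner)

lemma l2_inner_commute: "l2_inner \<Omega> u v = l2_inner \<Omega> v u"
  by (simp add: l2_inner_def inner_commute)

lemma l2_inner_cong_AE:
  assumes "u \<in> borel_measurable (lebesgue_on \<Omega>)" "u' \<in> borel_measurable (lebesgue_on \<Omega>)"
    "v \<in> borel_measurable (lebesgue_on \<Omega>)" "v' \<in> borel_measurable (lebesgue_on \<Omega>)"
    "AE x in lebesgue_on \<Omega>. u x = u' x" "AE x in lebesgue_on \<Omega>. v x = v' x"
  shows "l2_inner \<Omega> u v = l2_inner \<Omega> u' v'"
  unfolding l2_inner_def
  by (rule integral_cong_AE) (use assms in \<open>auto elim: eventually_elim2\<close>)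

lemma l2_norm_cong_AE:
  assumes "u \<in> borel_measurable (lebesgue_on \<Omega>)" "v \<in> borel_measurable (lebesgue_on \<Omega>)"
    "AE x in lebesgue_on \<Omega>. u x = v x"
  shows "l2_norm \<Omega> u = l2_norm \<Omega> v"
  unfolding l2_norm_def using assms by (auto intro!: arg_cong[where f = sqrt] l2_inner_cong_AE)

lemma L2_dominated:
  assumes "v \<in> L2 \<Omega>" "w \<in> borel_measurable (lebesgue_on \<Omega>)" "0 \<le> C"
    "AE x in lebesgue_on \<Omega>. norm (w x) \<le> C * norm (v x)"
  shows "w \<in> L2 \<Omega>" "l2_norm \<Omega> w \<le> C * l2_norm \<Omega> v"
proof -
  have int: "integrable (lebesgue_on \<Omega>) (\<lambda>x. C\<^sup>2 * (norm (v x))\<^sup>2)"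
    using L2D(2)[OF assms(1)] by simp
  have ae: "AE x in lebesgue_on \<Omega>. (norm (w x))\<^sup>2 \<le> C\<^sup>2 * (norm (v x))\<^sup>2"
    using assms(4)
  proof eventually_elim
    case (elim x)
    from power_mono[OF this, of 2] show ?case by (simp add: power_mult_distrib)
  qed
  have intw: "integrable (lebesgue_on \<Omega>) (\<lambda>x. (norm (w x))\<^sup>2)"
    by (rule Bochner_Integration.integrable_bound[OF int]) (use assms(2) ae in auto)
  with assms(2) show "w \<in> L2 \<Omega>" by (simp add: L2_def)
  have "(l2_norm \<Omega> w)\<^sup>2 \<le> (LINT x|lebesgue_on \<Omega>. C\<^sup>2 * (norm (v x))\<^sup>2)"
    unfolding l2_norm_power2 l2_inner_self
    by (rule integral_mono_AE[OF intw int ae])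
  also have "\<dots> = (C * l2_norm \<Omega> v)\<^sup>2"
    by (simp add: power_mult_distrib l2_norm_power2 l2_inner_self)
  finally show "l2_norm \<Omega> w \<le> C * l2_norm \<Omega> v"
    by (rule power2_le_imp_le) (simp add: assms(3) l2_norm_nonneg)
qed

lemma L2_scaleR:
  assumes "v \<in> L2 \<Omega>" shows "(\<lambda>x. c *\<^sub>R v x) \<in> L2 \<Omega>"
  by (rule L2_dominated(1)[OF assms, where C = "\<bar>c\<bar>"]) (use L2D(1)[OF assms] in auto)

lemma l2_norm_scaleR: "l2_norm \<Omega> (\<lambda>x. c *\<^sub>R v x) = \<bar>c\<bar> * l2_norm \<Omega> v"
  by (simp add: l2_norm_def l2_inner_def real_sqrt_mult power2_eq_square[symmetric]
      mult.assoc[symmetric])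

lemma L2_add:
  assumes "u \<in> L2 \<Omega>" "v \<in> L2 \<Omega>"
  shows "(\<lambda>x. u x + v x) \<in> L2 \<Omega>"
proof -
  have "integrable (lebesgue_on \<Omega>) (\<lambda>x. (norm (u x))\<^sup>2 + (norm (v x))\<^sup>2 + 2 * (u x \<bullet> v x))"
    using assms
    by (intro Bochner_Integration.integrable_add integrable_mult_right L2D(2) L2_inner_integrable)
  moreover have "(norm (u x + v x))\<^sup>2 = (norm (u x))\<^sup>2 + (norm (v x))\<^sup>2 + 2 * (u x \<bullet> v x)" for x
    by (simp add: power2_norm_eq_inner inner_add inner_commute)
  moreover have "(\<lambda>x. u x + v x) \<in> borel_measurable (lebesgue_on \<Omega>)"
    by (intro borel_measurable_add L2D(1) assms)
  ultimately show ?thesis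
    by (simp add: L2_def)
qed

lemma L2_diff:
  assumes "u \<in> L2 \<Omega>" "v \<in> L2 \<Omega>"
  shows "(\<lambda>x. u x - v x) \<in> L2 \<Omega>"
  using L2_add[OF assms(1) L2_scaleR[OF assms(2), of "-1"]] by simp

lemma l2_inner_add_left:
  "u \<in> L2 \<Omega> \<Longrightarrow> v \<in> L2 \<Omega> \<Longrightarrow> w \<in> L2 \<Omega> \<Longrightarrow>
   l2_inner \<Omega> (\<lambda>x. u x + v x) w = l2_inner \<Omega> u w + l2_inner \<Omega> v w"
  by (simp add: l2_inner_def inner_add_left L2_inner_integrable)

lemma l2_inner_diff_left:
  "u \<in> L2 \<Omega> \<Longrightarrow> v \<in> L2 \<Omega> \<Longrightarrow> w \<in> L2 \<Omega> \<Longrightarrow>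
   l2_inner \<Omega> (\<lambda>x. u x - v x) w = l2_inner \<Omega> u w - l2_inner \<Omega> v w"
  by (simp add: l2_inner_def inner_diff_left L2_inner_integrable)

lemma l2_inner_scaleR_left: "l2_inner \<Omega> (\<lambda>x. c *\<^sub>R u x) w = c * l2_inner \<Omega> u w"
  by (simp add: l2_inner_def)

lemma l2_Cauchy_Schwarz:
  assumes "u \<in> L2 \<Omega>" "v \<in> L2 \<Omega>"
  shows "\<bar>l2_inner \<Omega> u v\<bar> \<le> l2_norm \<Omega> u * l2_norm \<Omega> v"
proof -
  have expand: "0 \<le> s\<^sup>2 * l2_inner \<Omega> u u + 2 * s * t * l2_inner \<Omega> u v + t\<^sup>2 * l2_inner \<Omega> v v" for s t
  proof -
    let ?w = "\<lambda>x. s *\<^sub>R u x + t *\<^sub>R v x"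
    have "0 \<le> l2_inner \<Omega> ?w ?w"
      unfolding l2_inner_self by (auto intro!: Bochner_Integration.integral_nonneg)
    also have "l2_inner \<Omega> ?w ?w = s * l2_inner \<Omega> u ?w + t * l2_inner \<Omega> v ?w"
      using assms by (subst l2_inner_add_left) (auto intro!: L2_add L2_scaleR simp: l2_inner_scaleR_left)
    also have "l2_inner \<Omega> u ?w = s * l2_inner \<Omega> u u + t * l2_inner \<Omega> u v"
      using assms by (subst l2_inner_commute, subst l2_inner_add_left)
         (auto intro!: L2_add L2_scaleR simp: l2_inner_scaleR_left l2_inner_commute)
    also have "l2_inner \<Omega> v ?w = s * l2_inner \<Omega> u v + t * l2_inner \<Omega> v v"
      using assms by (subst l2_inner_commute, subst l2_inner_add_left)
         (auto intro!: L2_add L2_scaleR simp: l2_inner_scaleR_left l2_inner_commute)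
    finally show ?thesis by (simp add: power2_eq_square algebra_simps)
  qed
  define a b c where "a = l2_inner \<Omega> u u" and "b = l2_inner \<Omega> u v" and "c = l2_inner \<Omega> v v"
  have "b\<^sup>2 \<le> a * c"
  proof (cases "c = 0")
    case True
    have "b = 0"
    proof (rule ccontr)
      assume "b \<noteq> 0"
      \<comment> \<open>As \<open>c = 0\<close>, the quadratic form is affine in \<open>t\<close>; this value of \<open>t\<close> makes it equal to \<open>-1\<close>.\<close>
      have "0 \<le> a + 2 * 1 * (- (a + 1) / (2 * b)) * b"
        using expand[of 1 "- (a + 1) / (2 * b)"] True
        by (simp add: a_def[symmetric] b_def[symmetric] c_def[symmetric])
      with \<open>b \<noteq> 0\<close> show False by (simp add: field_simps)
    qed
    with True show ?thesis by simp
  next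
    case False
    have "0 \<le> c"
      unfolding c_def l2_inner_self by (auto intro!: Bochner_Integration.integral_nonneg)
    with False have "c > 0" by simp
    \<comment> \<open>the minimising direction\<close>
    have "0 \<le> c\<^sup>2 * a + 2 * c * (- b) * b + (- b)\<^sup>2 * c"
      using expand[of c "- b"] by (simp add: a_def[symmetric] b_def[symmetric] c_def[symmetric])
    also have "\<dots> = c * (a * c - b\<^sup>2)"
      by (simp add: power2_eq_square algebra_simps)
    finally show ?thesis using \<open>c > 0\<close> by (simp add: zero_le_mult_iff)
  qed
  then have "sqrt (b\<^sup>2) \<le> sqrt (a * c)" by (rule real_sqrt_le_mono)
  then show ?thesis
    by (simp add: a_def b_def c_def l2_norm_def real_sqrt_mult)
qed

lemma l2_norm_triangle:
  assumes "u \<in> L2 \<Omega>" "v \<in> L2 \<Omega>"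
  shows "l2_norm \<Omega> (\<lambda>x. u x + v x) \<le> l2_norm \<Omega> u + l2_norm \<Omega> v"
proof (rule power2_le_imp_le)
  let ?w = "\<lambda>x. u x + v x"
  have "(l2_norm \<Omega> ?w)\<^sup>2 = l2_inner \<Omega> u ?w + l2_inner \<Omega> v ?w"
    unfolding l2_norm_power2 using assms by (subst l2_inner_add_left) (auto intro: L2_add)
  also have "l2_inner \<Omega> u ?w = l2_inner \<Omega> u u + l2_inner \<Omega> u v"
    using assms by (subst l2_inner_commute, subst l2_inner_add_left) (auto simp: l2_inner_commute)
  also have "l2_inner \<Omega> v ?w = l2_inner \<Omega> u v + l2_inner \<Omega> v v"
    using assms by (subst l2_inner_commute, subst l2_inner_add_left) (auto simp: l2_inner_commute)
  finally have "(l2_norm \<Omega> ?w)\<^sup>2 = (l2_norm \<Omega> u)\<^sup>2 + (l2_norm \<Omega> v)\<^sup>2 + 2 * l2_inner \<Omega> u v"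
    by (simp add: l2_norm_power2)
  also have "\<dots> \<le> (l2_norm \<Omega> u + l2_norm \<Omega> v)\<^sup>2"
    using l2_Cauchy_Schwarz[OF assms] by (simp add: power2_sum)
  finally show "(l2_norm \<Omega> ?w)\<^sup>2 \<le> (l2_norm \<Omega> u + l2_norm \<Omega> v)\<^sup>2" .
qed (simp add: l2_norm_nonneg)

lemma L2_Pair:
  assumes "u \<in> L2 \<Omega>" "v \<in> L2 \<Omega>"
  shows "(\<lambda>x. (u x, v x)) \<in> L2 \<Omega>"
  using assms unfolding L2_def
  by (auto simp: norm_prod_def intro!: borel_measurable_Pair)

lemma l2_norm_Pair:
  assumes "u \<in> L2 \<Omega>" "v \<in> L2 \<Omega>"
  shows "(l2_norm \<Omega> (\<lambda>x. (u x, v x)))\<^sup>2 = (l2_norm \<Omega> u)\<^sup>2 + (l2_norm \<Omega> v)\<^sup>2"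
  unfolding l2_norm_power2 l2_inner_def inner_prod_def
  using assms by (simp add: L2_inner_integrable)

lemma L2_bounded:
  assumes "\<Omega> \<in> lmeasurable" "w \<in> borel_measurable (lebesgue_on \<Omega>)"
    "AE x in lebesgue_on \<Omega>. norm (w x) \<le> C"
  shows "w \<in> L2 \<Omega>"
proof -
  have sp: "emeasure (lebesgue_on \<Omega>) (space (lebesgue_on \<Omega>)) = emeasure lebesgue \<Omega>"
    using assms(1) by (subst emeasure_restrict_space) (auto simp: fmeasurable_def space_restrict_space)
  then have "finite_measure (lebesgue_on \<Omega>)"
    using assms(1) by (intro finite_measureI) (auto simp: fmeasurable_def)
  then have one: "(\<lambda>x. 1::real) \<in> L2 \<Omega>"
    using finite_measure.integrable_const[of "lebesgue_on \<Omega>" "1::real"] by (simp add: L2_def)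
  have "AE x in lebesgue_on \<Omega>. norm (w x) \<le> \<bar>C\<bar> * norm (1::real)"
    using assms(3) by eventually_elim auto
  from L2_dominated(1)[OF one assms(2) _ this] show ?thesis by simp
qed

section \<open>The fundamental lemma of the calculus of variations\<close>

text \<open>
  The positive and the negative part have the same integral over every box, so they are densities of
  the same finite measure.
\<close>

lemma integrable_zero_on_boxes:
  fixes f :: "'a::euclidean_space \<Rightarrow> real"
  assumes f: "integrable lborel f"
    and zero: "\<And>l u. (LINT x|lborel. f x * indicator (box l u) x) = 0"
  shows "AE x in lborel. f x = 0"
proof -
  let ?p = "\<lambda>x. ennreal (f x)" and ?n = "\<lambda>x. ennreal (- f x)"
  have [measurable]: "f \<in> borel_measurable lborel" using f by auto
  have fin: "(\<integral>\<^sup>+x. ?p x \<partial>lborel) \<noteq> \<infinity>" "(\<integral>\<^sup>+x. ?n x \<partial>lborel) \<noteq> \<infinity>"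
    using f by (auto simp: real_integrable_def)
  have eq: "density lborel ?p = density lborel ?n"
  proof (rule measure_eqI_generator_eq[where \<Omega> = UNIV and E = "range (\<lambda>(a, b). box a b)"
        and A = "\<lambda>n::nat. box (- (real n *\<^sub>R One)) (real n *\<^sub>R One)"])
    show "Int_stable (range (\<lambda>(a, b). box a b :: 'a set))"
      by (auto simp: Int_stable_def box_Int_box)
    show "sets (density lborel ?p) = sigma_sets UNIV (range (\<lambda>(a, b). box a b))"
      "sets (density lborel ?n) = sigma_sets UNIV (range (\<lambda>(a, b). box a b))"
      by (simp_all add: borel_eq_box)
    show "(\<Union>i. box (- (real i *\<^sub>R One)) (real i *\<^sub>R One)) = (UNIV :: 'a set)"
      unfolding UN_box_eq_UNIV by auto
    fix i :: nat
    have "emeasure (density lborel ?p) (box (- (real i *\<^sub>R One)) (real i *\<^sub>R One)) \<le> (\<integral>\<^sup>+x. ?p x \<partial>lborel)"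
      by (subst emeasure_density) (auto intro!: nn_integral_mono split: split_indicator)
    with fin show "emeasure (density lborel ?p) (box (- (real i *\<^sub>R One)) (real i *\<^sub>R One)) \<noteq> \<infinity>"
      by (auto simp: top_unique)
  next
    fix X :: "'a set" assume "X \<in> range (\<lambda>(a, b). box a b)"
    then obtain a b where X: "X = box a b" by auto
    have int: "integrable lborel (\<lambda>x. f x * indicator X x)"
      using f unfolding X by (intro integrable_real_mult_indicator) auto
    have "(\<integral>\<^sup>+x. ennreal (f x * indicator X x) \<partial>lborel) = (\<integral>\<^sup>+x. ennreal (- (f x * indicator X x)) \<partial>lborel)"
    proof -
      let ?P = "\<integral>\<^sup>+x. ennreal (f x * indicator X x) \<partial>lborel"
        and ?N = "\<integral>\<^sup>+x. ennreal (- (f x * indicator X x)) \<partial>lborel"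
      have "enn2real ?P = enn2real ?N"
        using zero[of a b] real_lebesgue_integral_def[OF int] unfolding X by simp
      moreover have "?P \<noteq> \<infinity>" "?N \<noteq> \<infinity>"
        using int by (auto simp: real_integrable_def)
      then have "ennreal (enn2real ?P) = ?P" "ennreal (enn2real ?N) = ?N"
        by (simp_all add: ennreal_enn2real_if)
      ultimately show ?thesis by metis
    qed
    moreover have "ennreal (f x * indicator X x) = ?p x * indicator X x"
      "ennreal (- (f x * indicator X x)) = ?n x * indicator X x" for x
      by (auto split: split_indicator)
    ultimately show "emeasure (density lborel ?p) X = emeasure (density lborel ?n) X"
      using X by (simp add: emeasure_density)
  qed auto
  have "AE x in lborel. ?p x = ?n x"
    using fin eq by (subst (asm) finite_density_unique) auto
  then show ?thesis
  proof eventually_elim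
    case (elim x)
    then show ?case
      by (cases "f x" "0::real" rule: linorder_cases) (auto simp: ennreal_neg)
  qed
qed

lemma AE_zero_if_zero_on_boxes:
  fixes f :: "'a::euclidean_space \<Rightarrow> real"
  assumes f: "integrable lebesgue f"
    and zero: "\<And>l u. (LINT x|lebesgue. f x * indicator (box l u) x) = 0"
  shows "AE x in lebesgue. f x = 0"
proof -
  obtain g where g[measurable]: "g \<in> borel_measurable lborel" and ae: "AE x in lborel. f x = g x"
    using completion_ex_borel_measurable_real[of f lborel] f by auto
  have [measurable]: "f \<in> borel_measurable lebesgue" using f by auto
  have gl[measurable]: "g \<in> borel_measurable lebesgue" using g by (simp add: measurable_completion)
  have ae': "AE x in lebesgue. f x = g x" using ae by (rule AE_completion)
  have "integrable lebesgue g"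
    using f integrable_cong_AE[OF _ gl ae'] by auto
  then have "integrable lborel g" using g by (simp add: integrable_completion)
  moreover have "(LINT x|lborel. g x * indicator (box l u) x) = 0" for l u
  proof -
    have "(LINT x|lborel. g x * indicator (box l u) x) = (LINT x|lebesgue. g x * indicator (box l u) x)"
      by (rule integral_completion[symmetric]) auto
    also have "\<dots> = (LINT x|lebesgue. f x * indicator (box l u) x)"
    proof (rule integral_cong_AE)
      have "(indicator (box l u) :: 'a \<Rightarrow> real) \<in> borel_measurable lebesgue"
        by (intro measurable_completion) simp
      then show "(\<lambda>x. g x * indicator (box l u) x) \<in> borel_measurable lebesgue"
        "(\<lambda>x. f x * indicator (box l u) x) \<in> borel_measurable lebesgue"
        by simp_all
    qed (use ae' in auto)
    finally show ?thesis using zero by simp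
  qed
  ultimately have "AE x in lborel. g x = 0" by (rule integrable_zero_on_boxes)
  then show ?thesis
    using ae' AE_completion by (smt (verit, best) eventually_elim2)
qed

lemma fundamental_lemma_of_variations:
  fixes w :: "real^'d \<Rightarrow> real"
  assumes \<Omega>: "open \<Omega>" "bounded \<Omega>" and w: "w \<in> L2 \<Omega>"
    and zero: "\<And>\<phi>. test_function \<Omega> \<phi> \<Longrightarrow> l2_inner \<Omega> w \<phi> = 0"
  shows "AE x in lebesgue_on \<Omega>. w x = 0"
proof -
  have lm: "\<Omega> \<in> lmeasurable" using \<Omega> by (simp add: lmeasurable_open)
  then have [measurable]: "\<Omega> \<in> sets lebesgue" by auto
  have wm[measurable]: "w \<in> borel_measurable (lebesgue_on \<Omega>)" using L2D(1)[OF w] .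
  have "(\<lambda>x. 1::real) \<in> L2 \<Omega>"
    by (rule L2_bounded(1)[OF lm, where C = 1]) auto
  from L2_inner_integrable[OF w this] have wint: "integrable (lebesgue_on \<Omega>) w" by simp
  then have W: "integrable lebesgue (\<lambda>x. indicator \<Omega> x * w x)"
    by (simp add: integrable_restrict_space)
  have box0: "(LINT x|lebesgue. indicator \<Omega> x * w x * indicator (box l u) x) = 0"
    if "cbox l u \<subseteq> \<Omega>" for l u
  proof -
    have "(\<lambda>k. LINT x|lebesgue_on \<Omega>. w x * box_bump l u (real (Suc k)) x) \<longlonglongrightarrow>
            (LINT x|lebesgue_on \<Omega>. w x * indicator (box l u) x)"
    proof (rule integral_dominated_convergence[where w = "\<lambda>x. norm (w x)"])
      have "continuous_on UNIV (box_bump l u k)" for k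
        by (intro differentiable_imp_continuous_on smooth_on_imp_differentiable_on
            flat_algebra_smooth box_bump_in_flat_algebra)
      then have [measurable]: "box_bump l u k \<in> borel_measurable borel" for k
        by (rule borel_measurable_continuous_onI)
      show "(\<lambda>x. w x * box_bump l u (real (Suc i)) x) \<in> borel_measurable (lebesgue_on \<Omega>)" for i
      proof -
        have "box_bump l u (real (Suc i)) \<in> borel_measurable (lebesgue_on \<Omega>)"
          by (intro measurable_restrict_space1 measurable_completion) simp
        then show ?thesis by simp
      qed
      show "(\<lambda>x. w x * indicator (box l u) x) \<in> borel_measurable (lebesgue_on \<Omega>)"
      proof -
        have "(indicator (box l u) :: _ \<Rightarrow> real) \<in> borel_measurable (lebesgue_on \<Omega>)"
          by (intro measurable_restrict_space1 measurable_completion) simp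
        then show ?thesis by simp
      qed
      show "AE x in lebesgue_on \<Omega>. norm (w x * box_bump l u (real (Suc i)) x) \<le> norm (w x)" for i
        by (auto simp: abs_mult box_bump_bounds intro!: mult_left_le)
      show "AE x in lebesgue_on \<Omega>. (\<lambda>k. w x * box_bump l u (real (Suc k)) x)
              \<longlonglongrightarrow> w x * indicator (box l u) x"
        by (intro AE_I2 tendsto_mult tendsto_const box_bump_tendsto)
    qed (use wint in auto)
    moreover have "(LINT x|lebesgue_on \<Omega>. w x * box_bump l u (real (Suc k)) x) = 0" for k
      using zero[OF box_bump_test_function[OF _ that, of "real (Suc k)"]] by (simp add: l2_inner_def)
    ultimately have "(LINT x|lebesgue_on \<Omega>. w x * indicator (box l u) x) = 0"
      using LIMSEQ_unique[OF tendsto_const] by fastforce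
    then show ?thesis
      by (simp add: integral_restrict_space mult.assoc)
  qed
  have ae_box: "AE x in lebesgue. x \<in> box l u \<longrightarrow> indicator \<Omega> x * w x = 0" if "cbox l u \<subseteq> \<Omega>" for l u
  proof -
    let ?f = "\<lambda>x. indicator \<Omega> x * w x * indicator (box l u) x"
    \<comment> \<open>Integrating \<open>?f\<close> over a further box only shrinks the box, which stays inside \<open>\<Omega>\<close>.\<close>
    have "AE x in lebesgue. ?f x = 0"
    proof (rule AE_zero_if_zero_on_boxes)
      show "integrable lebesgue ?f"
        by (rule integrable_real_mult_indicator[OF _ W]) simp
      fix l' u' :: "real^'d"
      obtain l'' u'' where I: "box l u \<inter> box l' u' = box l'' u''" "cbox l'' u'' \<subseteq> cbox l u \<or> box l'' u'' = {}"
      proof (cases "box l u \<inter> box l' u' = {}")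
        case True
        then show ?thesis using that[of 1 0] by (force simp: mem_box_cart)
      next
        case False
        have "cbox (\<Sum>i\<in>Basis. max (l \<bullet> i) (l' \<bullet> i) *\<^sub>R i) (\<Sum>i\<in>Basis. min (u \<bullet> i) (u' \<bullet> i) *\<^sub>R i) \<subseteq> cbox l u"
          by (auto simp: mem_box)
        then show ?thesis
          using that box_Int_box by blast
      qed
      show "(LINT x|lebesgue. ?f x * indicator (box l' u') x) = 0"
      proof (cases "box l'' u'' = {}")
        case True
        have "(\<lambda>x. ?f x * indicator (box l' u') x) = (\<lambda>x. 0)"
          by (simp add: mult.assoc indicator_inter_arith[symmetric] I(1) True)
        then show ?thesis by simp
      next
        case False
        have "(\<lambda>x. ?f x * indicator (box l' u') x) = (\<lambda>x. indicator \<Omega> x * w x * indicator (box l'' u'') x)"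
          by (simp add: mult.assoc indicator_inter_arith[symmetric] I(1))
        then show ?thesis
          using box0[of l'' u''] I(2) False that by auto
      qed
    qed
    then show ?thesis by eventually_elim auto
  qed
  obtain \<D> where \<D>: "countable \<D>" "\<D> \<subseteq> Pow \<Omega>" "\<And>X. X \<in> \<D> \<Longrightarrow> \<exists>a b. X = cbox a b" "\<Union>\<D> = \<Omega>"
    using open_countable_Union_open_cbox[OF \<Omega>(1)] by metis
  have "AE x in lebesgue. x \<in> X \<longrightarrow> indicator \<Omega> x * w x = 0" if "X \<in> \<D>" for X
  proof -
    obtain a b where X: "X = cbox a b" using \<D>(3) \<open>X \<in> \<D>\<close> by blast
    have "negligible (cbox a b - box a b)"
      by (rule negligible_frontier_interval)
    then have "AE x in lebesgue. x \<notin> cbox a b - box a b"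
      by (intro AE_not_in) (simp add: negligible_iff_null_sets)
    moreover have "cbox a b \<subseteq> \<Omega>" using X \<D>(2) \<open>X \<in> \<D>\<close> by auto
    ultimately show ?thesis
      using ae_box[of a b] unfolding X by (auto elim: eventually_elim2)
  qed
  then have "AE x in lebesgue. \<forall>X\<in>\<D>. x \<in> X \<longrightarrow> indicator \<Omega> x * w x = 0"
    by (subst AE_ball_countable[OF \<D>(1)]) blast
  then have "AE x in lebesgue. x \<in> \<Omega> \<longrightarrow> w x = 0"
  proof eventually_elim
    case (elim x)
    then show ?case using \<D>(4) by (auto simp: indicator_def)
  qed
  then show ?thesis by (simp add: AE_restrict_space_iff)
qed

section \<open>Weak gradients and the \<open>H\<^sup>1\<close> norm\<close>

lemma smooth_iter_deriv_L2:
  fixes \<phi> :: "real^'d \<Rightarrow> real"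
  assumes "\<Omega> \<in> lmeasurable" "bounded \<Omega>" "smooth_on UNIV \<phi>" "bs \<in> lists Basis"
  shows "iter_deriv bs \<phi> \<in> L2 \<Omega>"
proof -
  have cont: "continuous_on S (iter_deriv bs \<phi>)" for S
    using assms(3,4) unfolding smooth_on_def
    by (meson continuous_on_subset differentiable_imp_continuous_on subset_UNIV)
  have "compact (iter_deriv bs \<phi> ` closure \<Omega>)"
    using assms(2) by (intro compact_continuous_image cont) (simp add: compact_closure)
  then obtain C where C: "\<And>x. x \<in> closure \<Omega> \<Longrightarrow> norm (iter_deriv bs \<phi> x) \<le> C"
    by (meson bounded_iff compact_imp_bounded imageI)
  show ?thesis
  proof (rule L2_bounded(1)[OF assms(1)])
    show "iter_deriv bs \<phi> \<in> borel_measurable (lebesgue_on \<Omega>)"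
      using borel_measurable_continuous_onI[OF cont]
      by (intro measurable_restrict_space1 measurable_completion) simp
    show "AE x in lebesgue_on \<Omega>. norm (iter_deriv bs \<phi> x) \<le> C"
      using C closure_subset by (intro AE_I2) (auto simp: space_restrict_space)
  qed
qed

lemma test_function_L2:
  assumes "\<Omega> \<in> lmeasurable" "bounded \<Omega>" "test_function \<Omega> \<phi>"
  shows "\<phi> \<in> L2 \<Omega>" "iter_deriv (map (\<lambda>i. axis i 1) is) \<phi> \<in> L2 \<Omega>"
proof -
  have "smooth_on UNIV \<phi>" using assms(3) by (simp add: test_function_def)
  note * = smooth_iter_deriv_L2[OF assms(1,2) this]
  show "\<phi> \<in> L2 \<Omega>" using *[of "[]"] by simp
  show "iter_deriv (map (\<lambda>i. axis i 1) is) \<phi> \<in> L2 \<Omega>"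
    by (intro *) (auto simp: axis_in_Basis_iff)
qed

text \<open>
  The defining identity of a weak derivative speaks of enumerations of the multi-index; the list \<open>js\<close> is
  one, and makes it applicable.
\<close>

lemma weak_deriv_unique:
  assumes "open \<Omega>" "bounded \<Omega>" "\<forall>i. count_list js i = m i"
    and "weak_deriv \<Omega> m v w" "weak_deriv \<Omega> m v w'"
  shows "AE x in lebesgue_on \<Omega>. w x = w' x"
proof -
  have lm: "\<Omega> \<in> lmeasurable" using assms by (simp add: lmeasurable_open)
  have w: "w \<in> L2 \<Omega>" "w' \<in> L2 \<Omega>" using assms by (auto simp: weak_deriv_def)
  have "AE x in lebesgue_on \<Omega>. w x - w' x = 0"
  proof (rule fundamental_lemma_of_variations[OF assms(1,2) L2_diff[OF w]])
    fix \<phi> assume \<phi>: "test_function \<Omega> \<phi>"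
    then have "(-1) ^ mi_order m * l2_inner \<Omega> w \<phi> = (-1) ^ mi_order m * l2_inner \<Omega> w' \<phi>"
      using assms(3-5) unfolding weak_deriv_def by metis
    then show "l2_inner \<Omega> (\<lambda>x. w x - w' x) \<phi> = 0"
      using w test_function_L2(1)[OF lm assms(2) \<phi>] by (simp add: l2_inner_diff_left)
  qed
  then show ?thesis by simp
qed

lemma weak_deriv_lincomb:
  assumes "\<Omega> \<in> lmeasurable" "bounded \<Omega>" "v \<in> L2 \<Omega>" "v' \<in> L2 \<Omega>"
    and "weak_deriv \<Omega> m v w" "weak_deriv \<Omega> m v' w'"
  shows "weak_deriv \<Omega> m (\<lambda>x. a * v x + b * v' x) (\<lambda>x. a * w x + b * w' x)"
proof -
  have lin: "l2_inner \<Omega> (\<lambda>x. a * p x + b * q x) \<psi> = a * l2_inner \<Omega> p \<psi> + b * l2_inner \<Omega> q \<psi>"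
    if "p \<in> L2 \<Omega>" "q \<in> L2 \<Omega>" "\<psi> \<in> L2 \<Omega>" for p q \<psi> :: "real^'a \<Rightarrow> real"
    using l2_inner_add_left[OF L2_scaleR[OF that(1), of a] L2_scaleR[OF that(2), of b] that(3)]
      l2_inner_scaleR_left[of \<Omega> a p \<psi>] l2_inner_scaleR_left[of \<Omega> b q \<psi>] by simp
  have w: "w \<in> L2 \<Omega>" "w' \<in> L2 \<Omega>" using assms by (auto simp: weak_deriv_def)
  then have "(\<lambda>x. a * w x + b * w' x) \<in> L2 \<Omega>"
    using L2_add[OF L2_scaleR[OF w(1), of a] L2_scaleR[OF w(2), of b]] by simp
  moreover have "l2_inner \<Omega> (\<lambda>x. a * v x + b * v' x) (iter_deriv (map (\<lambda>i. axis i 1) is) \<phi>) =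
      (-1) ^ mi_order m * l2_inner \<Omega> (\<lambda>x. a * w x + b * w' x) \<phi>"
    if "test_function \<Omega> \<phi>" "\<forall>i. count_list is i = m i" for \<phi> "is"
    using assms(3-6) that w test_function_L2[OF assms(1,2) that(1)] unfolding weak_deriv_def
    by (simp add: lin algebra_simps)
  ultimately show ?thesis unfolding weak_deriv_def by blast
qed

lemma weak_deriv_order_0:
  assumes "v \<in> L2 \<Omega>" shows "weak_deriv \<Omega> (\<lambda>_. 0) v v"
proof -
  have "is = []" if "\<forall>i. count_list is i = 0" for "is" :: "'d list"
    using that by (cases "is") (auto split: if_splits dest: spec)
  with assms show ?thesis by (force simp: weak_deriv_def mi_order_def)
qed

text \<open>The multi-index of the first-order derivative in direction \<open>i\<close>.\<close>

abbreviation unit_mi :: "'d \<Rightarrow> 'd \<Rightarrow> nat" where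
  "unit_mi i \<equiv> (\<lambda>j. if j = i then 1 else 0)"

lemma mi_order_unit_mi: "mi_order (unit_mi i) = 1"
  by (simp add: mi_order_def)

lemma mi_order_le_1: "{m :: 'd::finite \<Rightarrow> nat. mi_order m \<le> 1} = insert (\<lambda>_. 0) (range unit_mi)"
proof (intro equalityI subsetI)
  fix m :: "'d \<Rightarrow> nat" assume "m \<in> {m. mi_order m \<le> 1}"
  then have le: "(\<Sum>j\<in>UNIV. m j) \<le> 1" by (simp add: mi_order_def)
  show "m \<in> insert (\<lambda>_. 0) (range unit_mi)"
  proof (cases "\<exists>i. m i \<noteq> 0")
    case True
    then obtain i where i: "m i \<noteq> 0" by blast
    have "(\<Sum>j\<in>UNIV. m j) = m i + (\<Sum>j\<in>UNIV - {i}. m j)"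
      by (simp add: sum.remove)
    with le i have "m i = 1" "(\<Sum>j\<in>UNIV - {i}. m j) = 0" by linarith+
    then have "m = unit_mi i" by (simp add: fun_eq_iff)
    then show ?thesis by blast
  qed auto
qed (auto simp: mi_order_def)

lemma Hs_1_weak_deriv:
  assumes "v \<in> Hs \<Omega> 1" "mi_order m \<le> 1"
  shows "weak_deriv \<Omega> m v (wderiv \<Omega> m v)"
proof -
  have "\<exists>w. weak_deriv \<Omega> m v w" using assms by (simp add: Hs_def)
  then show ?thesis unfolding wderiv_def by (rule someI_ex)
qed

lemma Hs_1_L2: "v \<in> Hs \<Omega> 1 \<Longrightarrow> v \<in> L2 \<Omega>"
  by (simp add: Hs_def)

lemma Hs_1_lincomb:
  assumes "open \<Omega>" "bounded \<Omega>" "v \<in> Hs \<Omega> 1" "w \<in> Hs \<Omega> 1"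
  shows "(\<lambda>x. a * v x + b * w x) \<in> Hs \<Omega> 1"
proof -
  have lm: "\<Omega> \<in> lmeasurable" using assms by (simp add: lmeasurable_open)
  have "(\<lambda>x. a * v x + b * w x) \<in> L2 \<Omega>"
    using L2_add[OF L2_scaleR[OF Hs_1_L2[OF assms(3)], of a] L2_scaleR[OF Hs_1_L2[OF assms(4)], of b]]
    by simp
  then show ?thesis
    unfolding Hs_def
    using weak_deriv_lincomb[OF lm assms(2) assms(3,4)[THEN Hs_1_L2]
        Hs_1_weak_deriv[OF assms(3)] Hs_1_weak_deriv[OF assms(4)]]
    by (auto intro!: exI)
qed

lemma Hs_1_diff:
  assumes "open \<Omega>" "bounded \<Omega>" "v \<in> Hs \<Omega> 1" "w \<in> Hs \<Omega> 1"
  shows "(\<lambda>x. v x - w x) \<in> Hs \<Omega> 1"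
  using Hs_1_lincomb[OF assms, of 1 "-1"] by simp

lemma wderiv_order_0:
  assumes "open \<Omega>" "bounded \<Omega>" "v \<in> Hs \<Omega> 1"
  shows "AE x in lebesgue_on \<Omega>. wderiv \<Omega> (\<lambda>_. 0) v x = v x"
  by (rule weak_deriv_unique[OF assms(1,2), where js = "[]" and m = "\<lambda>_. 0" and v = v])
     (auto intro!: Hs_1_weak_deriv weak_deriv_order_0 Hs_1_L2 assms simp: mi_order_def)

lemma wderiv_lincomb:
  assumes "open \<Omega>" "bounded \<Omega>" "v \<in> Hs \<Omega> 1" "w \<in> Hs \<Omega> 1"
  shows "AE x in lebesgue_on \<Omega>. wderiv \<Omega> (unit_mi i) (\<lambda>x. a * v x + b * w x) x
           = a * wderiv \<Omega> (unit_mi i) v x + b * wderiv \<Omega> (unit_mi i) w x"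
proof (rule weak_deriv_unique[OF assms(1,2), where js = "[i]" and m = "unit_mi i"])
  have lm: "\<Omega> \<in> lmeasurable" using assms by (simp add: lmeasurable_open)
  show "weak_deriv \<Omega> (unit_mi i) (\<lambda>x. a * v x + b * w x) (wderiv \<Omega> (unit_mi i) (\<lambda>x. a * v x + b * w x))"
    by (intro Hs_1_weak_deriv Hs_1_lincomb assms) (simp add: mi_order_unit_mi)
  show "weak_deriv \<Omega> (unit_mi i) (\<lambda>x. a * v x + b * w x)
     (\<lambda>x. a * wderiv \<Omega> (unit_mi i) v x + b * wderiv \<Omega> (unit_mi i) w x)"
    by (intro weak_deriv_lincomb lm assms Hs_1_L2 Hs_1_weak_deriv) (simp_all add: mi_order_unit_mi)
qed auto

lemma wgrad_lincomb:
  assumes "open \<Omega>" "bounded \<Omega>" "v \<in> Hs \<Omega> 1" "w \<in> Hs \<Omega> 1"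
  shows "AE x in lebesgue_on \<Omega>. wgrad \<Omega> (\<lambda>x. a * v x + b * w x) x
           = a *\<^sub>R wgrad \<Omega> v x + b *\<^sub>R wgrad \<Omega> w x"
proof -
  have "AE x in lebesgue_on \<Omega>. \<forall>i. wderiv \<Omega> (unit_mi i) (\<lambda>x. a * v x + b * w x) x
           = a * wderiv \<Omega> (unit_mi i) v x + b * wderiv \<Omega> (unit_mi i) w x"
    using wderiv_lincomb[OF assms] by (simp add: AE_all_countable)
  then show ?thesis
    by eventually_elim (simp add: wgrad_def vec_eq_iff)
qed

lemma wderiv_L2:
  assumes "v \<in> Hs \<Omega> 1" "mi_order m \<le> 1"
  shows "wderiv \<Omega> m v \<in> L2 \<Omega>"
  using Hs_1_weak_deriv[OF assms] by (simp add: weak_deriv_def)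

lemma norm_vec_power2: "(norm (x::real^'d))\<^sup>2 = (\<Sum>i\<in>UNIV. (x $ i)\<^sup>2)"
  by (simp add: norm_vec_def L2_set_def sum_nonneg)

lemma wgrad_L2:
  assumes "v \<in> Hs \<Omega> 1"
  shows "wgrad \<Omega> v \<in> L2 \<Omega>"
    and "(l2_norm \<Omega> (wgrad \<Omega> v))\<^sup>2 = (\<Sum>i\<in>UNIV. (l2_norm \<Omega> (wderiv \<Omega> (unit_mi i) v))\<^sup>2)"
proof -
  have D: "wderiv \<Omega> (unit_mi i) v \<in> L2 \<Omega>" for i
    by (rule wderiv_L2[OF assms]) (simp add: mi_order_unit_mi)
  have "wgrad \<Omega> v \<in> borel_measurable (lebesgue_on \<Omega>)"
    unfolding borel_measurable_euclidean_space[where f = "wgrad \<Omega> v"]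
    using L2D(1)[OF D] by (auto simp: Basis_vec_def inner_axis wgrad_def)
  moreover have "integrable (lebesgue_on \<Omega>) (\<lambda>x. (norm (wgrad \<Omega> v x))\<^sup>2)"
    unfolding norm_vec_power2 wgrad_def using L2D(2)[OF D] by simp
  ultimately show "wgrad \<Omega> v \<in> L2 \<Omega>" by (simp add: L2_def)
  show "(l2_norm \<Omega> (wgrad \<Omega> v))\<^sup>2 = (\<Sum>i\<in>UNIV. (l2_norm \<Omega> (wderiv \<Omega> (unit_mi i) v))\<^sup>2)"
    unfolding l2_norm_power2 l2_inner_self norm_vec_power2 wgrad_def
    using L2D(2)[OF D] by simp
qed

text \<open>A function together with its weak gradient; the \<open>H\<^sup>1\<close> norm is the \<open>L\<^sup>2\<close> norm of this pair.\<close>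

definition jet :: "(real^'d) set \<Rightarrow> (real^'d \<Rightarrow> real) \<Rightarrow> real^'d \<Rightarrow> real \<times> (real^'d)" where
  "jet \<Omega> v x = (v x, wgrad \<Omega> v x)"

lemma jet_L2: "v \<in> Hs \<Omega> 1 \<Longrightarrow> jet \<Omega> v \<in> L2 \<Omega>"
  unfolding jet_def[abs_def] by (intro L2_Pair wgrad_L2 Hs_1_L2)

lemma Hnorm_1_jet:
  assumes "open \<Omega>" "bounded \<Omega>" "v \<in> Hs \<Omega> 1"
  shows "Hnorm \<Omega> 1 v = l2_norm \<Omega> (jet \<Omega> v)"
proof -
  have ne: "(\<lambda>_. 0) \<notin> range (unit_mi :: 'a \<Rightarrow> _)"
  proof
    assume "(\<lambda>_. 0) \<in> range (unit_mi :: 'a \<Rightarrow> _)"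
    then obtain i :: 'a where "(\<lambda>_. 0) = unit_mi i" by blast
    from fun_cong[OF this, of i] show False by simp
  qed
  have inj: "inj (unit_mi :: 'a \<Rightarrow> _)"
    by (auto simp: inj_def fun_eq_iff split: if_splits)
  have "l2_norm \<Omega> (wderiv \<Omega> (\<lambda>_. 0) v) = l2_norm \<Omega> v"
    using wderiv_L2[OF assms(3), of "\<lambda>_. 0"] Hs_1_L2[OF assms(3)]
    by (intro l2_norm_cong_AE L2D(1) wderiv_order_0 assms) (simp_all add: mi_order_def)
  then have "(\<Sum>m | mi_order m \<le> nat \<lfloor>1::real\<rfloor>. (l2_norm \<Omega> (wderiv \<Omega> m v))\<^sup>2)
      = (l2_norm \<Omega> v)\<^sup>2 + (l2_norm \<Omega> (wgrad \<Omega> v))\<^sup>2"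
    using ne inj by (simp add: mi_order_le_1[simplified] wgrad_L2(2)[OF assms(3)] sum.reindex)
  also have "\<dots> = (l2_norm \<Omega> (jet \<Omega> v))\<^sup>2"
    unfolding jet_def[abs_def] by (rule l2_norm_Pair[symmetric]) (intro wgrad_L2 Hs_1_L2 assms)+
  finally show ?thesis
    by (simp add: Hnorm_def l2_norm_nonneg)
qed

lemma jet_lincomb:
  assumes "open \<Omega>" "bounded \<Omega>" "v \<in> Hs \<Omega> 1" "w \<in> Hs \<Omega> 1"
  shows "AE x in lebesgue_on \<Omega>. jet \<Omega> (\<lambda>x. a * v x + b * w x) x = a *\<^sub>R jet \<Omega> v x + b *\<^sub>R jet \<Omega> w x"
  using wgrad_lincomb[OF assms, of a b] by eventually_elim (simp add: jet_def)

lemma Hnorm_1_lincomb_le: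
  assumes "open \<Omega>" "bounded \<Omega>" "v \<in> Hs \<Omega> 1" "w \<in> Hs \<Omega> 1"
  shows "Hnorm \<Omega> 1 (\<lambda>x. a * v x + b * w x) \<le> \<bar>a\<bar> * Hnorm \<Omega> 1 v + \<bar>b\<bar> * Hnorm \<Omega> 1 w"
proof -
  note J = assms(3,4)[THEN jet_L2]
  have "l2_norm \<Omega> (jet \<Omega> (\<lambda>x. a * v x + b * w x)) = l2_norm \<Omega> (\<lambda>x. a *\<^sub>R jet \<Omega> v x + b *\<^sub>R jet \<Omega> w x)"
    by (rule l2_norm_cong_AE[OF L2D(1) L2D(1) jet_lincomb[OF assms]])
       (intro jet_L2 Hs_1_lincomb assms L2_add L2_scaleR)+
  also have "\<dots> \<le> l2_norm \<Omega> (\<lambda>x. a *\<^sub>R jet \<Omega> v x) + l2_norm \<Omega> (\<lambda>x. b *\<^sub>R jet \<Omega> w x)"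
    by (intro l2_norm_triangle L2_scaleR J)
  finally show ?thesis
    using assms by (simp add: Hnorm_1_jet Hs_1_lincomb l2_norm_scaleR)
qed

lemma Hnorm_1_triangle:
  assumes "open \<Omega>" "bounded \<Omega>" "v \<in> Hs \<Omega> 1" "w \<in> Hs \<Omega> 1" "z \<in> Hs \<Omega> 1"
  shows "Hnorm \<Omega> 1 (\<lambda>x. v x - w x) \<le> Hnorm \<Omega> 1 (\<lambda>x. v x - z x) + Hnorm \<Omega> 1 (\<lambda>x. z x - w x)"
  using Hnorm_1_lincomb_le[OF assms(1,2) Hs_1_diff[OF assms(1,2,3,5)] Hs_1_diff[OF assms(1,2,5,4)], of 1 1]
  by simp

lemma Hnorm_nonneg: "0 \<le> Hnorm \<Omega> r v"
  unfolding Hnorm_def by (auto intro!: real_sqrt_ge_zero add_nonneg_nonneg sum_nonneg)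

lemma l2_norm_le_Hnorm_1:
  assumes "open \<Omega>" "bounded \<Omega>" "v \<in> Hs \<Omega> 1"
  shows "l2_norm \<Omega> v \<le> Hnorm \<Omega> 1 v" "l2_norm \<Omega> (wgrad \<Omega> v) \<le> Hnorm \<Omega> 1 v"
  using L2_dominated(2)[OF jet_L2[OF assms(3)] L2D(1)[OF Hs_1_L2[OF assms(3)]], of 1]
    L2_dominated(2)[OF jet_L2[OF assms(3)] L2D(1)[OF wgrad_L2(1)[OF assms(3)]], of 1]
  by (auto simp: Hnorm_1_jet assms jet_def norm_prod_def real_le_rsqrt)

section \<open>The elliptic form and the nonlinear form\<close>

lemma norm_matrix_vector_mult_le: "norm (A *v x) \<le> norm A * norm x"
  for A :: "real^'n^'m"
proof -
  have "norm (A *v x) \<le> L2_set (\<lambda>i. norm (A $ i) * norm x) UNIV"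
    unfolding norm_vec_def[of "A *v x"]
    by (intro L2_set_mono) (auto simp: matrix_vector_mul_component Cauchy_Schwarz_ineq2)
  also have "\<dots> = norm A * norm x"
    by (simp add: norm_vec_def[of A] L2_set_left_distrib)
  finally show ?thesis .
qed

lemma bounded_bilinear_matrix_vector_mult:
  "bounded_bilinear (\<lambda>(A :: real^'n^'m) x. A *v x)"
proof
  show "\<exists>K. \<forall>(A :: real^'n^'m) x. norm (A *v x) \<le> norm A * norm x * K"
    by (rule exI[of _ 1]) (simp add: norm_matrix_vector_mult_le)
qed (simp_all add: matrix_vector_mult_add_rdistrib matrix_vector_right_distrib
      scaleR_matrix_vector_assoc matrix_vector_mult_scaleR)

lemma borel_measurable_matrix_vector_mult:
  fixes A :: "'a \<Rightarrow> real^'n^'m"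
  assumes "A \<in> borel_measurable M" "v \<in> borel_measurable M"
  shows "(\<lambda>x. A x *v v x) \<in> borel_measurable M"
  by (rule borel_measurable_continuous_Pair[OF assms])
     (intro bounded_bilinear.continuous_on[OF bounded_bilinear_matrix_vector_mult] continuous_intros)

text \<open>
  What the analysis uses of a coefficient \<open>F(x,s)\<close>: a common bound and Lipschitz constant \<open>C\<close>, and
  measurability of \<open>x \<mapsto> F(x,w(x))\<close>.
\<close>

definition lipschitz_coeff ::
    "(real^'d) set \<Rightarrow> real \<Rightarrow> (real^'d \<Rightarrow> real \<Rightarrow> 'b::euclidean_space) \<Rightarrow> bool" where
  "lipschitz_coeff \<Omega> C F \<longleftrightarrow> C \<ge> 0 \<and>
     (\<forall>x\<in>\<Omega>. \<forall>s. norm (F x s) \<le> C) \<and>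
     (\<forall>x\<in>\<Omega>. \<forall>s s'. norm (F x s - F x s') \<le> C * \<bar>s - s'\<bar>) \<and>
     (\<forall>w\<in>borel_measurable (lebesgue_on \<Omega>). (\<lambda>x. F x (w x)) \<in> borel_measurable (lebesgue_on \<Omega>))"

lemma lipschitz_coeff_zero: "C \<ge> 0 \<Longrightarrow> lipschitz_coeff \<Omega> C (\<lambda>x s. 0)"
  by (simp add: lipschitz_coeff_def)

lemma lipschitz_coeff_mono:
  assumes "lipschitz_coeff \<Omega> C F" "C \<le> C'"
  shows "lipschitz_coeff \<Omega> C' F"
  using assms mult_right_mono[OF assms(2)] unfolding lipschitz_coeff_def
  by (smt (verit, best) abs_ge_zero)

text \<open>
  The Lipschitz constant is a bound on the derivative in the basis direction \<open>(0,1)\<close>, that is, with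
  respect to \<open>s\<close>.
\<close>

lemma smooth_bounded_imp_lipschitz_coeff:
  fixes F :: "real^'d \<Rightarrow> real \<Rightarrow> 'b::euclidean_space"
  assumes "open \<Omega>" and F: "smooth_bounded_on (\<Omega> \<times> UNIV) (\<lambda>(x, s). F x s)"
  shows "\<exists>C. lipschitz_coeff \<Omega> C F"
proof -
  define f where "f = (\<lambda>(x, s). F x s)"
  have F_f: "F x s = f (x, s)" for x s by (simp add: f_def)
  let ?W = "\<Omega> \<times> (UNIV :: real set)"
  let ?e = "(0, 1) :: (real^'d) \<times> real"
  have op: "open ?W" using assms(1) by (simp add: open_Times)
  have e: "?e \<in> Basis" by (simp add: Basis_prod_def)
  have diff: "f differentiable_on ?W"
    using F unfolding f_def[symmetric] by (simp add: smooth_bounded_on_def smooth_on_imp_differentiable_on)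
  have bdd: "\<forall>bs\<in>lists Basis. bounded (iter_deriv bs f ` ?W)"
    using F unfolding f_def[symmetric] smooth_bounded_on_def by simp
  have "bounded (iter_deriv [] f ` ?W)" "bounded (iter_deriv [?e] f ` ?W)"
    by (rule bspec[OF bdd], simp add: e)+
  then obtain C1 C2 where "\<forall>y\<in>iter_deriv [] f ` ?W. norm y \<le> C1"
    "\<forall>y\<in>iter_deriv [?e] f ` ?W. norm y \<le> C2"
    unfolding bounded_iff by blast
  then have C1: "norm (f p) \<le> C1" and C2: "norm (dir_deriv ?e f p) \<le> C2" if "p \<in> ?W" for p
    using that by auto
  define C where "C = max 0 (max C1 C2)"
  have "norm (F x s - F x s') \<le> C * \<bar>s - s'\<bar>" if x: "x \<in> \<Omega>" for x s s'
  proof -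
    have "((\<lambda>s. F x s) has_derivative (\<lambda>h. h *\<^sub>R dir_deriv ?e f (x, s))) (at s)" for s
    proof -
      let ?D = "frechet_derivative f (at (x, s))"
      have "f differentiable (at (x, s))"
        using diff op x by (auto simp: differentiable_on_eq_differentiable_at)
      then have D: "(f has_derivative ?D) (at (x, s))" by (simp add: frechet_derivative_works)
      have "((\<lambda>s. (x, s)) has_derivative (\<lambda>h. (0, h))) (at s)"
        by (auto intro!: derivative_eq_intros)
      from has_derivative_compose[OF this D]
      have "((\<lambda>s. F x s) has_derivative (\<lambda>h. ?D (0, h))) (at s)" by (simp add: F_f)
      moreover have "?D (0, h) = h *\<^sub>R dir_deriv ?e f (x, s)" for h
        using linear_cmul[OF has_derivative_linear[OF D], of h ?e] by (simp add: dir_deriv_def)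
      ultimately show ?thesis by simp
    qed
    then have "norm (F x s - F x s') \<le> C * norm (s - s')"
    proof (intro differentiable_bound[of UNIV "F x" "\<lambda>s h. h *\<^sub>R dir_deriv ?e f (x, s)" C])
      show "onorm (\<lambda>h. h *\<^sub>R dir_deriv ?e f (x, s)) \<le> C" for s
      proof (rule onorm_le)
        fix h :: real
        have "norm (dir_deriv ?e f (x, s)) \<le> C" using C2[of "(x, s)"] x by (simp add: C_def)
        then show "norm (h *\<^sub>R dir_deriv ?e f (x, s)) \<le> C * norm h"
          unfolding norm_scaleR real_norm_def
          by (subst mult.commute) (intro mult_right_mono abs_ge_zero)
      qed
    qed auto
    then show ?thesis by simp
  qed
  moreover have "norm (F x s) \<le> C" if "x \<in> \<Omega>" for x s
    using C1[of "(x, s)"] that by (simp add: C_def F_f)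
  moreover have "(\<lambda>x. F x (w x)) \<in> borel_measurable (lebesgue_on \<Omega>)"
    if w: "w \<in> borel_measurable (lebesgue_on \<Omega>)" for w
  proof -
    have "(\<lambda>x. x) \<in> borel_measurable (lebesgue_on \<Omega>)"
      by (intro measurable_restrict_space1 measurable_completion) simp
    then have pair: "(\<lambda>x. (x, w x)) \<in> borel_measurable (lebesgue_on \<Omega>)"
      using w by (rule borel_measurable_Pair)
    have "(\<lambda>p. indicator ?W p *\<^sub>R f p) \<in> borel_measurable borel"
      using op by (intro borel_measurable_continuous_on_indicator differentiable_imp_continuous_on diff) simp
    from measurable_compose[OF pair this]
    have "(\<lambda>x. indicator ?W (x, w x) *\<^sub>R F x (w x)) \<in> borel_measurable (lebesgue_on \<Omega>)" by (simp add: F_f)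
    then show ?thesis
      by (subst measurable_cong[of _ _ "\<lambda>x. indicator ?W (x, w x) *\<^sub>R F x (w x)"])
         (auto simp: space_restrict_space indicator_def)
  qed
  ultimately have "lipschitz_coeff \<Omega> C F" unfolding lipschitz_coeff_def by (simp add: C_def)
  then show ?thesis ..
qed

text \<open>
  The nonlinear form is the \<open>L\<^sup>2\<close> product of this field with the jet of the test function: the
  terms tested with \<open>v\<close> form the first component, those tested with \<open>\<nabla>v\<close> the second.
\<close>

definition flux ::
    "(real^'d) set \<Rightarrow> (real^'d \<Rightarrow> real \<Rightarrow> real^'d^'d) \<Rightarrow> (real^'d \<Rightarrow> real \<Rightarrow> real^'d) \<Rightarrow>
     (real^'d \<Rightarrow> real \<Rightarrow> real^'d) \<Rightarrow> (real^'d \<Rightarrow> real \<Rightarrow> real) \<Rightarrow>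
     (real^'d \<Rightarrow> real) \<Rightarrow> (real^'d \<Rightarrow> real) \<Rightarrow> real^'d \<Rightarrow> real \<times> (real^'d)" where
  "flux \<Omega> \<alpha> \<beta> \<gamma> g w u x =
     (\<gamma> x (w x) \<bullet> wgrad \<Omega> u x + g x (w x), \<alpha> x (w x) *v wgrad \<Omega> u x + \<beta> x (w x))"

lemma lipschitz_coeff_L2:
  assumes "open \<Omega>" "bounded \<Omega>" "lipschitz_coeff \<Omega> C F" "w \<in> L2 \<Omega>"
  shows "(\<lambda>x. F x (w x)) \<in> L2 \<Omega>"
proof (rule L2_bounded(1)[where C = C])
  show "\<Omega> \<in> lmeasurable" using assms by (simp add: lmeasurable_open)
  show "(\<lambda>x. F x (w x)) \<in> borel_measurable (lebesgue_on \<Omega>)"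
    using assms(3) L2D(1)[OF assms(4)] by (simp add: lipschitz_coeff_def)
  show "AE x in lebesgue_on \<Omega>. norm (F x (w x)) \<le> C"
    using assms(3) by (intro AE_I2) (auto simp: lipschitz_coeff_def space_restrict_space)
qed

lemma matrix_coeff_L2:
  fixes A :: "real^'d \<Rightarrow> real^'n^'m"
  assumes "A \<in> borel_measurable (lebesgue_on \<Omega>)" "\<And>x. x \<in> \<Omega> \<Longrightarrow> norm (A x) \<le> C" "0 \<le> C" "v \<in> L2 \<Omega>"
  shows "(\<lambda>x. A x *v v x) \<in> L2 \<Omega>"
proof (rule L2_dominated(1)[OF assms(4) _ assms(3)])
  show "(\<lambda>x. A x *v v x) \<in> borel_measurable (lebesgue_on \<Omega>)"
    by (intro borel_measurable_matrix_vector_mult assms(1) L2D(1)[OF assms(4)])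
  show "AE x in lebesgue_on \<Omega>. norm (A x *v v x) \<le> C * norm (v x)"
    using assms(2) by (intro AE_I2 order_trans[OF norm_matrix_vector_mult_le] mult_right_mono)
      (auto simp: space_restrict_space)
qed

lemma inner_coeff_L2:
  fixes b :: "real^'d \<Rightarrow> 'b::euclidean_space"
  assumes "b \<in> borel_measurable (lebesgue_on \<Omega>)" "\<And>x. x \<in> \<Omega> \<Longrightarrow> norm (b x) \<le> C" "0 \<le> C" "v \<in> L2 \<Omega>"
  shows "(\<lambda>x. b x \<bullet> v x) \<in> L2 \<Omega>"
proof (rule L2_dominated(1)[OF assms(4) _ assms(3)])
  show "(\<lambda>x. b x \<bullet> v x) \<in> borel_measurable (lebesgue_on \<Omega>)"
    by (intro borel_measurable_inner assms(1) L2D(1)[OF assms(4)])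
  have "norm (b x \<bullet> v x) \<le> C * norm (v x)" if "x \<in> \<Omega>" for x
    using Cauchy_Schwarz_ineq2[of "b x" "v x"] mult_right_mono[OF assms(2)[OF that], of "norm (v x)"]
    by simp
  then show "AE x in lebesgue_on \<Omega>. norm (b x \<bullet> v x) \<le> C * norm (v x)"
    by (intro AE_I2) (simp add: space_restrict_space)
qed

lemma flux_parts_L2:
  assumes "open \<Omega>" "bounded \<Omega>"
    and "lipschitz_coeff \<Omega> C \<alpha>" "lipschitz_coeff \<Omega> C \<beta>" "lipschitz_coeff \<Omega> C \<gamma>" "lipschitz_coeff \<Omega> C g"
    and "w \<in> L2 \<Omega>" "u \<in> Hs \<Omega> 1"
  shows "(\<lambda>x. \<alpha> x (w x) *v wgrad \<Omega> u x) \<in> L2 \<Omega>" "(\<lambda>x. \<beta> x (w x)) \<in> L2 \<Omega>"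
    "(\<lambda>x. \<gamma> x (w x) \<bullet> wgrad \<Omega> u x) \<in> L2 \<Omega>" "(\<lambda>x. g x (w x)) \<in> L2 \<Omega>"
proof -
  show "(\<lambda>x. \<beta> x (w x)) \<in> L2 \<Omega>" "(\<lambda>x. g x (w x)) \<in> L2 \<Omega>"
    using assms lipschitz_coeff_L2 by blast+
  show "(\<lambda>x. \<alpha> x (w x) *v wgrad \<Omega> u x) \<in> L2 \<Omega>"
    using assms(3) by (intro matrix_coeff_L2[where C = C] wgrad_L2 assms L2D(1) lipschitz_coeff_L2[OF assms(1-3,7)])
      (auto simp: lipschitz_coeff_def)
  show "(\<lambda>x. \<gamma> x (w x) \<bullet> wgrad \<Omega> u x) \<in> L2 \<Omega>"
    using assms(5) by (intro inner_coeff_L2[where C = C] wgrad_L2 assms L2D(1) lipschitz_coeff_L2[OF assms(1,2,5,7)])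
      (auto simp: lipschitz_coeff_def)
qed

lemma B_form_eq_flux:
  assumes "open \<Omega>" "bounded \<Omega>"
    and "lipschitz_coeff \<Omega> C \<alpha>" "lipschitz_coeff \<Omega> C \<beta>" "lipschitz_coeff \<Omega> C \<gamma>" "lipschitz_coeff \<Omega> C g"
    and "w \<in> L2 \<Omega>" "u \<in> Hs \<Omega> 1" "v \<in> Hs \<Omega> 1"
  shows "flux \<Omega> \<alpha> \<beta> \<gamma> g w u \<in> L2 \<Omega>"
    and "B_form \<Omega> \<alpha> \<beta> \<gamma> g w u v = l2_inner \<Omega> (flux \<Omega> \<alpha> \<beta> \<gamma> g w u) (jet \<Omega> v)"
    and "B_form \<Omega> \<alpha> \<beta> \<gamma> g w u v = B1_form \<Omega> \<alpha> \<gamma> w u v +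
           (l2_inner \<Omega> (\<lambda>x. \<beta> x (w x)) (wgrad \<Omega> v) + l2_inner \<Omega> (\<lambda>x. g x (w x)) v)"
proof -
  note L = flux_parts_L2[OF assms(1-8)] wgrad_L2(1)[OF assms(9)] Hs_1_L2[OF assms(9)]
  show "flux \<Omega> \<alpha> \<beta> \<gamma> g w u \<in> L2 \<Omega>"
    unfolding flux_def[abs_def] by (intro L2_Pair L2_add L)
  show "B_form \<Omega> \<alpha> \<beta> \<gamma> g w u v = l2_inner \<Omega> (flux \<Omega> \<alpha> \<beta> \<gamma> g w u) (jet \<Omega> v)"
    using L2_inner_integrable[OF L2_add[OF L(1,2)] L(5)] L2_inner_integrable[OF L2_add[OF L(3,4)] L(6)]
    unfolding B_form_def l2_inner_def flux_def jet_def inner_prod_def by simp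
  show "B_form \<Omega> \<alpha> \<beta> \<gamma> g w u v = B1_form \<Omega> \<alpha> \<gamma> w u v +
           (l2_inner \<Omega> (\<lambda>x. \<beta> x (w x)) (wgrad \<Omega> v) + l2_inner \<Omega> (\<lambda>x. g x (w x)) v)"
    unfolding B_form_def B1_form_def using L by (simp add: l2_inner_add_left)
qed

lemma B1_form_eq_B_form: "B1_form \<Omega> \<alpha> \<gamma> = B_form \<Omega> \<alpha> (\<lambda>x s. 0) \<gamma> (\<lambda>x s. 0)"
  by (intro ext) (simp add: B1_form_def B_form_def)

lemma wgrad_diff:
  assumes "open \<Omega>" "bounded \<Omega>" "v \<in> Hs \<Omega> 1" "w \<in> Hs \<Omega> 1"
  shows "AE x in lebesgue_on \<Omega>. wgrad \<Omega> (\<lambda>x. v x - w x) x = wgrad \<Omega> v x - wgrad \<Omega> w x"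
  using wgrad_lincomb[OF assms, of 1 "-1"] by simp

text \<open>
  Lipschitz continuity of the nonlinear form.  Only the gradient of the second reference function \<open>z\<close> has
  to be bounded: in \<open>\<alpha>(W)\<nabla>U - \<alpha>(w)\<nabla>z = \<alpha>(W)\<nabla>(U - z) + (\<alpha>(W) - \<alpha>(w))\<nabla>z\<close> \<open>\<nabla>U\<close> enters
  only through \<open>\<nabla>(U - z)\<close>, with a bounded coefficient.
\<close>

lemma B_form_lipschitz:
  assumes \<Omega>: "open \<Omega>" "bounded \<Omega>"
    and coeff: "lipschitz_coeff \<Omega> C \<alpha>" "lipschitz_coeff \<Omega> C \<beta>" "lipschitz_coeff \<Omega> C \<gamma>" "lipschitz_coeff \<Omega> C g"
    and L2: "W \<in> L2 \<Omega>" "w \<in> L2 \<Omega>" and H1: "U \<in> Hs \<Omega> 1" "z \<in> Hs \<Omega> 1" "v \<in> Hs \<Omega> 1"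
    and G: "AE x in lebesgue_on \<Omega>. norm (wgrad \<Omega> z x) \<le> G" "G \<ge> 0"
  shows "\<bar>B_form \<Omega> \<alpha> \<beta> \<gamma> g W U v - B_form \<Omega> \<alpha> \<beta> \<gamma> g w z v\<bar>
           \<le> 4 * C * (1 + G) * (l2_norm \<Omega> (\<lambda>x. W x - w x) + Hnorm \<Omega> 1 (\<lambda>x. U x - z x)) * Hnorm \<Omega> 1 v"
proof -
  have C: "C \<ge> 0" using coeff by (simp add: lipschitz_coeff_def)
  let ?F = "\<lambda>x. flux \<Omega> \<alpha> \<beta> \<gamma> g W U x - flux \<Omega> \<alpha> \<beta> \<gamma> g w z x"
  let ?P = "\<lambda>x. (W x - w x, wgrad \<Omega> (\<lambda>x. U x - z x) x)"
  note FW = B_form_eq_flux[OF \<Omega> coeff L2(1) H1(1,3)] and Fw = B_form_eq_flux[OF \<Omega> coeff L2(2) H1(2,3)]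
  have d: "(\<lambda>x. U x - z x) \<in> Hs \<Omega> 1" by (intro Hs_1_diff \<Omega> H1)
  have P: "?P \<in> L2 \<Omega>" by (intro L2_Pair L2_diff L2 wgrad_L2 d)
  have F: "?F \<in> L2 \<Omega>" by (intro L2_diff FW(1) Fw(1))
  have "AE x in lebesgue_on \<Omega>. norm (?F x) \<le> (4 * C * (1 + G)) * norm (?P x)"
    using wgrad_diff[OF \<Omega> H1(1,2)] G(1) AE_space
  proof eventually_elim
    case (elim x)
    then have x: "x \<in> \<Omega>" by (simp add: space_restrict_space)
    define a b s s' where "a = wgrad \<Omega> U x" and "b = wgrad \<Omega> z x" and "s = W x" and "s' = w x"
    have b: "norm b \<le> G" using elim by (simp add: b_def)
    have bd: "norm (\<alpha> x s) \<le> C" "norm (\<gamma> x s) \<le> C"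
      "norm (\<alpha> x s - \<alpha> x s') \<le> C * \<bar>s - s'\<bar>" "norm (\<beta> x s - \<beta> x s') \<le> C * \<bar>s - s'\<bar>"
      "norm (\<gamma> x s - \<gamma> x s') \<le> C * \<bar>s - s'\<bar>" "norm (g x s - g x s') \<le> C * \<bar>s - s'\<bar>"
      using coeff x by (simp_all add: lipschitz_coeff_def)
    have F1: "norm ((\<alpha> x s *v a + \<beta> x s) - (\<alpha> x s' *v b + \<beta> x s'))
        \<le> C * norm (a - b) + C * \<bar>s - s'\<bar> * G + C * \<bar>s - s'\<bar>"
    proof -
      have "(\<alpha> x s *v a + \<beta> x s) - (\<alpha> x s' *v b + \<beta> x s')
          = \<alpha> x s *v (a - b) + (\<alpha> x s - \<alpha> x s') *v b + (\<beta> x s - \<beta> x s')"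
        by (simp add: matrix_vector_mult_diff_distrib matrix_vector_mult_diff_rdistrib)
      also have "norm \<dots> \<le> norm (\<alpha> x s *v (a - b)) + norm ((\<alpha> x s - \<alpha> x s') *v b) + norm (\<beta> x s - \<beta> x s')"
        by (intro norm_triangle_mono order_refl)
      also have "\<dots> \<le> C * norm (a - b) + C * \<bar>s - s'\<bar> * G + C * \<bar>s - s'\<bar>"
        using C bd b
        by (intro add_mono order_trans[OF norm_matrix_vector_mult_le] mult_mono) auto
      finally show ?thesis .
    qed
    have F2: "norm ((\<gamma> x s \<bullet> a + g x s) - (\<gamma> x s' \<bullet> b + g x s'))
        \<le> C * norm (a - b) + C * \<bar>s - s'\<bar> * G + C * \<bar>s - s'\<bar>"
    proof -
      have "(\<gamma> x s \<bullet> a + g x s) - (\<gamma> x s' \<bullet> b + g x s')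
          = \<gamma> x s \<bullet> (a - b) + (\<gamma> x s - \<gamma> x s') \<bullet> b + (g x s - g x s')"
        by (simp add: inner_diff_left inner_diff_right)
      also have "norm \<dots> \<le> norm (\<gamma> x s \<bullet> (a - b)) + norm ((\<gamma> x s - \<gamma> x s') \<bullet> b) + norm (g x s - g x s')"
        by (intro norm_triangle_mono order_refl)
      also have "\<dots> \<le> C * norm (a - b) + C * \<bar>s - s'\<bar> * G + C * \<bar>s - s'\<bar>"
        using C bd b unfolding real_norm_def
        by (intro add_mono order_trans[OF Cauchy_Schwarz_ineq2] mult_mono) auto
      finally show ?thesis .
    qed
    have "norm (?F x) \<le> norm ((\<gamma> x s \<bullet> a + g x s) - (\<gamma> x s' \<bullet> b + g x s'))
        + norm ((\<alpha> x s *v a + \<beta> x s) - (\<alpha> x s' *v b + \<beta> x s'))"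
      unfolding flux_def diff_Pair a_def b_def s_def s'_def by (rule norm_Pair_le)
    also have "\<dots> \<le> 2 * (C * norm (a - b) + C * \<bar>s - s'\<bar> * G + C * \<bar>s - s'\<bar>)"
      using F1 F2 by simp
    also have "\<dots> \<le> 2 * (C * (1 + G) * (norm (?P x)) + C * (1 + G) * norm (?P x))"
    proof -
      have n: "norm (a - b) \<le> norm (?P x)" "\<bar>s - s'\<bar> \<le> norm (?P x)"
        using elim norm_snd_le[of "wgrad \<Omega> (\<lambda>x. U x - z x) x" "W x - w x"]
          norm_fst_le[of "W x - w x" "wgrad \<Omega> (\<lambda>x. U x - z x) x"]
        by (simp_all add: a_def b_def s_def s'_def)
      have "C * norm (a - b) \<le> C * (1 + G) * norm (?P x)"
        using mult_mono[OF _ n(1), of C "C * (1 + G)"] C G(2) by (simp add: algebra_simps)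
      moreover have "C * \<bar>s - s'\<bar> * G + C * \<bar>s - s'\<bar> \<le> C * (1 + G) * norm (?P x)"
        using mult_left_mono[OF n(2), of "C * (1 + G)"] C G(2) by (simp add: algebra_simps)
      ultimately show ?thesis
        unfolding add.assoc by (intro mult_left_mono add_mono) auto
    qed
    finally show ?case by (simp add: algebra_simps)
  qed
  from L2_dominated(2)[OF P L2D(1)[OF F] _ this]
  have 1: "l2_norm \<Omega> ?F \<le> 4 * C * (1 + G) * l2_norm \<Omega> ?P" using C G(2) by simp
  have "l2_norm \<Omega> ?P \<le> l2_norm \<Omega> (\<lambda>x. W x - w x) + l2_norm \<Omega> (wgrad \<Omega> (\<lambda>x. U x - z x))"
  proof (rule power2_le_imp_le)
    show "(l2_norm \<Omega> ?P)\<^sup>2 \<le> (l2_norm \<Omega> (\<lambda>x. W x - w x) + l2_norm \<Omega> (wgrad \<Omega> (\<lambda>x. U x - z x)))\<^sup>2"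
      by (subst l2_norm_Pair) (auto intro!: L2_diff L2 wgrad_L2 d simp: power2_sum l2_norm_nonneg)
  qed (simp add: l2_norm_nonneg)
  also have "\<dots> \<le> l2_norm \<Omega> (\<lambda>x. W x - w x) + Hnorm \<Omega> 1 (\<lambda>x. U x - z x)"
    using l2_norm_le_Hnorm_1(2)[OF \<Omega> d] by simp
  finally have 2: "l2_norm \<Omega> ?P \<le> l2_norm \<Omega> (\<lambda>x. W x - w x) + Hnorm \<Omega> 1 (\<lambda>x. U x - z x)" .
  have "\<bar>B_form \<Omega> \<alpha> \<beta> \<gamma> g W U v - B_form \<Omega> \<alpha> \<beta> \<gamma> g w z v\<bar> = \<bar>l2_inner \<Omega> ?F (jet \<Omega> v)\<bar>"
    by (subst l2_inner_diff_left) (auto intro: FW(1) Fw(1) jet_L2 H1 simp: FW(2) Fw(2))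
  also have "\<dots> \<le> l2_norm \<Omega> ?F * l2_norm \<Omega> (jet \<Omega> v)"
    by (intro l2_Cauchy_Schwarz F jet_L2 H1)
  also have "\<dots> \<le> (4 * C * (1 + G) * (l2_norm \<Omega> (\<lambda>x. W x - w x) + Hnorm \<Omega> 1 (\<lambda>x. U x - z x))) * Hnorm \<Omega> 1 v"
  proof (rule mult_mono)
    show "l2_norm \<Omega> ?F \<le> 4 * C * (1 + G) * (l2_norm \<Omega> (\<lambda>x. W x - w x) + Hnorm \<Omega> 1 (\<lambda>x. U x - z x))"
      using 1 mult_left_mono[OF 2, of "4 * C * (1 + G)"] C G(2) by simp
  qed (use C G(2) \<Omega> H1 in \<open>auto simp: Hnorm_1_jet Hnorm_nonneg l2_norm_nonneg intro!: mult_nonneg_nonneg\<close>)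
  finally show ?thesis .
qed

lemma B1_form_diff_right:
  assumes \<Omega>: "open \<Omega>" "bounded \<Omega>"
    and coeff: "lipschitz_coeff \<Omega> C \<alpha>" "lipschitz_coeff \<Omega> C \<gamma>"
    and "w \<in> L2 \<Omega>" "u \<in> Hs \<Omega> 1" "z \<in> Hs \<Omega> 1" "v \<in> Hs \<Omega> 1"
  shows "B1_form \<Omega> \<alpha> \<gamma> w (\<lambda>x. u x - z x) v = B1_form \<Omega> \<alpha> \<gamma> w u v - B1_form \<Omega> \<alpha> \<gamma> w z v"
proof -
  have 0: "lipschitz_coeff \<Omega> C (\<lambda>x s. 0)" "lipschitz_coeff \<Omega> C (\<lambda>x s. 0)"
    using coeff(1) by (auto intro!: lipschitz_coeff_zero simp: lipschitz_coeff_def)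
  note eq = B_form_eq_flux[OF \<Omega> coeff(1) 0(1) coeff(2) 0(2) assms(5) _ assms(8)]
  have d: "(\<lambda>x. u x - z x) \<in> Hs \<Omega> 1" by (intro Hs_1_diff assms)
  let ?F = "flux \<Omega> \<alpha> (\<lambda>x s. 0) \<gamma> (\<lambda>x s. 0) w"
  have "l2_inner \<Omega> (?F (\<lambda>x. u x - z x)) (jet \<Omega> v) = l2_inner \<Omega> (\<lambda>x. ?F u x - ?F z x) (jet \<Omega> v)"
  proof (rule l2_inner_cong_AE)
    show "AE x in lebesgue_on \<Omega>. ?F (\<lambda>x. u x - z x) x = ?F u x - ?F z x"
      using wgrad_diff[OF \<Omega> assms(6,7)]
      by eventually_elim (simp add: flux_def inner_diff_right matrix_vector_mult_diff_distrib)
  qed (auto intro!: L2D(1) eq d assms L2_diff jet_L2)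
  also have "\<dots> = l2_inner \<Omega> (?F u) (jet \<Omega> v) - l2_inner \<Omega> (?F z) (jet \<Omega> v)"
    by (intro l2_inner_diff_left eq assms jet_L2)
  finally show ?thesis
    unfolding B1_form_eq_B_form by (simp add: eq(2) d assms)
qed

lemma smooth_near_continuous:
  assumes "smooth_near S f"
  shows "continuous_on S f"
proof -
  obtain W where "S \<subseteq> W" "smooth_on W f"
    using assms unfolding smooth_near_def by blast
  moreover from this(2) have "f differentiable_on W"
    by (rule smooth_on_imp_differentiable_on)
  ultimately show ?thesis
    using continuous_on_subset differentiable_imp_continuous_on by blast
qed

lemma A_form_diff_left:
  assumes \<Omega>: "open \<Omega>" "bounded \<Omega>" and "elliptic_coeffs \<Omega> T a a0" "t \<in> {0..T}"
    and H1: "u \<in> Hs \<Omega> 1" "z \<in> Hs \<Omega> 1" "v \<in> Hs \<Omega> 1"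
  shows "A_form \<Omega> a a0 t (\<lambda>x. u x - z x) v = A_form \<Omega> a a0 t u v - A_form \<Omega> a a0 t z v"
proof -
  have slice: "(\<lambda>x. F x t) \<in> borel_measurable (lebesgue_on \<Omega>) \<and> (\<exists>C\<ge>0. \<forall>x\<in>\<Omega>. norm (F x t) \<le> C)"
    if "smooth_near (closure \<Omega> \<times> {0..T}) (\<lambda>(x, t). F x t)"
    for F :: "real^'a \<Rightarrow> real \<Rightarrow> 'b::euclidean_space"
  proof -
    have "continuous_on (closure \<Omega> \<times> {0..T}) (\<lambda>(x, t). F x t)"
      using that by (rule smooth_near_continuous)
    then have "continuous_on (closure \<Omega>) (\<lambda>x. (\<lambda>(x, t). F x t) (x, t))"
      by (rule continuous_on_compose2) (use assms(4) in \<open>auto intro!: continuous_intros\<close>)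
    then have c: "continuous_on (closure \<Omega>) (\<lambda>x. F x t)" by simp
    then have "bounded ((\<lambda>x. F x t) ` closure \<Omega>)"
      using \<Omega>(2) by (intro compact_imp_bounded compact_continuous_image) (auto simp: compact_closure)
    then obtain C where "\<forall>x\<in>closure \<Omega>. norm (F x t) \<le> C"
      by (auto simp: bounded_iff)
    then have "\<forall>x\<in>\<Omega>. norm (F x t) \<le> max 0 C" using closure_subset[of \<Omega>] by force
    moreover have "(\<lambda>x. F x t) \<in> borel_measurable (lebesgue_on \<Omega>)"
      using \<Omega>(1) continuous_on_subset[OF c closure_subset]
      by (intro continuous_imp_measurable_on_sets_lebesgue) auto
    ultimately show ?thesis by (intro conjI exI[of _ "max 0 C"]) auto
  qed
  have a: "(\<lambda>x. a x t) \<in> borel_measurable (lebesgue_on \<Omega>)" "\<exists>C\<ge>0. \<forall>x\<in>\<Omega>. norm (a x t) \<le> C"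
    and a0: "(\<lambda>x. a0 x t) \<in> borel_measurable (lebesgue_on \<Omega>)" "\<exists>C\<ge>0. \<forall>x\<in>\<Omega>. norm (a0 x t) \<le> C"
    using slice[of a] slice[of a0] assms(3) by (simp_all add: elliptic_coeffs_def)
  have aL: "(\<lambda>x. a x t *v wgrad \<Omega> w x) \<in> L2 \<Omega>" if "w \<in> Hs \<Omega> 1" for w
    using a(2) matrix_coeff_L2[OF a(1) _ _ wgrad_L2(1)[OF that]] by blast
  have a0L: "(\<lambda>x. a0 x t * w x) \<in> L2 \<Omega>" if "w \<in> Hs \<Omega> 1" for w
    using a0(2) inner_coeff_L2[OF a0(1) _ _ Hs_1_L2[OF that]] by auto
  have d: "(\<lambda>x. u x - z x) \<in> Hs \<Omega> 1" by (intro Hs_1_diff \<Omega> H1)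
  have "l2_inner \<Omega> (\<lambda>x. a x t *v wgrad \<Omega> (\<lambda>x. u x - z x) x) (wgrad \<Omega> v)
      = l2_inner \<Omega> (\<lambda>x. a x t *v wgrad \<Omega> u x - a x t *v wgrad \<Omega> z x) (wgrad \<Omega> v)"
  proof (rule l2_inner_cong_AE)
    show "AE x in lebesgue_on \<Omega>. a x t *v wgrad \<Omega> (\<lambda>x. u x - z x) x
            = a x t *v wgrad \<Omega> u x - a x t *v wgrad \<Omega> z x"
      using wgrad_diff[OF \<Omega> H1(1,2)] by eventually_elim (simp add: matrix_vector_mult_diff_distrib)
  qed (auto intro!: L2D(1) aL d H1 L2_diff wgrad_L2)
  also have "\<dots> = l2_inner \<Omega> (\<lambda>x. a x t *v wgrad \<Omega> u x) (wgrad \<Omega> v)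
                - l2_inner \<Omega> (\<lambda>x. a x t *v wgrad \<Omega> z x) (wgrad \<Omega> v)"
    by (intro l2_inner_diff_left aL H1 wgrad_L2)
  finally show ?thesis
    unfolding A_form_def using l2_inner_diff_left[OF a0L[OF H1(1)] a0L[OF H1(2)] Hs_1_L2[OF H1(3)]]
    by (simp add: right_diff_distrib)
qed

section \<open>The memory operator and time derivatives\<close>

lemma memory_integrable:
  fixes K \<phi> :: "real \<Rightarrow> real"
  assumes K: "set_integrable lborel {0..T} K" and \<phi>: "continuous_on {0..T} \<phi>" and t: "t \<in> {0..T}"
  shows "set_integrable lborel {0..t} (\<lambda>s. K (t - s) * \<phi> s)"
proof -
  have c: "continuous_on {0..t} \<phi>" by (rule continuous_on_subset[OF \<phi>]) (use t in auto)
  then have "bounded (\<phi> ` {0..t})"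
    by (intro compact_imp_bounded compact_continuous_image) auto
  then obtain C where C: "\<forall>s\<in>{0..t}. \<bar>\<phi> s\<bar> \<le> C" by (auto simp: bounded_iff)
  let ?k = "\<lambda>s. indicator {0..T} (t - s) * K (t - s)"
    and ?p = "\<lambda>s. indicator {0..t} s * \<phi> s"
  have k: "integrable lborel ?k"
    using K lborel_integrable_real_affine_iff[of "-1" "\<lambda>s. indicator {0..T} s * K s" t]
    by (simp add: set_integrable_def)
  have p: "?p \<in> borel_measurable borel"
    using borel_measurable_continuous_on_indicator[OF _ c] by simp
  have "integrable lborel (\<lambda>s. ?k s * ?p s)"
  proof (rule Bochner_Integration.integrable_bound)
    show "integrable lborel (\<lambda>s. C * ?k s)" using k by (rule integrable_mult_right)
    show "(\<lambda>s. ?k s * ?p s) \<in> borel_measurable lborel"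
      using borel_measurable_integrable[OF k] p by simp
    have "\<bar>?p s\<bar> \<le> \<bar>C\<bar>" for s
      using C by (force simp: indicator_def)
    then have "\<bar>?k s\<bar> * \<bar>?p s\<bar> \<le> \<bar>?k s\<bar> * \<bar>C\<bar>" for s
      by (rule mult_left_mono) simp
    then show "AE s in lborel. norm (?k s * ?p s) \<le> norm (C * ?k s)"
      unfolding real_norm_def abs_mult[of "?k _" "?p _"] abs_mult[of C] by (simp only: mult.commute[of "\<bar>C\<bar>"] AE_I2)
  qed
  moreover have "?k s * ?p s = indicator {0..t} s * (K (t - s) * \<phi> s)" for s
    using t by (auto simp: indicator_def)
  ultimately show ?thesis by (simp add: set_integrable_def)
qed

lemma memory_add:
  assumes "set_integrable lborel {0..T} K" "t \<in> {0..T}" "continuous_on {0..T} \<phi>" "continuous_on {0..T} \<psi>"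
  shows "memory K (\<lambda>s. \<phi> s + \<psi> s) t = memory K \<phi> t + memory K \<psi> t"
  using set_integral_add(2)[OF memory_integrable[OF assms(1,3,2)] memory_integrable[OF assms(1,4,2)]]
  by (simp add: memory_def distrib_left)

lemma memory_cong:
  assumes "\<And>s. s \<in> {0..t} \<Longrightarrow> \<phi> s = \<psi> s"
  shows "memory K \<phi> t = memory K \<psi> t"
  unfolding memory_def using assms by (intro set_lebesgue_integral_cong) auto

lemma time_deriv_H1_imp_L2:
  assumes \<Omega>: "open \<Omega>" "bounded \<Omega>" and d: "time_deriv (Hnorm \<Omega> 1) T u u'"
    and H1: "\<And>t. t \<in> {0..T} \<Longrightarrow> u t \<in> Hs \<Omega> 1" "\<And>t. t \<in> {0..T} \<Longrightarrow> u' t \<in> Hs \<Omega> 1"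
  shows "time_deriv (l2_norm \<Omega>) T u u'"
  unfolding time_deriv_def
proof
  fix t assume t: "t \<in> {0..T}"
  let ?q = "\<lambda>s x. (u s x - u t x) / (s - t) - u' t x"
  show "((\<lambda>s. l2_norm \<Omega> (?q s)) \<longlongrightarrow> 0) (at t within {0..T})"
  proof (rule tendsto_sandwich[OF _ _ tendsto_const])
    show "((\<lambda>s. Hnorm \<Omega> 1 (?q s)) \<longlongrightarrow> 0) (at t within {0..T})"
      using d t by (simp add: time_deriv_def)
    have "?q s \<in> Hs \<Omega> 1" if "s \<in> {0..T}" for s
      using Hs_1_lincomb[OF \<Omega> Hs_1_diff[OF \<Omega> H1(1)[OF that] H1(1)[OF t]] H1(2)[OF t], of "1 / (s - t)" "-1"]
      by simp
    then show "\<forall>\<^sub>F s in at t within {0..T}. l2_norm \<Omega> (?q s) \<le> Hnorm \<Omega> 1 (?q s)"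
      using l2_norm_le_Hnorm_1(1)[OF \<Omega>] by (auto simp: eventually_at_filter)
  qed (simp add: l2_norm_nonneg)
qed

lemma time_deriv_H1_continuous:
  assumes \<Omega>: "open \<Omega>" "bounded \<Omega>" and d: "time_deriv (Hnorm \<Omega> 1) T u u'"
    and H1: "\<And>t. t \<in> {0..T} \<Longrightarrow> u t \<in> Hs \<Omega> 1" "\<And>t. t \<in> {0..T} \<Longrightarrow> u' t \<in> Hs \<Omega> 1"
    and t: "t \<in> {0..T}"
  shows "((\<lambda>s. Hnorm \<Omega> 1 (\<lambda>x. u s x - u t x)) \<longlongrightarrow> 0) (at t within {0..T})"
proof -
  let ?q = "\<lambda>s x. (u s x - u t x) / (s - t) - u' t x"
  show ?thesis
  proof (rule tendsto_sandwich[OF _ _ tendsto_const])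
    have "((\<lambda>s. \<bar>s - t\<bar> * Hnorm \<Omega> 1 (?q s) + \<bar>s - t\<bar> * Hnorm \<Omega> 1 (u' t)) \<longlongrightarrow>
        \<bar>t - t\<bar> * 0 + \<bar>t - t\<bar> * Hnorm \<Omega> 1 (u' t)) (at t within {0..T})"
      using d t by (intro tendsto_intros) (simp add: time_deriv_def)
    then show "((\<lambda>s. \<bar>s - t\<bar> * Hnorm \<Omega> 1 (?q s) + \<bar>s - t\<bar> * Hnorm \<Omega> 1 (u' t)) \<longlongrightarrow> 0) (at t within {0..T})"
      by simp
    have "Hnorm \<Omega> 1 (\<lambda>x. u s x - u t x) \<le> \<bar>s - t\<bar> * Hnorm \<Omega> 1 (?q s) + \<bar>s - t\<bar> * Hnorm \<Omega> 1 (u' t)"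
      if "s \<in> {0..T}" "s \<noteq> t" for s
    proof -
      have "?q s \<in> Hs \<Omega> 1"
        using Hs_1_lincomb[OF \<Omega> Hs_1_diff[OF \<Omega> H1(1)[OF that(1)] H1(1)[OF t]] H1(2)[OF t], of "1 / (s - t)" "-1"]
        by simp
      from Hnorm_1_lincomb_le[OF \<Omega> this H1(2)[OF t], of "s - t" "s - t"]
      moreover have "(\<lambda>x. (s - t) * ?q s x + (s - t) * u' t x) = (\<lambda>x. u s x - u t x)"
        using that(2) by (simp add: fun_eq_iff field_simps)
      ultimately show ?thesis by simp
    qed
    then show "\<forall>\<^sub>F s in at t within {0..T}. Hnorm \<Omega> 1 (\<lambda>x. u s x - u t x)
        \<le> \<bar>s - t\<bar> * Hnorm \<Omega> 1 (?q s) + \<bar>s - t\<bar> * Hnorm \<Omega> 1 (u' t)"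
      by (auto simp: eventually_at_filter)
  qed (simp add: Hnorm_nonneg)
qed

lemma time_deriv_l2_inner:
  assumes d: "time_deriv (l2_norm \<Omega>) T u u'" and t: "t \<in> {0..T}" and w: "w \<in> L2 \<Omega>"
    and L2: "\<And>t. t \<in> {0..T} \<Longrightarrow> u t \<in> L2 \<Omega>" "\<And>t. t \<in> {0..T} \<Longrightarrow> u' t \<in> L2 \<Omega>"
  shows "((\<lambda>s. l2_inner \<Omega> (u s) w) has_real_derivative l2_inner \<Omega> (u' t) w) (at t within {0..T})"
proof -
  let ?q = "\<lambda>s x. (u s x - u t x) / (s - t) - u' t x"
  have "((\<lambda>s. (l2_inner \<Omega> (u s) w - l2_inner \<Omega> (u t) w) / (s - t) - l2_inner \<Omega> (u' t) w) \<longlongrightarrow> 0)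
      (at t within {0..T})"
  proof (rule tendsto_rabs_zero_cancel, rule tendsto_sandwich[OF _ _ tendsto_const])
    have "((\<lambda>s. l2_norm \<Omega> (?q s) * l2_norm \<Omega> w) \<longlongrightarrow> 0 * l2_norm \<Omega> w) (at t within {0..T})"
      using d t by (intro tendsto_intros) (simp add: time_deriv_def)
    then show "((\<lambda>s. l2_norm \<Omega> (?q s) * l2_norm \<Omega> w) \<longlongrightarrow> 0) (at t within {0..T})" by simp
    have "\<bar>(l2_inner \<Omega> (u s) w - l2_inner \<Omega> (u t) w) / (s - t) - l2_inner \<Omega> (u' t) w\<bar>
        \<le> l2_norm \<Omega> (?q s) * l2_norm \<Omega> w" if s: "s \<in> {0..T}" for s
    proof -
      have dq: "(\<lambda>x. (u s x - u t x) / (s - t)) \<in> L2 \<Omega>"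
        using L2_scaleR[OF L2_diff[OF L2(1)[OF s] L2(1)[OF t]], of "1 / (s - t)"] by simp
      have "l2_inner \<Omega> (\<lambda>x. (u s x - u t x) / (s - t)) w = (l2_inner \<Omega> (u s) w - l2_inner \<Omega> (u t) w) / (s - t)"
        using l2_inner_scaleR_left[of \<Omega> "1 / (s - t)" "\<lambda>x. u s x - u t x" w]
          l2_inner_diff_left[OF L2(1)[OF s] L2(1)[OF t] w] by simp
      then have "(l2_inner \<Omega> (u s) w - l2_inner \<Omega> (u t) w) / (s - t) - l2_inner \<Omega> (u' t) w = l2_inner \<Omega> (?q s) w"
        using l2_inner_diff_left[OF dq L2(2)[OF t] w] by simp
      then show ?thesis
        using l2_Cauchy_Schwarz[OF L2_diff[OF dq L2(2)[OF t]] w] by simp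
    qed
    then show "\<forall>\<^sub>F s in at t within {0..T}.
        \<bar>(l2_inner \<Omega> (u s) w - l2_inner \<Omega> (u t) w) / (s - t) - l2_inner \<Omega> (u' t) w\<bar>
        \<le> l2_norm \<Omega> (?q s) * l2_norm \<Omega> w"
      by (auto simp: eventually_at_filter)
  qed simp
  then show ?thesis
    unfolding has_field_derivative_iff by (rule LIM_zero_cancel)
qed

text \<open>
  The derivative \<open>u'\<close> at the end of a time step against the difference quotient of an approximation
  \<open>V\<close>: the mean value theorem is applied to \<open>\<tau> \<mapsto> (V(\<tau>),v) - \<tau> (u'(t),v)\<close>.
\<close>

lemma difference_quotient_error:
  assumes du: "time_deriv (l2_norm \<Omega>) T u' u''" and dV: "time_deriv (l2_norm \<Omega>) T V V'"
    and L2: "\<And>t. t \<in> {0..T} \<Longrightarrow> u' t \<in> L2 \<Omega>" "\<And>t. t \<in> {0..T} \<Longrightarrow> u'' t \<in> L2 \<Omega>"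
      "\<And>t. t \<in> {0..T} \<Longrightarrow> V t \<in> L2 \<Omega>" "\<And>t. t \<in> {0..T} \<Longrightarrow> V' t \<in> L2 \<Omega>"
    and a: "\<And>t. t \<in> {0..T} \<Longrightarrow> l2_norm \<Omega> (u'' t) \<le> a"
    and b: "\<And>t. t \<in> {0..T} \<Longrightarrow> l2_norm \<Omega> (\<lambda>x. u' t x - V' t x) \<le> b"
    and s: "0 \<le> s" "s < t" "t \<le> T" and v: "v \<in> L2 \<Omega>"
  shows "\<bar>l2_inner \<Omega> (u' t) v - 1 / (t - s) * l2_inner \<Omega> (\<lambda>x. V t x - V s x) v\<bar>
           \<le> (a * (t - s) + b) * l2_norm \<Omega> v"
proof -
  have tT: "t \<in> {0..T}" "s \<in> {0..T}" and sub: "{s..t} \<subseteq> {0..T}" using s by auto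
  have a0: "0 \<le> a" using a[OF tT(1)] l2_norm_nonneg order_trans by blast
  let ?F = "\<lambda>\<tau>. l2_inner \<Omega> (V \<tau>) v - \<tau> * l2_inner \<Omega> (u' t) v"
  have lip: "\<bar>l2_inner \<Omega> (u' t) v - l2_inner \<Omega> (u' \<tau>) v\<bar> \<le> a * (t - s) * l2_norm \<Omega> v" if \<tau>: "\<tau> \<in> {s..t}" for \<tau>
  proof -
    have "norm (l2_inner \<Omega> (u' t) v - l2_inner \<Omega> (u' \<tau>) v) \<le> (a * l2_norm \<Omega> v) * norm (t - \<tau>)"
    proof (rule field_differentiable_bound[of "{0..T}" _ "\<lambda>z. l2_inner \<Omega> (u'' z) v"])
      fix z assume z: "z \<in> {0..T}"
      show "((\<lambda>s. l2_inner \<Omega> (u' s) v) has_real_derivative l2_inner \<Omega> (u'' z) v) (at z within {0..T})"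
        by (rule time_deriv_l2_inner[OF du z v L2(1,2)])
      have "\<bar>l2_inner \<Omega> (u'' z) v\<bar> \<le> l2_norm \<Omega> (u'' z) * l2_norm \<Omega> v"
        by (rule l2_Cauchy_Schwarz[OF L2(2)[OF z] v])
      also have "\<dots> \<le> a * l2_norm \<Omega> v" by (intro mult_right_mono a z l2_norm_nonneg)
      finally show "norm (l2_inner \<Omega> (u'' z) v) \<le> a * l2_norm \<Omega> v" by simp
    qed (use that sub tT in auto)
    also have "\<dots> \<le> (a * l2_norm \<Omega> v) * (t - s)"
      using \<tau> a0 by (intro mult_left_mono) (auto simp: l2_norm_nonneg)
    finally show ?thesis by (simp add: ac_simps)
  qed
  have "norm (?F t - ?F s) \<le> ((a * (t - s) + b) * l2_norm \<Omega> v) * norm (t - s)"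
  proof (rule field_differentiable_bound[of "{s..t}" _ "\<lambda>z. l2_inner \<Omega> (V' z) v - l2_inner \<Omega> (u' t) v"])
    fix z assume "z \<in> {s..t}"
    then have z: "z \<in> {0..T}" using sub by blast
    have "((\<lambda>\<tau>. l2_inner \<Omega> (V \<tau>) v) has_real_derivative l2_inner \<Omega> (V' z) v) (at z within {s..t})"
      using time_deriv_l2_inner[OF dV z v L2(3,4)] sub by (rule DERIV_subset)
    then show "(?F has_real_derivative l2_inner \<Omega> (V' z) v - l2_inner \<Omega> (u' t) v) (at z within {s..t})"
      by (auto intro!: derivative_eq_intros)
    have "\<bar>l2_inner \<Omega> (u' z) v - l2_inner \<Omega> (V' z) v\<bar> \<le> l2_norm \<Omega> (\<lambda>x. u' z x - V' z x) * l2_norm \<Omega> v"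
      using l2_Cauchy_Schwarz[OF L2_diff[OF L2(1)[OF z] L2(4)[OF z]] v]
        l2_inner_diff_left[OF L2(1)[OF z] L2(4)[OF z] v] by simp
    also have "\<dots> \<le> b * l2_norm \<Omega> v" by (intro mult_right_mono b z l2_norm_nonneg)
    finally show "norm (l2_inner \<Omega> (V' z) v - l2_inner \<Omega> (u' t) v) \<le> (a * (t - s) + b) * l2_norm \<Omega> v"
      using lip[OF \<open>z \<in> {s..t}\<close>] unfolding distrib_right by simp
  qed (use s in auto)
  moreover have "l2_inner \<Omega> (u' t) v - 1 / (t - s) * l2_inner \<Omega> (\<lambda>x. V t x - V s x) v = - (?F t - ?F s) / (t - s)"
    using s l2_inner_diff_left[OF L2(3)[OF tT(1)] L2(3)[OF tT(2)] v] by (simp add: field_simps)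
  ultimately show ?thesis
    using s by (simp add: field_simps abs_minus_commute)
qed

section \<open>A discrete Gronwall estimate\<close>

text \<open>
  Here \<open>x\<close> stands for \<open>L\<^sup>2\<close> norms, \<open>y\<close> for \<open>H\<^sup>1\<close> norms, \<open>k\<close> is the time step and \<open>k z\<close> a perturbation.  Young's
  inequality absorbs half of the dissipation \<open>k \<nu> y\<^sup>2\<close>; the square of the memory sum is at most \<open>T/\<nu>\<close> times
  the energy accumulated so far, so the energies satisfy a linear recursion.
\<close>

lemma discrete_energy_bound:
  fixes x y z :: "nat \<Rightarrow> real" and k \<nu> c T \<eta> :: real
  assumes k: "k > 0" "real N * k \<le> T" and \<nu>: "\<nu> > 0" and c: "c \<ge> 0"
    and step: "\<And>n. n \<in> {1..N} \<Longrightarrow> ((x n)\<^sup>2 - (x (n - 1))\<^sup>2) / 2 + k * \<nu> * (y n)\<^sup>2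
                 \<le> k * c * y n * (\<eta> + k * (\<Sum>i=1..n-1. y i) + k * z n)"
    and D: "D = 3 * c\<^sup>2 / \<nu> * max 1 (T / \<nu>)"
    and "n \<le> N"
  shows "(x n)\<^sup>2 + k * \<nu> * (\<Sum>i=1..n. (y i)\<^sup>2)
           \<le> exp (D * T) * ((x 0)\<^sup>2 + D * T * \<eta>\<^sup>2 + D * k\<^sup>2 * (k * (\<Sum>i=1..n. (z i)\<^sup>2)))"
proof -
  define S where "S n = (x n)\<^sup>2 + k * \<nu> * (\<Sum>i=1..n. (y i)\<^sup>2)" for n
  define e where "e n = k * D * (\<eta>\<^sup>2 + k\<^sup>2 * (z n)\<^sup>2)" for n
  have D0: "D \<ge> 0" using \<nu> unfolding D by (auto intro!: mult_nonneg_nonneg)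
  have S0: "S n \<ge> 0" for n
    unfolding S_def using k \<nu> by (auto intro!: add_nonneg_nonneg mult_nonneg_nonneg sum_nonneg)
  have e0: "e n \<ge> 0" for n
    unfolding e_def using k D0 by (auto intro!: add_nonneg_nonneg mult_nonneg_nonneg)
  have rec: "S (Suc n) \<le> (1 + k * D) * S n + e (Suc n)" if "Suc n \<le> N" for n
  proof -
    define m where "m = Suc n"
    define Y where "Y = k * (\<Sum>i=1..n. y i)"
    define X where "X = \<eta> + Y + k * z m"
    have Y2: "Y\<^sup>2 \<le> T / \<nu> * S n"
    proof -
      have "(\<Sum>i=1..n. y i * 1)\<^sup>2 \<le> (\<Sum>i=1..n. (y i)\<^sup>2) * (\<Sum>i=1..n. 1\<^sup>2)"
        by (rule Cauchy_Schwarz_ineq_sum)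
      then have "Y\<^sup>2 \<le> k\<^sup>2 * ((\<Sum>i=1..n. (y i)\<^sup>2) * real n)"
        unfolding Y_def power_mult_distrib by (intro mult_left_mono) auto
      also have "\<dots> = (real n * k) * (k * (\<Sum>i=1..n. (y i)\<^sup>2))"
        by (simp add: power2_eq_square)
      also have "\<dots> \<le> T * (k * (\<Sum>i=1..n. (y i)\<^sup>2))"
      proof (rule mult_right_mono)
        have "real n * k \<le> real N * k" using that k by (intro mult_right_mono) auto
        with k(2) show "real n * k \<le> T" by linarith
        show "0 \<le> k * (\<Sum>i=1..n. (y i)\<^sup>2)" using k by (simp add: sum_nonneg)
      qed
      also have "\<dots> = T / \<nu> * (k * \<nu> * (\<Sum>i=1..n. (y i)\<^sup>2))" using \<nu> by simp
      also have "\<dots> \<le> T / \<nu> * S n"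
      proof (rule mult_left_mono)
        have "0 \<le> real N * k" using k(1) by simp
        with k(2) have "0 \<le> T" by linarith
        then show "0 \<le> T / \<nu>" using \<nu> by simp
      qed (simp add: S_def)
      finally show ?thesis .
    qed
    have X2: "X\<^sup>2 \<le> 3 * (\<eta>\<^sup>2 + Y\<^sup>2 + k\<^sup>2 * (z m)\<^sup>2)"
    proof -
      have "0 \<le> (\<eta> - Y)\<^sup>2 + (\<eta> - k * z m)\<^sup>2 + (Y - k * z m)\<^sup>2" by simp
      then show ?thesis unfolding X_def by (simp add: power2_eq_square algebra_simps)
    qed
    have young: "2 * (c * y m * X) \<le> \<nu> * (y m)\<^sup>2 + c\<^sup>2 / \<nu> * X\<^sup>2"
    proof -
      have "0 \<le> (\<nu> * y m - c * X)\<^sup>2 / \<nu>" using \<nu> by simp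
      also have "\<dots> = \<nu> * (y m)\<^sup>2 + c\<^sup>2 / \<nu> * X\<^sup>2 - 2 * (c * y m * X)"
        using \<nu> by (simp add: power2_eq_square field_simps)
      finally show ?thesis by simp
    qed
    have "((x m)\<^sup>2 - (x n)\<^sup>2) / 2 + k * \<nu> * (y m)\<^sup>2 \<le> k * (c * y m * X)"
      using step[of m] that unfolding m_def X_def Y_def by (simp add: mult.assoc)
    then have "(x m)\<^sup>2 - (x n)\<^sup>2 + 2 * (k * \<nu> * (y m)\<^sup>2) \<le> k * (2 * (c * y m * X))"
      by (simp add: field_simps)
    also have "\<dots> \<le> k * (\<nu> * (y m)\<^sup>2 + c\<^sup>2 / \<nu> * X\<^sup>2)"
      using young k by (intro mult_left_mono) auto
    finally have "(x m)\<^sup>2 - (x n)\<^sup>2 + k * \<nu> * (y m)\<^sup>2 \<le> k * (c\<^sup>2 / \<nu> * X\<^sup>2)"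
      by (simp add: algebra_simps)
    moreover have "S m = S n + ((x m)\<^sup>2 - (x n)\<^sup>2 + k * \<nu> * (y m)\<^sup>2)"
      by (simp add: S_def m_def algebra_simps)
    moreover have "k * (c\<^sup>2 / \<nu> * X\<^sup>2) \<le> k * D * S n + e m"
    proof -
      have "c\<^sup>2 / \<nu> * X\<^sup>2 \<le> c\<^sup>2 / \<nu> * (3 * (\<eta>\<^sup>2 + T / \<nu> * S n + k\<^sup>2 * (z m)\<^sup>2))"
        using X2 Y2 \<nu> by (intro mult_left_mono) auto
      also have "\<dots> = 3 * c\<^sup>2 / \<nu> * (T / \<nu> * S n + 1 * (\<eta>\<^sup>2 + k\<^sup>2 * (z m)\<^sup>2))"
        by (simp add: algebra_simps)
      also have "\<dots> \<le> 3 * c\<^sup>2 / \<nu> * (max 1 (T / \<nu>) * S n + max 1 (T / \<nu>) * (\<eta>\<^sup>2 + k\<^sup>2 * (z m)\<^sup>2))"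
        using \<nu> S0 by (intro mult_left_mono add_mono mult_right_mono) auto
      also have "\<dots> = D * S n + D * (\<eta>\<^sup>2 + k\<^sup>2 * (z m)\<^sup>2)"
        unfolding D by (simp add: algebra_simps)
      finally show ?thesis
        unfolding e_def using k
        by (metis (no_types, opaque_lifting) distrib_left less_imp_le mult.assoc mult_left_mono)
    qed
    ultimately show ?thesis unfolding m_def by (simp add: algebra_simps)
  qed
  have "S n \<le> (1 + k * D) ^ n * (S 0 + (\<Sum>i=1..n. e i))" if "n \<le> N" for n
    using that
  proof (induction n)
    case (Suc n)
    have q: "1 + k * D \<ge> 1" using k D0 by simp
    have "S (Suc n) \<le> (1 + k * D) * S n + e (Suc n)" using rec Suc.prems by blast
    also have "\<dots> \<le> (1 + k * D) * ((1 + k * D) ^ n * (S 0 + (\<Sum>i=1..n. e i))) + (1 + k * D) ^ Suc n * e (Suc n)"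
    proof (rule add_mono)
      show "(1 + k * D) * S n \<le> (1 + k * D) * ((1 + k * D) ^ n * (S 0 + (\<Sum>i=1..n. e i)))"
        using Suc q by (intro mult_left_mono) auto
      show "e (Suc n) \<le> (1 + k * D) ^ Suc n * e (Suc n)"
        using mult_right_mono[OF one_le_power[OF q, of "Suc n"] e0[of "Suc n"]] by simp
    qed
    also have "\<dots> = (1 + k * D) ^ Suc n * (S 0 + (\<Sum>i=1..Suc n. e i))"
      by (simp add: algebra_simps)
    finally show ?case .
  qed simp
  from this[OF \<open>n \<le> N\<close>]
  have "S n \<le> (1 + k * D) ^ n * (S 0 + (\<Sum>i=1..n. e i))" .
  also have "\<dots> \<le> exp (D * T) * ((x 0)\<^sup>2 + D * T * \<eta>\<^sup>2 + D * k\<^sup>2 * (k * (\<Sum>i=1..n. (z i)\<^sup>2)))"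
  proof (rule mult_mono)
    have nk: "real n * k \<le> T"
      using mult_right_mono[of "real n" "real N" k] \<open>n \<le> N\<close> k by (meson less_imp_le of_nat_le_iff order_trans)
    have "(1 + k * D) ^ n \<le> exp (k * D) ^ n"
      using k D0 exp_ge_add_one_self[of "k * D"] by (intro power_mono) auto
    also have "\<dots> = exp (D * (real n * k))" by (simp add: exp_of_nat_mult[symmetric] ac_simps)
    also have "\<dots> \<le> exp (D * T)" using nk D0 by (simp add: mult_left_mono)
    finally show "(1 + k * D) ^ n \<le> exp (D * T)" .
    have "(\<Sum>i=1..n. e i) = D * (real n * k) * \<eta>\<^sup>2 + D * k\<^sup>2 * (k * (\<Sum>i=1..n. (z i)\<^sup>2))"
      unfolding e_def by (simp add: sum.distrib sum_distrib_left algebra_simps)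
    also have "\<dots> \<le> D * T * \<eta>\<^sup>2 + D * k\<^sup>2 * (k * (\<Sum>i=1..n. (z i)\<^sup>2))"
      using nk D0 by (intro add_right_mono mult_right_mono mult_left_mono) auto
    finally show "S 0 + (\<Sum>i=1..n. e i) \<le> (x 0)\<^sup>2 + D * T * \<eta>\<^sup>2 + D * k\<^sup>2 * (k * (\<Sum>i=1..n. (z i)\<^sup>2))"
      by (simp add: S_def)
    show "0 \<le> S 0 + (\<Sum>i=1..n. e i)" using S0 e0 by (simp add: sum_nonneg)
  qed simp
  finally show ?thesis by (simp add: S_def)
qed

section \<open>The projection and its consistency\<close>

lemma B_form_continuous_on:
  fixes p q :: "real \<Rightarrow> real^'d \<Rightarrow> real"
  assumes \<Omega>: "open \<Omega>" "bounded \<Omega>"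
    and coeff: "lipschitz_coeff \<Omega> C \<alpha>" "lipschitz_coeff \<Omega> C \<beta>" "lipschitz_coeff \<Omega> C \<gamma>" "lipschitz_coeff \<Omega> C g"
    and H1: "\<And>t. t \<in> X \<Longrightarrow> p t \<in> Hs \<Omega> 1" "\<And>t. t \<in> X \<Longrightarrow> q t \<in> Hs \<Omega> 1" "v \<in> Hs \<Omega> 1"
    and cont: "\<And>t. t \<in> X \<Longrightarrow> ((\<lambda>s. Hnorm \<Omega> 1 (\<lambda>x. p s x - p t x)) \<longlongrightarrow> 0) (at t within X)"
      "\<And>t. t \<in> X \<Longrightarrow> ((\<lambda>s. Hnorm \<Omega> 1 (\<lambda>x. q s x - q t x)) \<longlongrightarrow> 0) (at t within X)"
    and G: "\<And>t. t \<in> X \<Longrightarrow> AE x in lebesgue_on \<Omega>. norm (wgrad \<Omega> (q t) x) \<le> G" "G \<ge> 0"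
  shows "continuous_on X (\<lambda>s. B_form \<Omega> \<alpha> \<beta> \<gamma> g (p s) (q s) v)"
  unfolding continuous_on_def
proof
  fix t assume t: "t \<in> X"
  let ?B = "\<lambda>s. B_form \<Omega> \<alpha> \<beta> \<gamma> g (p s) (q s) v"
  let ?e = "\<lambda>s. 4 * C * (1 + G) * (Hnorm \<Omega> 1 (\<lambda>x. p s x - p t x) + Hnorm \<Omega> 1 (\<lambda>x. q s x - q t x)) * Hnorm \<Omega> 1 v"
  have C: "C \<ge> 0" using coeff(1) by (simp add: lipschitz_coeff_def)
  have "((\<lambda>s. ?B s - ?B t) \<longlongrightarrow> 0) (at t within X)"
  proof (rule tendsto_rabs_zero_cancel, rule tendsto_sandwich[OF _ _ tendsto_const])
    have "(?e \<longlongrightarrow> 4 * C * (1 + G) * (0 + 0) * Hnorm \<Omega> 1 v) (at t within X)"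
      by (intro tendsto_intros cont t)
    then show "(?e \<longlongrightarrow> 0) (at t within X)" by simp
    have "\<bar>?B s - ?B t\<bar> \<le> ?e s" if s: "s \<in> X" for s
    proof -
      have "\<bar>?B s - ?B t\<bar> \<le> 4 * C * (1 + G) * (l2_norm \<Omega> (\<lambda>x. p s x - p t x)
          + Hnorm \<Omega> 1 (\<lambda>x. q s x - q t x)) * Hnorm \<Omega> 1 v"
        by (intro B_form_lipschitz[OF \<Omega> coeff] H1 Hs_1_L2 G s t)
      also have "\<dots> \<le> ?e s"
        using C G(2) l2_norm_le_Hnorm_1(1)[OF \<Omega> Hs_1_diff[OF \<Omega> H1(1)[OF s] H1(1)[OF t]]]
        by (intro mult_right_mono mult_left_mono add_right_mono) (auto simp: Hnorm_nonneg)
      finally show ?thesis .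
    qed
    then show "\<forall>\<^sub>F s in at t within X. \<bar>?B s - ?B t\<bar> \<le> ?e s"
      by (auto simp: eventually_at_filter)
  qed simp
  then show "(?B \<longlongrightarrow> ?B t) (at t within X)" by (rule LIM_zero_cancel)
qed

lemma linf_norm_AE:
  assumes "linf_norm \<Omega> v \<le> ereal C"
  shows "AE x in lebesgue_on \<Omega>. norm (v x) \<le> C"
proof -
  have "AE x in lebesgue_on \<Omega>. ereal (norm (v x)) \<le> linf_norm \<Omega> v"
    unfolding linf_norm_def by (rule esssup_AE)
  then show ?thesis
  proof eventually_elim
    case (elim x)
    from order_trans[OF this assms] show ?case by simp
  qed
qed

text \<open>
  On a set of measure zero the essential supremum is \<open>-\<infinity>\<close>; hence the hypothesis that \<open>\<Omega>\<close> is nonempty.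
\<close>

lemma linf_norm_nonneg:
  assumes "open \<Omega>" "\<Omega> \<noteq> {}"
  shows "0 \<le> linf_norm \<Omega> v"
proof (rule ccontr)
  assume "\<not> 0 \<le> linf_norm \<Omega> v"
  then have neg: "linf_norm \<Omega> v < 0" by simp
  have "AE x in lebesgue_on \<Omega>. ereal (norm (v x)) \<le> linf_norm \<Omega> v"
    unfolding linf_norm_def by (rule esssup_AE)
  then have "AE x in lebesgue_on \<Omega>. False"
  proof eventually_elim
    case (elim x)
    from order_le_less_trans[OF this neg] show ?case by simp
  qed
  then have "AE x in lebesgue. x \<notin> \<Omega>"
    using assms(1) by (simp add: AE_restrict_space_iff)
  then have "negligible \<Omega>"
    using assms(1) by (simp add: AE_iff_null_sets negligible_iff_null_sets)
  with open_not_negligible assms show False by blast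
qed

lemma fin_dim_subspace_diff:
  assumes "fin_dim_subspace S" "v \<in> S" "w \<in> S"
  shows "(\<lambda>x. v x - w x) \<in> S"
proof -
  obtain E where E: "S = {v. \<exists>c. v = (\<lambda>x. \<Sum>e\<in>E. c e * e x)}"
    using assms(1) unfolding fin_dim_subspace_def by blast
  then obtain c d where "v = (\<lambda>x. \<Sum>e\<in>E. c e * e x)" "w = (\<lambda>x. \<Sum>e\<in>E. d e * e x)"
    using assms(2,3) by blast
  then have "(\<lambda>x. v x - w x) = (\<lambda>x. \<Sum>e\<in>E. (c e - d e) * e x)"
    by (simp add: sum_subtractf left_diff_distrib)
  then show ?thesis unfolding E by (intro CollectI exI)
qed

text \<open>
  The setting: an exact solution \<open>u\<close> of the integro-differential problem, with its time derivatives \<open>ut\<close> and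
  \<open>utt\<close>, the discrete spaces \<open>S h\<close>, and the Ritz--Volterra projections \<open>V h\<close> of \<open>u\<close>, with time derivatives
  \<open>Vt h\<close>.  The smoothness of the nonlinear coefficients is reduced to the common bound and Lipschitz
  constant \<open>L\<close>.
\<close>

locale memory_problem =
  fixes \<Omega> :: "(real^'d) set" and T r \<nu>0 L :: real
    and a :: "real^'d \<Rightarrow> real \<Rightarrow> real^'d^'d" and a0 :: "real^'d \<Rightarrow> real \<Rightarrow> real"
    and \<alpha> :: "real^'d \<Rightarrow> real \<Rightarrow> real^'d^'d"
    and \<beta> \<gamma> :: "real^'d \<Rightarrow> real \<Rightarrow> real^'d"
    and g :: "real^'d \<Rightarrow> real \<Rightarrow> real"
    and K :: "real \<Rightarrow> real"
    and f u ut utt :: "real \<Rightarrow> real^'d \<Rightarrow> real" and u0 :: "real^'d \<Rightarrow> real"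
    and S :: "real \<Rightarrow> (real^'d \<Rightarrow> real) set"
    and V Vt :: "real \<Rightarrow> real \<Rightarrow> real^'d \<Rightarrow> real"
    and \<omega> :: "nat \<Rightarrow> nat \<Rightarrow> nat \<Rightarrow> real"
  assumes \<Omega>: "open \<Omega>" "bounded \<Omega>" and \<Omega>_ne: "\<Omega> \<noteq> {}" and T: "T > 0" and r: "r \<ge> 1"
    and kernel: "set_integrable lborel {0..T} K"
    and elliptic: "elliptic_coeffs \<Omega> T a a0" and \<nu>0: "\<nu>0 > 0"
    and coercive: "\<And>t v. t \<in> {0..T} \<Longrightarrow> v \<in> H10 \<Omega> \<Longrightarrow> A_form \<Omega> a a0 t v v \<ge> \<nu>0 * (Hnorm \<Omega> 1 v)\<^sup>2"
    and coeff: "lipschitz_coeff \<Omega> L \<alpha>" "lipschitz_coeff \<Omega> L \<beta>" "lipschitz_coeff \<Omega> L \<gamma>" "lipschitz_coeff \<Omega> L g"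
    and solution: "weak_solution \<Omega> T (A_form \<Omega> a a0) (B_form \<Omega> \<alpha> \<beta> \<gamma> g) K f u0 u ut"
    and spaces: "fe_family \<Omega> r S"
    and weights: "quadrature_weights T K \<omega>"
    and projection: "\<And>h. h \<in> {0<..1} \<Longrightarrow> ritz_volterra T (A_form \<Omega> a a0) (B1_form \<Omega> \<alpha> \<gamma>) K (S h) u (V h)"
    and regularity: "regular_solution \<Omega> T r u ut utt"
    and projection_regularity: "projection_bounds \<Omega> T r S u ut V Vt"
    and quadrature_B1:
      "\<exists>C. \<forall>h\<in>{0<..1}. \<forall>v\<in>S h. \<forall>N n. 1 \<le> n \<and> n \<le> N \<longrightarrow>
         quad_err T K \<omega> N n (\<lambda>s. B1_form \<Omega> \<alpha> \<gamma> (u s) (V h s) v) \<le> C * (T / N) * Hnorm \<Omega> 1 v"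
    and quadrature_lower:
      "\<exists>C. \<forall>h\<in>{0<..1}. \<forall>v\<in>S h. \<forall>N n. 1 \<le> n \<and> n \<le> N \<longrightarrow>
         quad_err T K \<omega> N n (\<lambda>s. l2_inner \<Omega> (\<lambda>x. \<beta> x (u s x)) (wgrad \<Omega> v)
                                  + l2_inner \<Omega> (\<lambda>x. g x (u s x)) v) \<le> C * (T / N) * Hnorm \<Omega> 1 v"
begin

abbreviation "A \<equiv> A_form \<Omega> a a0"
abbreviation "B \<equiv> B_form \<Omega> \<alpha> \<beta> \<gamma> g"
abbreviation "B1 \<equiv> B1_form \<Omega> \<alpha> \<gamma>"

text \<open>The part of the nonlinear form that does not involve the gradient of its second argument.\<close>

abbreviation lower :: "(real^'d \<Rightarrow> real) \<Rightarrow> (real^'d \<Rightarrow> real) \<Rightarrow> real" where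
  "lower w v \<equiv> l2_inner \<Omega> (\<lambda>x. \<beta> x (w x)) (wgrad \<Omega> v) + l2_inner \<Omega> (\<lambda>x. g x (w x)) v"

lemma L_nonneg: "L \<ge> 0" using coeff(1) by (simp add: lipschitz_coeff_def)

lemma H10_H1: "v \<in> H10 \<Omega> \<Longrightarrow> v \<in> Hs \<Omega> 1" by (simp add: H10_def)

lemma S_H10: "h \<in> {0<..1} \<Longrightarrow> v \<in> S h \<Longrightarrow> v \<in> H10 \<Omega>"
  using spaces unfolding fe_family_def by blast

lemma S_H1: "h \<in> {0<..1} \<Longrightarrow> v \<in> S h \<Longrightarrow> v \<in> Hs \<Omega> 1"
  using S_H10 H10_H1 by blast

lemma S_diff: "h \<in> {0<..1} \<Longrightarrow> v \<in> S h \<Longrightarrow> w \<in> S h \<Longrightarrow> (\<lambda>x. v x - w x) \<in> S h"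
  using spaces unfolding fe_family_def by (blast intro: fin_dim_subspace_diff)

lemma u_H10: "t \<in> {0..T} \<Longrightarrow> u t \<in> H10 \<Omega>" "t \<in> {0..T} \<Longrightarrow> ut t \<in> H10 \<Omega>"
  and utt_L2: "t \<in> {0..T} \<Longrightarrow> utt t \<in> L2 \<Omega>"
  using regularity unfolding regular_solution_def by auto

lemma u_H1: "t \<in> {0..T} \<Longrightarrow> u t \<in> Hs \<Omega> 1" "t \<in> {0..T} \<Longrightarrow> ut t \<in> Hs \<Omega> 1"
  using u_H10 H10_H1 by blast+

lemma V_S: "h \<in> {0<..1} \<Longrightarrow> t \<in> {0..T} \<Longrightarrow> V h t \<in> S h"
  using projection unfolding ritz_volterra_def by blast

lemma Vt_S: "h \<in> {0<..1} \<Longrightarrow> t \<in> {0..T} \<Longrightarrow> Vt h t \<in> S h"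
  using projection_regularity unfolding projection_bounds_def by blast

lemma V_H1: "h \<in> {0<..1} \<Longrightarrow> t \<in> {0..T} \<Longrightarrow> V h t \<in> Hs \<Omega> 1"
  and Vt_H1: "h \<in> {0<..1} \<Longrightarrow> t \<in> {0..T} \<Longrightarrow> Vt h t \<in> Hs \<Omega> 1"
  by (simp_all add: S_H1 V_S Vt_S)

lemma u_continuous:
  "t \<in> {0..T} \<Longrightarrow> ((\<lambda>s. Hnorm \<Omega> 1 (\<lambda>x. u s x - u t x)) \<longlongrightarrow> 0) (at t within {0..T})"
  using regularity unfolding regular_solution_def
  by (intro time_deriv_H1_continuous[OF \<Omega>, of T u ut] u_H1) auto

lemma V_continuous:
  assumes "h \<in> {0<..1}" "t \<in> {0..T}"
  shows "((\<lambda>s. Hnorm \<Omega> 1 (\<lambda>x. V h s x - V h t x)) \<longlongrightarrow> 0) (at t within {0..T})"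
  using projection_regularity assms unfolding projection_bounds_def
  by (intro time_deriv_H1_continuous[OF \<Omega>, of T "V h" "Vt h"] V_H1 Vt_H1) auto

lemma grad_bound:
  "\<exists>G\<ge>0. (\<forall>t\<in>{0..T}. AE x in lebesgue_on \<Omega>. norm (wgrad \<Omega> (u t) x) \<le> G) \<and>
     (\<forall>h\<in>{0<..1}. \<forall>t\<in>{0..T}. AE x in lebesgue_on \<Omega>. norm (wgrad \<Omega> (V h t) x) \<le> G)"
proof -
  obtain C1 where C1: "\<And>t. t \<in> {0..T} \<Longrightarrow> linf_norm \<Omega> (wgrad \<Omega> (u t)) \<le> ereal C1"
    using regularity unfolding regular_solution_def by blast
  obtain C2 where C2: "\<And>h t. h \<in> {0<..1} \<Longrightarrow> t \<in> {0..T} \<Longrightarrow>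
      linf_norm \<Omega> (wgrad \<Omega> (V h t)) + linf_norm \<Omega> (wgrad \<Omega> (Vt h t)) \<le> ereal C2"
    using projection_regularity unfolding projection_bounds_def by blast
  define G where "G = max 0 (max C1 C2)"
  have G: "0 \<le> G" "C1 \<le> G" "C2 \<le> G" by (auto simp: G_def)
  have "linf_norm \<Omega> (wgrad \<Omega> (u t)) \<le> ereal G" if "t \<in> {0..T}" for t
    using C1[OF that] by (rule order_trans) (simp add: G)
  moreover have "linf_norm \<Omega> (wgrad \<Omega> (V h t)) \<le> ereal G" if "h \<in> {0<..1}" "t \<in> {0..T}" for h t
  proof -
    have "linf_norm \<Omega> (wgrad \<Omega> (V h t)) \<le> linf_norm \<Omega> (wgrad \<Omega> (V h t)) + linf_norm \<Omega> (wgrad \<Omega> (Vt h t))"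
      using add_left_mono[OF linf_norm_nonneg[OF \<Omega>(1) \<Omega>_ne, of "wgrad \<Omega> (Vt h t)"],
          of "linf_norm \<Omega> (wgrad \<Omega> (V h t))"] by simp
    also have "\<dots> \<le> ereal C2" by (rule C2[OF that])
    also have "\<dots> \<le> ereal G" by (simp add: G)
    finally show ?thesis .
  qed
  ultimately show ?thesis
    by (intro exI[of _ G]) (auto intro: linf_norm_AE simp: G)
qed

text \<open>\<open>C\<close> bounds the projection error: in \<open>L\<^sup>2\<close> and for the time derivative to full order, in \<open>H\<^sup>1\<close> merely
  uniformly in the mesh size.\<close>

abbreviation projection_const :: "real \<Rightarrow> bool" where
  "projection_const C \<equiv> C \<ge> 0 \<and> (\<forall>h\<in>{0<..1}. \<forall>t\<in>{0..T}.
     l2_norm \<Omega> (\<lambda>x. u t x - V h t x) \<le> C * h powr r \<and>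
     Hnorm \<Omega> 1 (\<lambda>x. u t x - V h t x) \<le> C \<and>
     l2_norm \<Omega> (\<lambda>x. ut t x - Vt h t x) \<le> C * h powr r)"

lemma projection_error: "\<exists>C. projection_const C"
proof -
  obtain C where C: "\<And>h t. h \<in> {0<..1} \<Longrightarrow> t \<in> {0..T} \<Longrightarrow>
      l2_norm \<Omega> (\<lambda>x. u t x - V h t x) + h * Hnorm \<Omega> 1 (\<lambda>x. u t x - V h t x)
          + l2_norm \<Omega> (\<lambda>x. ut t x - Vt h t x) \<le> C * h powr r"
    using projection_regularity unfolding projection_bounds_def by blast
  have "l2_norm \<Omega> (\<lambda>x. u t x - V h t x) \<le> \<bar>C\<bar> * h powr r \<and>
     Hnorm \<Omega> 1 (\<lambda>x. u t x - V h t x) \<le> \<bar>C\<bar> \<and>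
     l2_norm \<Omega> (\<lambda>x. ut t x - Vt h t x) \<le> \<bar>C\<bar> * h powr r"
    if h: "h \<in> {0<..1}" and t: "t \<in> {0..T}" for h t
  proof -
    have "C * h powr r \<le> \<bar>C\<bar> * h powr r" by (intro mult_right_mono) auto
    moreover have "0 \<le> h * Hnorm \<Omega> 1 (\<lambda>x. u t x - V h t x)" using h by (simp add: Hnorm_nonneg)
    moreover note C[OF h t] l2_norm_nonneg[of \<Omega> "\<lambda>x. u t x - V h t x"]
      l2_norm_nonneg[of \<Omega> "\<lambda>x. ut t x - Vt h t x"]
    ultimately have le: "l2_norm \<Omega> (\<lambda>x. u t x - V h t x) \<le> \<bar>C\<bar> * h powr r"
      "h * Hnorm \<Omega> 1 (\<lambda>x. u t x - V h t x) \<le> \<bar>C\<bar> * h powr r"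
      "l2_norm \<Omega> (\<lambda>x. ut t x - Vt h t x) \<le> \<bar>C\<bar> * h powr r"
      by linarith+
    \<comment> \<open>\<open>r \<ge> 1\<close> and \<open>h \<le> 1\<close>, so a factor \<open>h\<close> can be cancelled.\<close>
    have "\<bar>C\<bar> * h powr r \<le> \<bar>C\<bar> * h"
      using powr_le_one_le[of h r] h r by (intro mult_left_mono) auto
    with le(2) have "h * Hnorm \<Omega> 1 (\<lambda>x. u t x - V h t x) \<le> h * \<bar>C\<bar>" by (simp add: mult.commute)
    with le h show ?thesis by simp
  qed
  then show ?thesis by (intro exI[of _ "\<bar>C\<bar>"]) auto
qed

lemma B_eq_B1_lower:
  assumes "w \<in> L2 \<Omega>" "z \<in> Hs \<Omega> 1" "v \<in> Hs \<Omega> 1"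
  shows "B w z v = B1 w z v + lower w v"
  by (rule B_form_eq_flux(3)[OF \<Omega> coeff assms])

lemma continuous_forms:
  assumes h: "h \<in> {0<..1}" and v: "v \<in> Hs \<Omega> 1"
  shows "continuous_on {0..T} (\<lambda>s. B1 (u s) (V h s) v)"
    and "continuous_on {0..T} (\<lambda>s. B1 (u s) (\<lambda>x. u s x - V h s x) v)"
    and "continuous_on {0..T} (\<lambda>s. lower (u s) v)"
proof -
  obtain G where G: "G \<ge> 0" "\<And>t. t \<in> {0..T} \<Longrightarrow> AE x in lebesgue_on \<Omega>. norm (wgrad \<Omega> (u t) x) \<le> G"
    "\<And>h t. h \<in> {0<..1} \<Longrightarrow> t \<in> {0..T} \<Longrightarrow> AE x in lebesgue_on \<Omega>. norm (wgrad \<Omega> (V h t) x) \<le> G"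
    using grad_bound by blast
  note zero = lipschitz_coeff_zero[OF L_nonneg]
  show V: "continuous_on {0..T} (\<lambda>s. B1 (u s) (V h s) v)"
    unfolding B1_form_eq_B_form
    by (rule B_form_continuous_on[OF \<Omega> coeff(1) zero coeff(3) zero])
       (use u_H1 V_H1 h v u_continuous V_continuous G in auto)
  have U: "continuous_on {0..T} (\<lambda>s. B1 (u s) (u s) v)"
    unfolding B1_form_eq_B_form
    by (rule B_form_continuous_on[OF \<Omega> coeff(1) zero coeff(3) zero])
       (use u_H1 v u_continuous G in auto)
  have "B1 (u s) (\<lambda>x. u s x - V h s x) v = B1 (u s) (u s) v - B1 (u s) (V h s) v" if "s \<in> {0..T}" for s
    by (intro B1_form_diff_right[OF \<Omega> coeff(1,3)] Hs_1_L2 u_H1 V_H1 h v that)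
  then show "continuous_on {0..T} (\<lambda>s. B1 (u s) (\<lambda>x. u s x - V h s x) v)"
    by (intro continuous_on_eq[OF continuous_on_diff[OF U V]]) simp
  have "continuous_on {0..T} (\<lambda>s. B_form \<Omega> (\<lambda>x s. 0) \<beta> (\<lambda>x s. 0) g (u s) (u s) v)"
    by (rule B_form_continuous_on[OF \<Omega> zero coeff(2) zero coeff(4)])
       (use u_H1 v u_continuous G in auto)
  then show "continuous_on {0..T} (\<lambda>s. lower (u s) v)"
    by (simp add: B_form_def)
qed

text \<open>
  The defining equation of the projection removes \<open>A(u - V\<^sub>h u, v)\<close> together with the memory of
  \<open>B\<^sub>1(u; u - V\<^sub>h u, v)\<close> from the weak form, so that \<open>u\<close> survives only in the time derivative and in the
  coefficients.
\<close>

lemma projection_equation: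
  assumes h: "h \<in> {0<..1}" and t: "t \<in> {0<..T}" and v: "v \<in> S h"
  shows "l2_inner \<Omega> (f t) v = l2_inner \<Omega> (ut t) v + A t (V h t) v
           + memory K (\<lambda>s. B1 (u s) (V h s) v) t + memory K (\<lambda>s. lower (u s) v) t"
proof -
  have t': "t \<in> {0..T}" using t by auto
  have v1: "v \<in> Hs \<Omega> 1" by (rule S_H1[OF h v])
  have 1: "l2_inner \<Omega> (ut t) v + A t (u t) v + memory K (\<lambda>s. B (u s) (u s) v) t = l2_inner \<Omega> (f t) v"
    using solution t S_H10[OF h v] unfolding weak_solution_def by blast
  have 2: "A t (\<lambda>x. u t x - V h t x) v + memory K (\<lambda>s. B1 (u s) (\<lambda>x. u s x - V h s x) v) t = 0"
    using projection[OF h] t' v unfolding ritz_volterra_def by blast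
  have 3: "A t (\<lambda>x. u t x - V h t x) v = A t (u t) v - A t (V h t) v"
    by (intro A_form_diff_left[OF \<Omega> elliptic t'] u_H1 V_H1 h t' v1)
  note cont = continuous_forms[OF h v1]
  have "memory K (\<lambda>s. B (u s) (u s) v) t =
      memory K (\<lambda>s. B1 (u s) (\<lambda>x. u s x - V h s x) v + (B1 (u s) (V h s) v + lower (u s) v)) t"
  proof (rule memory_cong)
    fix s assume "s \<in> {0..t}"
    then have s: "s \<in> {0..T}" using t by auto
    have "B1 (u s) (\<lambda>x. u s x - V h s x) v = B1 (u s) (u s) v - B1 (u s) (V h s) v"
      by (intro B1_form_diff_right[OF \<Omega> coeff(1,3)] Hs_1_L2 u_H1 V_H1 h v1 s)
    moreover have "B (u s) (u s) v = B1 (u s) (u s) v + lower (u s) v"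
      by (intro B_eq_B1_lower Hs_1_L2 u_H1 s v1)
    ultimately show "B (u s) (u s) v =
        B1 (u s) (\<lambda>x. u s x - V h s x) v + (B1 (u s) (V h s) v + lower (u s) v)" by simp
  qed
  also have "\<dots> = memory K (\<lambda>s. B1 (u s) (\<lambda>x. u s x - V h s x) v) t
      + memory K (\<lambda>s. B1 (u s) (V h s) v + lower (u s) v) t"
    by (rule memory_add[OF kernel t' cont(2) continuous_on_add[OF cont(1,3)]])
  also have "memory K (\<lambda>s. B1 (u s) (V h s) v + lower (u s) v) t
      = memory K (\<lambda>s. B1 (u s) (V h s) v) t + memory K (\<lambda>s. lower (u s) v) t"
    by (rule memory_add[OF kernel t' cont(1,3)])
  finally show ?thesis using 1 2 3 by linarith
qed

lemma time_grid:
  assumes "n \<le> N" "1 \<le> N"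
  shows "real n * (T / real N) \<in> {0..T}"
  using assms T by (auto simp: field_simps)

text \<open>The projection satisfies the discrete scheme with an error of at most \<open>C (\<Delta>t + h\<^sup>r) \<parallel>v\<parallel>\<^sub>1\<close>.\<close>

abbreviation consistency_const :: "real \<Rightarrow> bool" where
  "consistency_const C \<equiv> C \<ge> 0 \<and> (\<forall>h\<in>{0<..1}. \<forall>v\<in>S h. \<forall>N n. 1 \<le> n \<and> n \<le> N \<longrightarrow>
     \<bar>l2_inner \<Omega> (f (n * (T / N))) v
        - 1 / (T / N) * l2_inner \<Omega> (\<lambda>x. V h (n * (T / N)) x - V h (real (n - 1) * (T / N)) x) v
        - A (n * (T / N)) (V h (n * (T / N))) v
        - T / N * (\<Sum>i=1..n. \<omega> N n i * B (u (i * (T / N))) (V h (i * (T / N))) v)\<bar>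
     \<le> C * (T / N + h powr r) * Hnorm \<Omega> 1 v)"

lemma consistency: "\<exists>C. consistency_const C"
proof -
  obtain C1 where C1: "\<And>h v N n. h \<in> {0<..1} \<Longrightarrow> v \<in> S h \<Longrightarrow> 1 \<le> n \<Longrightarrow> n \<le> N \<Longrightarrow>
      quad_err T K \<omega> N n (\<lambda>s. B1 (u s) (V h s) v) \<le> C1 * (T / N) * Hnorm \<Omega> 1 v"
    using quadrature_B1 by blast
  obtain C2 where C2: "\<And>h v N n. h \<in> {0<..1} \<Longrightarrow> v \<in> S h \<Longrightarrow> 1 \<le> n \<Longrightarrow> n \<le> N \<Longrightarrow>
      quad_err T K \<omega> N n (\<lambda>s. lower (u s) v) \<le> C2 * (T / N) * Hnorm \<Omega> 1 v"
    using quadrature_lower by blast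
  obtain C3 where C3: "\<And>t. t \<in> {0..T} \<Longrightarrow> l2_norm \<Omega> (utt t) \<le> C3"
    using regularity unfolding regular_solution_def by blast
  obtain C4 where C4: "C4 \<ge> 0" "\<And>h t. h \<in> {0<..1} \<Longrightarrow> t \<in> {0..T} \<Longrightarrow>
      l2_norm \<Omega> (\<lambda>x. ut t x - Vt h t x) \<le> C4 * h powr r"
    using projection_error by blast
  define C where "C = \<bar>C1\<bar> + \<bar>C2\<bar> + \<bar>C3\<bar> + C4"
  have "\<bar>l2_inner \<Omega> (f (n * (T / N))) v
        - 1 / (T / N) * l2_inner \<Omega> (\<lambda>x. V h (n * (T / N)) x - V h (real (n - 1) * (T / N)) x) v
        - A (n * (T / N)) (V h (n * (T / N))) v
        - T / N * (\<Sum>i=1..n. \<omega> N n i * B (u (i * (T / N))) (V h (i * (T / N))) v)\<bar>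
     \<le> C * (T / N + h powr r) * Hnorm \<Omega> 1 v"
    if h: "h \<in> {0<..1}" and v: "v \<in> S h" and n: "1 \<le> n" "n \<le> N" for h v N n
  proof -
    define k t s where "k = T / real N" and "t = real n * k" and "s = real (n - 1) * k"
    have k: "k > 0" using n T by (simp add: k_def)
    have ts: "t - s = k" using n by (simp add: t_def s_def of_nat_diff algebra_simps)
    have t: "t \<in> {0<..T}" and t': "t \<in> {0..T}" "s \<in> {0..T}"
      using time_grid[of n N] time_grid[of "n - 1" N] n k
      unfolding t_def s_def k_def[symmetric] by (auto simp: zero_less_mult_iff)
    have v1: "v \<in> Hs \<Omega> 1" by (rule S_H1[OF h v])
    let ?H = "Hnorm \<Omega> 1 v"
    let ?m1 = "memory K (\<lambda>s. B1 (u s) (V h s) v) t" and ?m2 = "memory K (\<lambda>s. lower (u s) v) t"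
    let ?s1 = "k * (\<Sum>i=1..n. \<omega> N n i * B1 (u (i * k)) (V h (i * k)) v)"
      and ?s2 = "k * (\<Sum>i=1..n. \<omega> N n i * lower (u (i * k)) v)"
    have split: "k * (\<Sum>i=1..n. \<omega> N n i * B (u (i * k)) (V h (i * k)) v) = ?s1 + ?s2"
    proof -
      have "B (u (i * k)) (V h (i * k)) v = B1 (u (i * k)) (V h (i * k)) v + lower (u (i * k)) v"
        if "i \<in> {1..n}" for i
        using time_grid[of i N] that n unfolding k_def
        by (intro B_eq_B1_lower Hs_1_L2 u_H1 V_H1 h v1) auto
      then have "(\<Sum>i=1..n. \<omega> N n i * B (u (i * k)) (V h (i * k)) v)
          = (\<Sum>i=1..n. \<omega> N n i * (B1 (u (i * k)) (V h (i * k)) v + lower (u (i * k)) v))"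
        by (intro sum.cong) auto
      then show ?thesis by (simp add: distrib_left sum.distrib)
    qed
    have q1: "\<bar>?s1 - ?m1\<bar> \<le> \<bar>C1\<bar> * k * ?H"
    proof -
      have "\<bar>?s1 - ?m1\<bar> \<le> C1 * k * ?H"
        using C1[OF h v n] by (simp add: quad_err_def k_def t_def)
      also have "\<dots> \<le> \<bar>C1\<bar> * k * ?H"
        using k by (intro mult_right_mono) (auto simp: Hnorm_nonneg)
      finally show ?thesis .
    qed
    have q2: "\<bar>?s2 - ?m2\<bar> \<le> \<bar>C2\<bar> * k * ?H"
    proof -
      have "\<bar>?s2 - ?m2\<bar> \<le> C2 * k * ?H"
        using C2[OF h v n] by (simp add: quad_err_def k_def t_def)
      also have "\<dots> \<le> \<bar>C2\<bar> * k * ?H"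
        using k by (intro mult_right_mono) (auto simp: Hnorm_nonneg)
      finally show ?thesis .
    qed
    have d: "\<bar>l2_inner \<Omega> (ut t) v - 1 / k * l2_inner \<Omega> (\<lambda>x. V h t x - V h s x) v\<bar>
        \<le> (\<bar>C3\<bar> * k + C4 * h powr r) * ?H"
    proof -
      have dV: "time_deriv (l2_norm \<Omega>) T (V h) (Vt h)"
        using projection_regularity h unfolding projection_bounds_def
        by (intro time_deriv_H1_imp_L2[OF \<Omega>] V_H1 Vt_H1) auto
      have du: "time_deriv (l2_norm \<Omega>) T ut utt"
        using regularity by (simp add: regular_solution_def)
      have "\<bar>l2_inner \<Omega> (ut t) v - 1 / (t - s) * l2_inner \<Omega> (\<lambda>x. V h t x - V h s x) v\<bar>
          \<le> (C3 * (t - s) + C4 * h powr r) * l2_norm \<Omega> v"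
        using t' ts k
        by (intro difference_quotient_error[OF du dV] C3 C4 Hs_1_L2 u_H1 V_H1 Vt_H1 utt_L2 h v1) auto
      also have "\<dots> \<le> (\<bar>C3\<bar> * k + C4 * h powr r) * ?H"
        unfolding ts using k C4(1) l2_norm_le_Hnorm_1(1)[OF \<Omega> v1]
        by (intro mult_mono add_mono mult_right_mono) (auto simp: l2_norm_nonneg)
      finally show ?thesis by (simp add: ts)
    qed
    have "l2_inner \<Omega> (f t) v - 1 / k * l2_inner \<Omega> (\<lambda>x. V h t x - V h s x) v - A t (V h t) v - (?s1 + ?s2)
        = (l2_inner \<Omega> (ut t) v - 1 / k * l2_inner \<Omega> (\<lambda>x. V h t x - V h s x) v) - (?s1 - ?m1) - (?s2 - ?m2)"
      using projection_equation[OF h t v] by linarith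
    then have "\<bar>l2_inner \<Omega> (f t) v - 1 / k * l2_inner \<Omega> (\<lambda>x. V h t x - V h s x) v - A t (V h t) v - (?s1 + ?s2)\<bar>
        \<le> (\<bar>C3\<bar> * k + C4 * h powr r) * ?H + \<bar>C1\<bar> * k * ?H + \<bar>C2\<bar> * k * ?H"
      using d q1 q2 by linarith
    also have "\<dots> = (\<bar>C3\<bar> * k + C4 * h powr r + \<bar>C1\<bar> * k + \<bar>C2\<bar> * k) * ?H"
      by (simp add: algebra_simps)
    also have "\<dots> \<le> C * (k + h powr r) * ?H"
      unfolding C_def using k C4(1)
      by (intro mult_right_mono) (auto simp: algebra_simps Hnorm_nonneg)
    finally show ?thesis
      by (simp only: split[symmetric]) (simp only: k_def t_def s_def)
  qed
  moreover have "C \<ge> 0" using C4(1) by (simp add: C_def)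
  ultimately show ?thesis by (intro exI[of _ C]) blast
qed

end

section \<open>Energy estimates on the two grids\<close>

context memory_problem
begin

text \<open>
  \<open>C\<close> bounds the difference of the nonlinear forms at a discrete function \<open>W\<close> of the grid \<open>H\<close> and at the
  exact solution, the latter with the gradient of the projection on the grid \<open>h\<close>.  Both grids occur
  because the fine scheme evaluates the form at the coarse solution.
\<close>

abbreviation form_const :: "real \<Rightarrow> bool" where
  "form_const C \<equiv> C \<ge> 0 \<and> (\<forall>h\<in>{0<..1}. \<forall>H\<in>{0<..1}. \<forall>t\<in>{0..T}. \<forall>W\<in>S H. \<forall>v\<in>Hs \<Omega> 1.
     \<bar>B W W v - B (u t) (V h t) v\<bar>
       \<le> C * (H powr r + Hnorm \<Omega> 1 (\<lambda>x. W x - V H t x) + Hnorm \<Omega> 1 (\<lambda>x. V H t x - V h t x)) * Hnorm \<Omega> 1 v)"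

lemma form_error: "\<exists>C. form_const C"
proof -
  obtain G where G: "G \<ge> 0"
    "\<And>h t. h \<in> {0<..1} \<Longrightarrow> t \<in> {0..T} \<Longrightarrow> AE x in lebesgue_on \<Omega>. norm (wgrad \<Omega> (V h t) x) \<le> G"
    using grad_bound by blast
  obtain R where R: "R \<ge> 0" "\<And>h t. h \<in> {0<..1} \<Longrightarrow> t \<in> {0..T} \<Longrightarrow>
      l2_norm \<Omega> (\<lambda>x. u t x - V h t x) \<le> R * h powr r"
    using projection_error by blast
  define C where "C = 4 * L * (1 + G) * (R + 2)"
  have "\<bar>B W W v - B (u t) (V h t) v\<bar>
       \<le> C * (H powr r + Hnorm \<Omega> 1 (\<lambda>x. W x - V H t x) + Hnorm \<Omega> 1 (\<lambda>x. V H t x - V h t x)) * Hnorm \<Omega> 1 v"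
    if h: "h \<in> {0<..1}" "H \<in> {0<..1}" and t: "t \<in> {0..T}" and W: "W \<in> S H" and v: "v \<in> Hs \<Omega> 1" for h H t W v
  proof -
    have W1: "W \<in> Hs \<Omega> 1" by (rule S_H1[OF h(2) W])
    note m = W1 u_H1(1)[OF t] V_H1[OF h(1) t] V_H1[OF h(2) t]
    let ?y = "Hnorm \<Omega> 1 (\<lambda>x. W x - V H t x)" and ?d = "Hnorm \<Omega> 1 (\<lambda>x. V H t x - V h t x)"
    have "l2_norm \<Omega> (\<lambda>x. W x - u t x) \<le> l2_norm \<Omega> (\<lambda>x. W x - V H t x) + l2_norm \<Omega> (\<lambda>x. V H t x - u t x)"
      using l2_norm_triangle[OF L2_diff[OF Hs_1_L2[OF m(1)] Hs_1_L2[OF m(4)]]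
          L2_diff[OF Hs_1_L2[OF m(4)] Hs_1_L2[OF m(2)]]] by simp
    also have "l2_norm \<Omega> (\<lambda>x. V H t x - u t x) = l2_norm \<Omega> (\<lambda>x. u t x - V H t x)"
      using l2_norm_scaleR[of \<Omega> "-1" "\<lambda>x. u t x - V H t x"] by simp
    also have "l2_norm \<Omega> (\<lambda>x. W x - V H t x) + l2_norm \<Omega> (\<lambda>x. u t x - V H t x) \<le> ?y + R * H powr r"
      by (intro add_mono R h t l2_norm_le_Hnorm_1 \<Omega> Hs_1_diff m)
    finally have l2: "l2_norm \<Omega> (\<lambda>x. W x - u t x) \<le> ?y + R * H powr r" .
    have h1: "Hnorm \<Omega> 1 (\<lambda>x. W x - V h t x) \<le> ?y + ?d"
      by (intro Hnorm_1_triangle \<Omega> m)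
    have "\<bar>B W W v - B (u t) (V h t) v\<bar> \<le> 4 * L * (1 + G) *
        (l2_norm \<Omega> (\<lambda>x. W x - u t x) + Hnorm \<Omega> 1 (\<lambda>x. W x - V h t x)) * Hnorm \<Omega> 1 v"
      by (intro B_form_lipschitz[OF \<Omega> coeff] Hs_1_L2 m v G h t)
    also have "\<dots> \<le> 4 * L * (1 + G) * ((R + 2) * (H powr r + ?y + ?d)) * Hnorm \<Omega> 1 v"
    proof (intro mult_right_mono mult_left_mono)
      have "0 \<le> R * ?y" "0 \<le> R * ?d" "0 \<le> H powr r" "0 \<le> ?y" "0 \<le> ?d" using R(1) by (auto simp: Hnorm_nonneg)
      then show "l2_norm \<Omega> (\<lambda>x. W x - u t x) + Hnorm \<Omega> 1 (\<lambda>x. W x - V h t x) \<le> (R + 2) * (H powr r + ?y + ?d)"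
        using l2 h1 unfolding distrib_left distrib_right by linarith
    qed (use L_nonneg G(1) in \<open>auto simp: Hnorm_nonneg\<close>)
    finally show ?thesis by (simp add: C_def mult.assoc)
  qed
  moreover have "C \<ge> 0" using L_nonneg G(1) R(1) by (simp add: C_def)
  ultimately show ?thesis by (intro exI[of _ C]) blast
qed

lemma weights_bound: "\<exists>K1\<ge>0. \<forall>N n i. 1 \<le> i \<and> i \<le> n \<and> n \<le> N \<longrightarrow> \<bar>\<omega> N n i\<bar> \<le> K1"
proof -
  obtain K1 where K1: "\<forall>N n i. 1 \<le> i \<and> i \<le> n \<and> n \<le> N \<longrightarrow> \<bar>\<omega> N n i\<bar> \<le> K1"
    using weights unfolding quadrature_weights_def by (elim exE conjE) (rule that)
  then have "\<bar>\<omega> 1 1 1\<bar> \<le> K1" by simp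
  then have "0 \<le> K1" by linarith
  with K1 show ?thesis by (intro exI[of _ K1] conjI)
qed

text \<open>The resulting constant for the first \<open>m\<close> summands of the discrete memory term.\<close>

abbreviation memory_const :: "real \<Rightarrow> bool" where
  "memory_const C \<equiv> C \<ge> 0 \<and> (\<forall>h\<in>{0<..1}. \<forall>N n m. \<forall>U :: nat \<Rightarrow> real^'d \<Rightarrow> real. \<forall>v\<in>Hs \<Omega> 1.
     1 \<le> n \<longrightarrow> n \<le> N \<longrightarrow> m \<le> n \<longrightarrow> (\<forall>i\<in>{1..m}. U i \<in> S h) \<longrightarrow>
     \<bar>T / N * (\<Sum>i=1..m. \<omega> N n i * B (U i) (U i) v)
        - T / N * (\<Sum>i=1..m. \<omega> N n i * B (u (i * (T / N))) (V h (i * (T / N))) v)\<bar>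
     \<le> C * (h powr r + T / N * (\<Sum>i=1..m. Hnorm \<Omega> 1 (\<lambda>x. U i x - V h (i * (T / N)) x))) * Hnorm \<Omega> 1 v)"

lemma memory_sum_error: "\<exists>C. memory_const C"
proof -
  obtain E where E: "form_const E"
    using form_error by (rule exE)
  obtain K1 where K1_0: "K1 \<ge> 0" and wt: "\<forall>N n i. 1 \<le> i \<and> i \<le> n \<and> n \<le> N \<longrightarrow> \<bar>\<omega> N n i\<bar> \<le> K1"
    using weights_bound by (elim exE conjE) (rule that)
  define C where "C = K1 * E * (T + 1)"
  have "\<bar>T / N * (\<Sum>i=1..m. \<omega> N n i * B (U i) (U i) v)
        - T / N * (\<Sum>i=1..m. \<omega> N n i * B (u (i * (T / N))) (V h (i * (T / N))) v)\<bar>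
     \<le> C * (h powr r + T / N * (\<Sum>i=1..m. Hnorm \<Omega> 1 (\<lambda>x. U i x - V h (i * (T / N)) x))) * Hnorm \<Omega> 1 v"
    if h: "h \<in> {0<..1}" and v: "v \<in> Hs \<Omega> 1" and n: "1 \<le> n" "n \<le> N" and m: "m \<le> n"
      and U: "\<forall>i\<in>{1..m}. U i \<in> S h" for h N n m v and U :: "nat \<Rightarrow> real^'d \<Rightarrow> real"
  proof -
    define k where "k = T / real N"
    have k: "k > 0" using n T by (simp add: k_def)
    have km: "k * real m \<le> T" using time_grid[of m N] m n by (simp add: k_def mult.commute)
    define y where "y i = Hnorm \<Omega> 1 (\<lambda>x. U i x - V h (i * k) x)" for i
    have summand: "\<bar>\<omega> N n i * (B (U i) (U i) v - B (u (i * k)) (V h (i * k)) v)\<bar>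
        \<le> K1 * E * (h powr r + y i) * Hnorm \<Omega> 1 v" if i: "i \<in> {1..m}" for i
    proof -
      have t: "real i * k \<in> {0..T}" using time_grid[of i N] i m n by (simp add: k_def)
      have z: "Hnorm \<Omega> 1 (\<lambda>x. V h (i * k) x - V h (i * k) x) = 0"
        using Hnorm_1_lincomb_le[OF \<Omega> V_H1[OF h t] V_H1[OF h t], of 0 0] Hnorm_nonneg[of \<Omega> 1]
        by (simp add: antisym)
      have "\<bar>B (U i) (U i) v - B (u (i * k)) (V h (i * k)) v\<bar> \<le> E * (h powr r + y i) * Hnorm \<Omega> 1 v"
        using conjunct2[OF E, rule_format, OF h h t bspec[OF U i] v] unfolding z y_def by simp
      then have "\<bar>\<omega> N n i\<bar> * \<bar>B (U i) (U i) v - B (u (i * k)) (V h (i * k)) v\<bar>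
          \<le> K1 * (E * (h powr r + y i) * Hnorm \<Omega> 1 v)"
        using i m n K1_0 wt by (intro mult_mono) auto
      then show ?thesis by (simp add: abs_mult mult.assoc)
    qed
    have "\<bar>k * (\<Sum>i=1..m. \<omega> N n i * B (U i) (U i) v) - k * (\<Sum>i=1..m. \<omega> N n i * B (u (i * k)) (V h (i * k)) v)\<bar>
        = k * \<bar>\<Sum>i=1..m. \<omega> N n i * (B (U i) (U i) v - B (u (i * k)) (V h (i * k)) v)\<bar>"
      using k by (simp add: right_diff_distrib[symmetric] sum_subtractf[symmetric] abs_mult)
    also have "\<dots> \<le> k * (\<Sum>i=1..m. K1 * E * (h powr r + y i) * Hnorm \<Omega> 1 v)"
      using k by (intro mult_left_mono order_trans[OF sum_abs] sum_mono summand) auto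
    also have "\<dots> = K1 * E * (k * real m * h powr r + k * (\<Sum>i=1..m. y i)) * Hnorm \<Omega> 1 v"
      by (simp add: sum_distrib_left sum_distrib_right sum.distrib algebra_simps)
    also have "\<dots> \<le> K1 * E * ((T + 1) * (h powr r + k * (\<Sum>i=1..m. y i))) * Hnorm \<Omega> 1 v"
    proof (intro mult_right_mono mult_left_mono)
      have s: "0 \<le> k * (\<Sum>i=1..m. y i)" using k by (simp add: y_def sum_nonneg Hnorm_nonneg)
      have "k * real m * h powr r \<le> T * h powr r" using km by (intro mult_right_mono) auto
      moreover have "0 \<le> T * (k * (\<Sum>i=1..m. y i))" using s T by simp
      moreover have "0 \<le> h powr r" by simp
      ultimately show "k * real m * h powr r + k * (\<Sum>i=1..m. y i) \<le> (T + 1) * (h powr r + k * (\<Sum>i=1..m. y i))"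
        unfolding distrib_left distrib_right mult_1 by linarith
    qed (use conjunct1[OF E] K1_0 in \<open>auto simp: Hnorm_nonneg\<close>)
    finally show ?thesis unfolding C_def y_def k_def by (simp only: mult.assoc)
  qed
  moreover have "C \<ge> 0" using conjunct1[OF E] K1_0 T by (simp add: C_def)
  ultimately show ?thesis by (intro exI[of _ C]) blast
qed

text \<open>
  One step of the energy estimate for \<open>\<theta>\<^sub>n = U\<^sub>n - V\<^sub>h u(t\<^sub>n)\<close>, obtained by testing with \<open>\<theta>\<^sub>n\<close>.  The functional \<open>R\<close> is
  whatever the scheme puts in place of the memory term, and \<open>M\<close> measures how far it is from the
  quadrature of the form at the exact solution.
\<close>

abbreviation energy_const :: "real \<Rightarrow> bool" where
  "energy_const C \<equiv> C \<ge> 0 \<and> (\<forall>h\<in>{0<..1}. \<forall>N n. \<forall>U R M.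
     1 \<le> n \<longrightarrow> n \<le> N \<longrightarrow> U n \<in> S h \<longrightarrow> U (n - 1) \<in> S h \<longrightarrow>
     (\<forall>v\<in>S h. 1 / (T / N) * l2_inner \<Omega> (\<lambda>x. U n x - U (n - 1) x) v + A (n * (T / N)) (U n) v + R v
        = l2_inner \<Omega> (f (n * (T / N))) v) \<longrightarrow>
     (let \<theta> = (\<lambda>n x. U n x - V h (real n * (T / N)) x) in
       \<bar>R (\<theta> n) - T / N * (\<Sum>i=1..n. \<omega> N n i * B (u (i * (T / N))) (V h (i * (T / N))) (\<theta> n))\<bar>
         \<le> M * Hnorm \<Omega> 1 (\<theta> n) \<longrightarrow>
       ((l2_norm \<Omega> (\<theta> n))\<^sup>2 - (l2_norm \<Omega> (\<theta> (n - 1)))\<^sup>2) / 2 + T / N * \<nu>0 * (Hnorm \<Omega> 1 (\<theta> n))\<^sup>2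
         \<le> T / N * Hnorm \<Omega> 1 (\<theta> n) * (C * (T / N + h powr r) + M)))"

lemma energy_step: "\<exists>C. energy_const C"
proof -
  obtain C where C: "consistency_const C"
    using consistency by (rule exE)
  show ?thesis
    unfolding Let_def
  proof (intro exI[of _ C] conjI ballI allI impI conjunct1[OF C])
    fix h N n U R M
    let ?k = "T / real N"
    let ?th = "\<lambda>n x. U n x - V h (real n * ?k) x"
    let ?Q = "T / N * (\<Sum>i=1..n. \<omega> N n i * B (u (i * (T / N))) (V h (i * (T / N))) (?th n))"
    assume h: "h \<in> {0<..1}" and n: "1 \<le> n" "n \<le> N" and U: "U n \<in> S h" "U (n - 1) \<in> S h"
      and scheme: "\<forall>v\<in>S h. 1 / ?k * l2_inner \<Omega> (\<lambda>x. U n x - U (n - 1) x) v + A (n * ?k) (U n) v + R v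
        = l2_inner \<Omega> (f (n * ?k)) v"
      and M: "\<bar>R (?th n) - ?Q\<bar> \<le> M * Hnorm \<Omega> 1 (?th n)"
    define k t s where "k = ?k" and "t = real n * ?k" and "s = real (n - 1) * ?k"
    define v where "v = (\<lambda>x. U n x - V h t x)"
    define w where "w = (\<lambda>x. U (n - 1) x - V h s x)"
    have k: "k > 0" using n T by (simp add: k_def)
    have t: "t \<in> {0..T}" "s \<in> {0..T}" using time_grid[of n N] time_grid[of "n - 1" N] n by (auto simp: t_def s_def)
    have vS: "v \<in> S h" "w \<in> S h" unfolding v_def w_def by (intro S_diff h U V_S t)+
    note mem = S_H1[OF h vS(1)] S_H1[OF h vS(2)] S_H1[OF h U(1)] S_H1[OF h U(2)] V_H1[OF h t(1)] V_H1[OF h t(2)]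
    note L2 = mem[THEN Hs_1_L2]
    have "l2_inner \<Omega> (\<lambda>x. U n x - U (n - 1) x) v - l2_inner \<Omega> (\<lambda>x. V h t x - V h s x) v
        = l2_inner \<Omega> v v - l2_inner \<Omega> w v"
    proof -
      have "l2_inner \<Omega> (\<lambda>x. U n x - V h t x) v = l2_inner \<Omega> (U n) v - l2_inner \<Omega> (V h t) v"
        "l2_inner \<Omega> (\<lambda>x. U (n - 1) x - V h s x) v = l2_inner \<Omega> (U (n - 1)) v - l2_inner \<Omega> (V h s) v"
        "l2_inner \<Omega> (\<lambda>x. U n x - U (n - 1) x) v = l2_inner \<Omega> (U n) v - l2_inner \<Omega> (U (n - 1)) v"
        "l2_inner \<Omega> (\<lambda>x. V h t x - V h s x) v = l2_inner \<Omega> (V h t) v - l2_inner \<Omega> (V h s) v"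
        by (intro l2_inner_diff_left L2)+
      then show ?thesis unfolding v_def[symmetric] w_def[symmetric] by linarith
    qed
    moreover have "l2_inner \<Omega> w v \<le> l2_norm \<Omega> w * l2_norm \<Omega> v"
      using l2_Cauchy_Schwarz[OF L2(2,1)] by linarith
    moreover have "l2_norm \<Omega> w * l2_norm \<Omega> v \<le> ((l2_norm \<Omega> w)\<^sup>2 + (l2_norm \<Omega> v)\<^sup>2) / 2"
      using sum_squares_bound[of "l2_norm \<Omega> w" "l2_norm \<Omega> v"] by simp
    \<comment> \<open>The increment of the energy is at most \<open>(\<theta>\<^sub>n - \<theta>\<^sub>n\<^sub>-\<^sub>1, \<theta>\<^sub>n)\<close>.\<close>
    ultimately have inc: "((l2_norm \<Omega> v)\<^sup>2 - (l2_norm \<Omega> w)\<^sup>2) / 2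
        \<le> l2_inner \<Omega> (\<lambda>x. U n x - U (n - 1) x) v - l2_inner \<Omega> (\<lambda>x. V h t x - V h s x) v"
      by (simp add: l2_norm_power2 field_simps)
    have coer: "\<nu>0 * (Hnorm \<Omega> 1 v)\<^sup>2 \<le> A t (U n) v - A t (V h t) v"
    proof -
      have "\<nu>0 * (Hnorm \<Omega> 1 v)\<^sup>2 \<le> A t v v" by (rule coercive[OF t(1) S_H10[OF h vS(1)]])
      also have "A t v v = A t (U n) v - A t (V h t) v"
        using A_form_diff_left[OF \<Omega> elliptic t(1) mem(3,5,1)] unfolding v_def[symmetric] .
      finally show ?thesis .
    qed
    have con: "l2_inner \<Omega> (f t) v - 1 / k * l2_inner \<Omega> (\<lambda>x. V h t x - V h s x) v - A t (V h t) v - ?Q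
        \<le> C * (k + h powr r) * Hnorm \<Omega> 1 v"
      using conjunct2[OF C, rule_format, OF h vS(1) conjI[OF n]] unfolding k_def t_def s_def v_def by linarith
    have sch: "1 / k * l2_inner \<Omega> (\<lambda>x. U n x - U (n - 1) x) v + A t (U n) v + R v = l2_inner \<Omega> (f t) v"
      using scheme vS(1) unfolding k_def t_def by blast
    have Mv: "\<bar>R v - ?Q\<bar> \<le> M * Hnorm \<Omega> 1 v" using M unfolding v_def t_def .
    have "1 / k * (l2_inner \<Omega> (\<lambda>x. U n x - U (n - 1) x) v - l2_inner \<Omega> (\<lambda>x. V h t x - V h s x) v)
        + (A t (U n) v - A t (V h t) v) \<le> (C * (k + h powr r) + M) * Hnorm \<Omega> 1 v"
      using con sch Mv unfolding right_diff_distrib distrib_right[of _ M] by linarith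
    moreover have "1 / k * (((l2_norm \<Omega> v)\<^sup>2 - (l2_norm \<Omega> w)\<^sup>2) / 2)
        \<le> 1 / k * (l2_inner \<Omega> (\<lambda>x. U n x - U (n - 1) x) v - l2_inner \<Omega> (\<lambda>x. V h t x - V h s x) v)"
      using inc k by (intro mult_left_mono) auto
    ultimately have "1 / k * (((l2_norm \<Omega> v)\<^sup>2 - (l2_norm \<Omega> w)\<^sup>2) / 2) + \<nu>0 * (Hnorm \<Omega> 1 v)\<^sup>2
        \<le> (C * (k + h powr r) + M) * Hnorm \<Omega> 1 v"
      using coer by linarith
    then have *: "k * (1 / k * (((l2_norm \<Omega> v)\<^sup>2 - (l2_norm \<Omega> w)\<^sup>2) / 2) + \<nu>0 * (Hnorm \<Omega> 1 v)\<^sup>2)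
        \<le> k * ((C * (k + h powr r) + M) * Hnorm \<Omega> 1 v)"
      using k by (intro mult_left_mono) auto
    have "((l2_norm \<Omega> v)\<^sup>2 - (l2_norm \<Omega> w)\<^sup>2) / 2 + k * \<nu>0 * (Hnorm \<Omega> 1 v)\<^sup>2
        \<le> k * Hnorm \<Omega> 1 v * (C * (k + h powr r) + M)"
    proof -
      have "k * (1 / k * p + q) = p + k * q" for p q using k by (simp add: distrib_left)
      note this[of "((l2_norm \<Omega> v)\<^sup>2 - (l2_norm \<Omega> w)\<^sup>2) / 2" "\<nu>0 * (Hnorm \<Omega> 1 v)\<^sup>2"]
      with * show ?thesis by (simp only: ac_simps)
    qed
    then show "((l2_norm \<Omega> (?th n))\<^sup>2 - (l2_norm \<Omega> (?th (n - 1)))\<^sup>2) / 2 + ?k * \<nu>0 * (Hnorm \<Omega> 1 (?th n))\<^sup>2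
         \<le> ?k * Hnorm \<Omega> 1 (?th n) * (C * (?k + h powr r) + M)"
      unfolding v_def w_def k_def t_def s_def .
  qed
qed

lemma initial_error:
  assumes "h \<in> {0<..1}" "u0h \<in> S h" "Hnorm \<Omega> 1 (\<lambda>x. u0h x - V h 0 x) \<le> C0 * h powr r"
  shows "(l2_norm \<Omega> (\<lambda>x. u0h x - V h 0 x))\<^sup>2 \<le> C0\<^sup>2 * (h powr r)\<^sup>2"
proof -
  have "(\<lambda>x. u0h x - V h 0 x) \<in> Hs \<Omega> 1"
    using T by (intro Hs_1_diff \<Omega> S_H1[OF assms(1,2)] V_H1 assms(1)) auto
  then have "l2_norm \<Omega> (\<lambda>x. u0h x - V h 0 x) \<le> C0 * h powr r"
    using l2_norm_le_Hnorm_1(1)[OF \<Omega>] assms(3) order_trans by blast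
  then have "(l2_norm \<Omega> (\<lambda>x. u0h x - V h 0 x))\<^sup>2 \<le> (C0 * h powr r)\<^sup>2"
    by (intro power_mono l2_norm_nonneg)
  then show ?thesis by (simp only: power_mult_distrib)
qed

text \<open>
  Coarse grid: the errors stay bounded in the discrete \<open>L\<^sup>2(0,T;H\<^sup>1)\<close> norm.  The memory term is implicit
  here, and absorbing its last summand is what makes the time step small.
\<close>

lemma coarse_stability:
  "\<exists>\<delta>>0. \<exists>M\<ge>0. \<forall>H\<in>{0<..1}. \<forall>N u0H UH.
     1 \<le> N \<longrightarrow> T / real N \<le> \<delta> \<longrightarrow> u0H \<in> S H \<longrightarrow> Hnorm \<Omega> 1 (\<lambda>x. u0H x - V H 0 x) \<le> C0 * H powr r \<longrightarrow>
     coarse_scheme \<Omega> A B f (\<omega> N) (S H) (T / N) N u0H UH \<longrightarrow>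
     T / N * (\<Sum>i=1..N. (Hnorm \<Omega> 1 (\<lambda>x. UH i x - V H (i * (T / N)) x))\<^sup>2) \<le> M"
proof -
  obtain Ce where Ce_const: "energy_const Ce"
    using energy_step by (rule exE)
  note Ce = conjunct1[OF Ce_const] and energy = conjunct2[OF Ce_const]
  obtain Cm where Cm_const: "memory_const Cm"
    using memory_sum_error by (rule exE)
  note Cm = conjunct1[OF Cm_const] and mem = conjunct2[OF Cm_const]
  define c where "c = Ce + Cm"
  define D where "D = 3 * c\<^sup>2 / (\<nu>0 / 2) * max 1 (T / (\<nu>0 / 2))"
  \<comment> \<open>\<open>c \<delta> \<le> \<nu>0/2\<close>: half of the coercivity absorbs the implicit summand.\<close>
  define \<delta> where "\<delta> = \<nu>0 / (2 * (c + 1))"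
  define M where "M = 2 / \<nu>0 * (exp (D * T) * (C0\<^sup>2 + D * T * (T + 1)\<^sup>2))"
  have c0: "c \<ge> 0" using Ce Cm by (simp add: c_def)
  have D0: "D \<ge> 0" unfolding D_def using \<nu>0 by (auto intro!: mult_nonneg_nonneg)
  have "T / N * (\<Sum>i=1..N. (Hnorm \<Omega> 1 (\<lambda>x. UH i x - V H (i * (T / N)) x))\<^sup>2) \<le> M"
    if H: "H \<in> {0<..1}" and N: "1 \<le> N" "T / real N \<le> \<delta>"
      and init: "u0H \<in> S H" "Hnorm \<Omega> 1 (\<lambda>x. u0H x - V H 0 x) \<le> C0 * H powr r"
      and scheme: "coarse_scheme \<Omega> A B f (\<omega> N) (S H) (T / N) N u0H UH" for H N u0H UH
  proof -
    define k where "k = T / real N"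
    define y where "y n = Hnorm \<Omega> 1 (\<lambda>x. UH n x - V H (real n * k) x)" for n
    define x where "x n = l2_norm \<Omega> (\<lambda>x. UH n x - V H (real n * k) x)" for n
    have k: "k > 0" "real N * k \<le> T" using N T by (simp_all add: k_def)
    have kT: "k \<le> T" using N T by (simp add: k_def field_simps)
    have ck: "c * k \<le> \<nu>0 / 2"
    proof -
      have "c * k \<le> (c + 1) * (\<nu>0 / (2 * (c + 1)))"
        using N(2) k c0 unfolding k_def[symmetric] \<delta>_def by (intro mult_mono) auto
      also have "\<dots> = \<nu>0 / 2" using c0 by (simp add: field_simps)
      finally show ?thesis .
    qed
    have US: "UH n \<in> S H" if "n \<le> N" for n
      using scheme init(1) that unfolding coarse_scheme_def by (cases "n = 0") auto
    have y0: "y n \<ge> 0" for n by (simp add: y_def Hnorm_nonneg)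
    have step: "((x n)\<^sup>2 - (x (n - 1))\<^sup>2) / 2 + k * (\<nu>0 / 2) * (y n)\<^sup>2
        \<le> k * c * y n * ((k + H powr r) + k * (\<Sum>i=1..n-1. y i) + k * 0)" if n: "n \<in> {1..N}" for n
    proof -
      define v where "v = (\<lambda>x. UH n x - V H (real n * k) x)"
      define R where "R v = k * (\<Sum>i=1..n. \<omega> N n i * B (UH i) (UH i) v)" for v
      have n': "1 \<le> n" "n \<le> N" using n by auto
      have v: "v \<in> Hs \<Omega> 1"
        unfolding v_def using time_grid[OF n'(2) N(1)] n'
        by (intro Hs_1_diff \<Omega> V_H1 S_H1[OF H US] H) (simp_all add: k_def)
      have "((x n)\<^sup>2 - (x (n - 1))\<^sup>2) / 2 + k * \<nu>0 * (y n)\<^sup>2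
          \<le> k * y n * (Ce * (k + H powr r) + Cm * (H powr r + k * (\<Sum>i=1..n. y i)))"
        unfolding x_def y_def k_def
      proof (rule energy[unfolded Let_def, rule_format, OF H n', where R = R])
        show "UH n \<in> S H" "UH (n - 1) \<in> S H" using US n' by auto
        fix v assume "v \<in> S H"
        then show "1 / (T / N) * l2_inner \<Omega> (\<lambda>x. UH n x - UH (n - 1) x) v + A (n * (T / N)) (UH n) v + R v
            = l2_inner \<Omega> (f (n * (T / N))) v"
          using scheme n unfolding coarse_scheme_def R_def k_def by blast
      next
        have US': "UH i \<in> S H" if "i \<in> {1..n}" for i using US that n' by simp
        show "\<bar>R (\<lambda>x. UH n x - V H (real n * (T / N)) x) - T / N * (\<Sum>i=1..n. \<omega> N n i *
              B (u (i * (T / N))) (V H (i * (T / N))) (\<lambda>x. UH n x - V H (real n * (T / N)) x))\<bar>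
            \<le> Cm * (H powr r + T / N * (\<Sum>i=1..n. Hnorm \<Omega> 1 (\<lambda>x. UH i x - V H (i * (T / N)) x)))
              * Hnorm \<Omega> 1 (\<lambda>x. UH n x - V H (real n * (T / N)) x)"
          using mem[rule_format, OF H v n' order_refl US'] unfolding R_def v_def k_def .
      qed
      also have "\<dots> \<le> k * y n * (c * ((k + H powr r) + k * (\<Sum>i=1..n. y i)))"
      proof (rule mult_left_mono)
        have s: "0 \<le> k * (\<Sum>i=1..n. y i)" using k y0 by (simp add: sum_nonneg)
        have "0 \<le> Ce * (k * (\<Sum>i=1..n. y i))" "0 \<le> Cm * k" using Ce Cm s k by auto
        then show "Ce * (k + H powr r) + Cm * (H powr r + k * (\<Sum>i=1..n. y i))
            \<le> c * ((k + H powr r) + k * (\<Sum>i=1..n. y i))"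
          unfolding c_def distrib_left distrib_right by linarith
      qed (use k y0 in auto)
      also have "(\<Sum>i=1..n. y i) = (\<Sum>i=1..n-1. y i) + y n"
        using n' by (cases n) auto
      also have "k * y n * (c * ((k + H powr r) + k * ((\<Sum>i=1..n-1. y i) + y n)))
          = k * c * y n * ((k + H powr r) + k * (\<Sum>i=1..n-1. y i)) + k * (c * k) * (y n)\<^sup>2"
        by (simp add: power2_eq_square algebra_simps)
      also have "\<dots> \<le> k * c * y n * ((k + H powr r) + k * (\<Sum>i=1..n-1. y i)) + k * (\<nu>0 / 2) * (y n)\<^sup>2"
        using ck k by (intro add_left_mono mult_right_mono mult_left_mono) auto
      finally show ?thesis by simp
    qed
    have bound: "(x N)\<^sup>2 + k * (\<nu>0 / 2) * (\<Sum>i=1..N. (y i)\<^sup>2)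
        \<le> exp (D * T) * ((x 0)\<^sup>2 + D * T * (k + H powr r)\<^sup>2 + D * k\<^sup>2 * (k * (\<Sum>i=1..N. 0\<^sup>2)))"
      by (rule discrete_energy_bound[OF k _ c0 step D_def order_refl]) (use \<nu>0 in auto)
    have Hr: "H powr r \<le> 1" using H r by (intro powr_le1) auto
    have "(x 0)\<^sup>2 \<le> C0\<^sup>2 * (H powr r)\<^sup>2"
      using initial_error[OF H init] scheme by (simp add: x_def coarse_scheme_def)
    also have "\<dots> \<le> C0\<^sup>2 * 1" using Hr by (intro mult_left_mono power_le_one) auto
    finally have x0: "(x 0)\<^sup>2 \<le> C0\<^sup>2" by simp
    have \<eta>: "(k + H powr r)\<^sup>2 \<le> (T + 1)\<^sup>2" using k kT Hr by (intro power_mono) auto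
    have "k * (\<nu>0 / 2) * (\<Sum>i=1..N. (y i)\<^sup>2) \<le> exp (D * T) * (C0\<^sup>2 + D * T * (T + 1)\<^sup>2)"
    proof -
      have "k * (\<nu>0 / 2) * (\<Sum>i=1..N. (y i)\<^sup>2) \<le> exp (D * T) * ((x 0)\<^sup>2 + D * T * (k + H powr r)\<^sup>2)"
      proof -
        have "D * k\<^sup>2 * (k * (\<Sum>i=1..N. (0::real)\<^sup>2)) = 0" by simp
        with bound zero_le_power2[of "x N"] show ?thesis by (simp only: add_0_right)
      qed
      also have "\<dots> \<le> exp (D * T) * (C0\<^sup>2 + D * T * (T + 1)\<^sup>2)"
        using x0 \<eta> D0 T by (intro mult_left_mono add_mono) auto
      finally show ?thesis .
    qed
    then have "2 / \<nu>0 * (k * (\<nu>0 / 2) * (\<Sum>i=1..N. (y i)\<^sup>2)) \<le> M"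
      unfolding M_def using \<nu>0 by (intro mult_left_mono) auto
    then show ?thesis using \<nu>0 by (simp add: y_def k_def)
  qed
  moreover have "\<delta> > 0" "M \<ge> 0" using \<nu>0 c0 D0 T by (auto simp: \<delta>_def M_def)
  ultimately show ?thesis
    by (intro exI[of _ \<delta>] exI[of _ M] conjI ballI allI impI)
qed

text \<open>
  Fine grid: the coarse solution enters only through the last summand of the memory term, which
  carries a factor \<open>\<Delta>t\<close>, so boundedness of the coarse errors is enough.
\<close>

lemma fine_error:
  "\<exists>Q\<ge>0. \<forall>h\<in>{0<..1}. \<forall>H\<in>{0<..1}. \<forall>N u0h UH Uh.
     1 \<le> N \<longrightarrow> u0h \<in> S h \<longrightarrow> Hnorm \<Omega> 1 (\<lambda>x. u0h x - V h 0 x) \<le> C0 * h powr r \<longrightarrow>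
     (\<forall>n\<in>{1..N}. UH n \<in> S H) \<longrightarrow>
     T / N * (\<Sum>i=1..N. (Hnorm \<Omega> 1 (\<lambda>x. UH i x - V H (i * (T / N)) x))\<^sup>2) \<le> M \<longrightarrow>
     fine_scheme \<Omega> A B f (\<omega> N) (S h) (T / N) N UH u0h Uh \<longrightarrow>
     (\<forall>n\<in>{1..N}. l2_norm \<Omega> (\<lambda>x. Uh n x - V h (n * (T / N)) x) \<le> Q * (T / N + h powr r))"
proof -
  obtain Ce where Ce_const: "energy_const Ce"
    using energy_step by (rule exE)
  note Ce = conjunct1[OF Ce_const] and energy = conjunct2[OF Ce_const]
  obtain Cm where Cm_const: "memory_const Cm"
    using memory_sum_error by (rule exE)
  note Cm = conjunct1[OF Cm_const] and mem = conjunct2[OF Cm_const]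
  obtain E where E_const: "form_const E"
    using form_error by (rule exE)
  note E = conjunct1[OF E_const] and form = conjunct2[OF E_const]
  obtain P where P_const: "projection_const P"
    using projection_error by (rule exE)
  note P = conjunct1[OF P_const] and proj = conjunct2[OF P_const]
  obtain K1 where K1: "K1 \<ge> 0" and wt: "\<forall>N n i. 1 \<le> i \<and> i \<le> n \<and> n \<le> N \<longrightarrow> \<bar>\<omega> N n i\<bar> \<le> K1"
    using weights_bound by (elim exE conjE) (rule that)
  define F where "F = K1 * E * (1 + 2 * P)"
  define c where "c = Ce + Cm + F"
  define D where "D = 3 * c\<^sup>2 / \<nu>0 * max 1 (T / \<nu>0)"
  define Q where "Q = exp (D * T) * (C0\<^sup>2 + D * T + D * (2 * (T + \<bar>M\<bar>)))"
  have F0: "F \<ge> 0" using K1 E P by (simp add: F_def)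
  have c0: "c \<ge> 0" using Ce Cm F0 by (simp add: c_def)
  have D0: "D \<ge> 0" unfolding D_def using \<nu>0 by (auto intro!: mult_nonneg_nonneg)
  have Q0: "Q \<ge> 0" unfolding Q_def using D0 T by (auto intro!: mult_nonneg_nonneg add_nonneg_nonneg)
  have "l2_norm \<Omega> (\<lambda>x. Uh n x - V h (n * (T / N)) x) \<le> sqrt Q * (T / N + h powr r)"
    if h: "h \<in> {0<..1}" "H \<in> {0<..1}" and N: "1 \<le> N"
      and init: "u0h \<in> S h" "Hnorm \<Omega> 1 (\<lambda>x. u0h x - V h 0 x) \<le> C0 * h powr r"
      and UH: "\<forall>n\<in>{1..N}. UH n \<in> S H"
      and coarse: "T / N * (\<Sum>i=1..N. (Hnorm \<Omega> 1 (\<lambda>x. UH i x - V H (i * (T / N)) x))\<^sup>2) \<le> M"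
      and scheme: "fine_scheme \<Omega> A B f (\<omega> N) (S h) (T / N) N UH u0h Uh"
      and nN: "n \<in> {1..N}" for h H N u0h UH Uh n
  proof -
    define k where "k = T / real N"
    define y where "y n = Hnorm \<Omega> 1 (\<lambda>x. Uh n x - V h (real n * k) x)" for n
    define x where "x n = l2_norm \<Omega> (\<lambda>x. Uh n x - V h (real n * k) x)" for n
    define yH where "yH n = Hnorm \<Omega> 1 (\<lambda>x. UH n x - V H (real n * k) x)" for n
    have k: "k > 0" "real N * k \<le> T" using N T by (simp_all add: k_def)
    have US: "Uh n \<in> S h" if "n \<le> N" for n
      using scheme init(1) that unfolding fine_scheme_def by (cases "n = 0") auto
    have y0: "y n \<ge> 0" "yH n \<ge> 0" for n by (simp_all add: y_def yH_def Hnorm_nonneg)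
    have step: "((x n)\<^sup>2 - (x (n - 1))\<^sup>2) / 2 + k * \<nu>0 * (y n)\<^sup>2
        \<le> k * c * y n * ((k + h powr r) + k * (\<Sum>i=1..n-1. y i) + k * (1 + yH n))" if n: "n \<in> {1..N}" for n
    proof -
      define t where "t = real n * k"
      define v where "v = (\<lambda>x. Uh n x - V h t x)"
      define R where "R v = k * (\<Sum>i=1..n-1. \<omega> N n i * B (Uh i) (Uh i) v)
          + k * \<omega> N n n * B (UH n) (UH n) v" for v
      define Mn where "Mn = Cm * (h powr r + k * (\<Sum>i=1..n-1. y i)) + k * (F * (1 + yH n))"
      have n': "1 \<le> n" "n \<le> N" using n by auto
      have t: "t \<in> {0..T}" using time_grid[OF n'(2) N(1)] by (simp add: t_def k_def)
      have v: "v \<in> Hs \<Omega> 1"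
        unfolding v_def using n' by (intro Hs_1_diff \<Omega> V_H1 t S_H1[OF h(1) US] h)
      have last: "\<bar>k * \<omega> N n n * B (UH n) (UH n) v - k * \<omega> N n n * B (u t) (V h t) v\<bar>
          \<le> k * (F * (1 + yH n)) * Hnorm \<Omega> 1 v"
      proof -
        have "Hnorm \<Omega> 1 (\<lambda>x. V H t x - V h t x) \<le> 2 * P"
        proof -
          have H1: "(\<lambda>x. u t x - V H t x) \<in> Hs \<Omega> 1" "(\<lambda>x. u t x - V h t x) \<in> Hs \<Omega> 1"
            by (intro Hs_1_diff \<Omega> u_H1 V_H1 h t)+
          have "(\<lambda>x. (-1) * (u t x - V H t x) + 1 * (u t x - V h t x)) = (\<lambda>x. V H t x - V h t x)"
            by auto
          then show ?thesis
            using Hnorm_1_lincomb_le[OF \<Omega> H1, of "-1" 1] proj[rule_format, OF h(1) t] proj[rule_format, OF h(2) t]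
            by simp
        qed
        moreover have "H powr r \<le> 1" using h r by (intro powr_le1) auto
        ultimately have "H powr r + yH n + Hnorm \<Omega> 1 (\<lambda>x. V H t x - V h t x) \<le> 1 + yH n + 2 * P"
          by simp
        also have "\<dots> \<le> (1 + 2 * P) * (1 + yH n)"
          using mult_nonneg_nonneg[OF P y0(2)[of n]] by (simp add: algebra_simps)
        finally have le: "H powr r + yH n + Hnorm \<Omega> 1 (\<lambda>x. V H t x - V h t x) \<le> (1 + 2 * P) * (1 + yH n)" .
        have "\<bar>B (UH n) (UH n) v - B (u t) (V h t) v\<bar>
            \<le> E * (H powr r + yH n + Hnorm \<Omega> 1 (\<lambda>x. V H t x - V h t x)) * Hnorm \<Omega> 1 v"
          using form[rule_format, OF h t bspec[OF UH n] v] unfolding yH_def t_def .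
        also have "\<dots> \<le> E * ((1 + 2 * P) * (1 + yH n)) * Hnorm \<Omega> 1 v"
          using le E by (intro mult_right_mono mult_left_mono) (auto simp: Hnorm_nonneg)
        finally have "k * \<bar>\<omega> N n n\<bar> * \<bar>B (UH n) (UH n) v - B (u t) (V h t) v\<bar>
            \<le> k * K1 * (E * ((1 + 2 * P) * (1 + yH n)) * Hnorm \<Omega> 1 v)"
          using k K1 wt n' by (intro mult_mono) auto
        then show ?thesis
          using k by (simp add: F_def right_diff_distrib[symmetric] abs_mult mult.assoc)
      qed
      have Mb: "\<bar>R v - k * (\<Sum>i=1..n. \<omega> N n i * B (u (i * k)) (V h (i * k)) v)\<bar> \<le> Mn * Hnorm \<Omega> 1 v"
      proof -
        have US': "Uh i \<in> S h" if "i \<in> {1..n-1}" for i using that n' by (intro US) auto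
        have "\<bar>k * (\<Sum>i=1..n-1. \<omega> N n i * B (Uh i) (Uh i) v)
            - k * (\<Sum>i=1..n-1. \<omega> N n i * B (u (i * k)) (V h (i * k)) v)\<bar>
          \<le> Cm * (h powr r + k * (\<Sum>i=1..n-1. y i)) * Hnorm \<Omega> 1 v"
          using mem[rule_format, OF h(1) v n' diff_le_self US'] unfolding y_def k_def .
        moreover have sum_n: "(\<Sum>i=1..n. \<omega> N n i * B (u (i * k)) (V h (i * k)) v)
            = (\<Sum>i=1..n-1. \<omega> N n i * B (u (i * k)) (V h (i * k)) v) + \<omega> N n n * B (u t) (V h t) v"
          using n' unfolding t_def by (cases n) auto
        moreover have "R v - k * (\<Sum>i=1..n. \<omega> N n i * B (u (i * k)) (V h (i * k)) v)
            = (k * (\<Sum>i=1..n-1. \<omega> N n i * B (Uh i) (Uh i) v)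
                - k * (\<Sum>i=1..n-1. \<omega> N n i * B (u (i * k)) (V h (i * k)) v))
              + (k * \<omega> N n n * B (UH n) (UH n) v - k * \<omega> N n n * B (u t) (V h t) v)"
          unfolding sum_n R_def by (simp only: distrib_left mult.assoc)
        ultimately show ?thesis
          using last unfolding Mn_def distrib_right[of _ _ "Hnorm \<Omega> 1 v"] by linarith
      qed
      have "((x n)\<^sup>2 - (x (n - 1))\<^sup>2) / 2 + k * \<nu>0 * (y n)\<^sup>2 \<le> k * y n * (Ce * (k + h powr r) + Mn)"
        unfolding x_def y_def k_def
      proof (rule energy[unfolded Let_def, rule_format, OF h(1) n', where R = R])
        show "Uh n \<in> S h" "Uh (n - 1) \<in> S h" using US n' by auto
        fix v assume "v \<in> S h"
        then have "1 / (T / N) * l2_inner \<Omega> (\<lambda>x. Uh n x - Uh (n - 1) x) v + A (n * (T / N)) (Uh n) v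
            + T / N * (\<Sum>i=1..n-1. \<omega> N n i * B (Uh i) (Uh i) v) + T / N * \<omega> N n n * B (UH n) (UH n) v
            = l2_inner \<Omega> (f (n * (T / N))) v"
          using scheme n unfolding fine_scheme_def by blast
        then show "1 / (T / N) * l2_inner \<Omega> (\<lambda>x. Uh n x - Uh (n - 1) x) v + A (n * (T / N)) (Uh n) v + R v
            = l2_inner \<Omega> (f (n * (T / N))) v"
          unfolding R_def k_def by (simp only: add.assoc)
      next
        show "\<bar>R (\<lambda>x. Uh n x - V h (real n * (T / N)) x) - T / N * (\<Sum>i=1..n. \<omega> N n i *
              B (u (i * (T / N))) (V h (i * (T / N))) (\<lambda>x. Uh n x - V h (real n * (T / N)) x))\<bar>
            \<le> Mn * Hnorm \<Omega> 1 (\<lambda>x. Uh n x - V h (real n * (T / N)) x)"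
          using Mb unfolding v_def t_def k_def .
      qed
      also have "\<dots> \<le> k * y n * (c * ((k + h powr r) + k * (\<Sum>i=1..n-1. y i) + k * (1 + yH n)))"
      proof (rule mult_left_mono)
        define s z where "s = k * (\<Sum>i=1..n-1. y i)" and "z = k * (1 + yH n)"
        have "0 \<le> s" "0 \<le> z" using k y0 by (simp_all add: s_def z_def sum_nonneg)
        then have "0 \<le> Ce * s" "0 \<le> Ce * z" "0 \<le> Cm * k" "0 \<le> Cm * z" "0 \<le> F * k" "0 \<le> F * s" "0 \<le> F * h powr r"
          using Ce Cm F0 k by auto
        then have "Ce * (k + h powr r) + (Cm * (h powr r + s) + F * z) \<le> c * ((k + h powr r) + s + z)"
          unfolding c_def distrib_left distrib_right by linarith
        then show "Ce * (k + h powr r) + Mn \<le> c * ((k + h powr r) + k * (\<Sum>i=1..n-1. y i) + k * (1 + yH n))"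
          unfolding Mn_def s_def z_def by (simp only: mult.left_commute[of k])
      qed (use k y0 in auto)
      finally show ?thesis by (simp only: ac_simps)
    qed
    define \<eta> where "\<eta> = k + h powr r"
    have \<eta>: "0 \<le> \<eta>" "k \<le> \<eta>" "h powr r \<le> \<eta>" using k by (simp_all add: \<eta>_def)
    have n': "1 \<le> n" "n \<le> N" using nN by auto
    have bound: "(x n)\<^sup>2 + k * \<nu>0 * (\<Sum>i=1..n. (y i)\<^sup>2)
        \<le> exp (D * T) * ((x 0)\<^sup>2 + D * T * \<eta>\<^sup>2 + D * k\<^sup>2 * (k * (\<Sum>i=1..n. (1 + yH i)\<^sup>2)))"
      unfolding \<eta>_def by (rule discrete_energy_bound[OF k \<nu>0 c0 step D_def n'(2)])
    have z: "k * (\<Sum>i=1..n. (1 + yH i)\<^sup>2) \<le> 2 * (T + \<bar>M\<bar>)"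
    proof -
      have "(1 + yH i)\<^sup>2 \<le> 2 * (1 + (yH i)\<^sup>2)" for i
        using sum_squares_bound[of 1 "yH i"] by (simp add: power2_sum)
      then have "(\<Sum>i=1..n. (1 + yH i)\<^sup>2) \<le> (\<Sum>i=1..n. 2 * (1 + (yH i)\<^sup>2))"
        by (intro sum_mono)
      also have "\<dots> \<le> (\<Sum>i=1..N. 2 * (1 + (yH i)\<^sup>2))"
        using n' by (intro sum_mono2) auto
      also have "\<dots> = 2 * (real N + (\<Sum>i=1..N. (yH i)\<^sup>2))"
        by (simp add: sum_distrib_left[symmetric] sum.distrib)
      finally have "k * (\<Sum>i=1..n. (1 + yH i)\<^sup>2) \<le> k * (2 * (real N + (\<Sum>i=1..N. (yH i)\<^sup>2)))"
        using k by (intro mult_left_mono) auto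
      also have "\<dots> = 2 * (real N * k + k * (\<Sum>i=1..N. (yH i)\<^sup>2))" by (simp add: algebra_simps)
      also have "\<dots> \<le> 2 * (T + \<bar>M\<bar>)"
      proof (intro mult_left_mono add_mono k(2))
        show "k * (\<Sum>i=1..N. (yH i)\<^sup>2) \<le> \<bar>M\<bar>"
          using order_trans[OF coarse abs_ge_self] unfolding yH_def k_def .
      qed simp
      finally show ?thesis .
    qed
    have "(x n)\<^sup>2 \<le> exp (D * T) * ((x 0)\<^sup>2 + D * T * \<eta>\<^sup>2 + D * k\<^sup>2 * (k * (\<Sum>i=1..n. (1 + yH i)\<^sup>2)))"
    proof -
      have "0 \<le> k * \<nu>0 * (\<Sum>i=1..n. (y i)\<^sup>2)" using k \<nu>0 by (simp add: sum_nonneg)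
      with bound show ?thesis by linarith
    qed
    also have "\<dots> \<le> exp (D * T) * (C0\<^sup>2 * \<eta>\<^sup>2 + D * T * \<eta>\<^sup>2 + D * \<eta>\<^sup>2 * (2 * (T + \<bar>M\<bar>)))"
    proof (intro mult_left_mono add_mono order_refl)
      have "(x 0)\<^sup>2 \<le> C0\<^sup>2 * (h powr r)\<^sup>2"
        using initial_error[OF h(1) init] scheme by (simp add: x_def fine_scheme_def)
      also have "\<dots> \<le> C0\<^sup>2 * \<eta>\<^sup>2" using \<eta> by (intro mult_left_mono power_mono) auto
      finally show "(x 0)\<^sup>2 \<le> C0\<^sup>2 * \<eta>\<^sup>2" .
      show "D * k\<^sup>2 * (k * (\<Sum>i=1..n. (1 + yH i)\<^sup>2)) \<le> D * \<eta>\<^sup>2 * (2 * (T + \<bar>M\<bar>))"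
      proof (rule mult_mono[OF _ z])
        show "D * k\<^sup>2 \<le> D * \<eta>\<^sup>2" using D0 k \<eta> by (intro mult_left_mono power_mono) auto
      qed (use D0 k in \<open>auto simp: sum_nonneg\<close>)
    qed (use D0 T in auto)
    also have "\<dots> = Q * \<eta>\<^sup>2" by (simp add: Q_def algebra_simps)
    finally have "(x n)\<^sup>2 \<le> (sqrt Q * \<eta>)\<^sup>2" using Q0 by (simp add: power_mult_distrib)
    then have "x n \<le> sqrt Q * \<eta>"
      by (rule power2_le_imp_le) (use Q0 \<eta> in auto)
    then show ?thesis by (simp add: x_def \<eta>_def k_def)
  qed
  then show ?thesis
    using Q0 by (intro exI[of _ "sqrt Q"] conjI ballI allI impI) auto
qed

lemma two_grid_error:
  "\<exists>C>0. \<exists>\<delta>0>0. \<forall>h H N u0h u0H UH Uh.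
     0 < h \<and> h < H \<and> H \<le> 1 \<and> 1 \<le> N \<and> T / real N \<le> \<delta>0 \<and>
     u0h \<in> S h \<and> Hnorm \<Omega> 1 (\<lambda>x. u0h x - V h 0 x) \<le> C0 * h powr r \<and>
     u0H \<in> S H \<and> Hnorm \<Omega> 1 (\<lambda>x. u0H x - V H 0 x) \<le> C0 * H powr r \<and>
     coarse_scheme \<Omega> A B f (\<omega> N) (S H) (T / N) N u0H UH \<and>
     fine_scheme \<Omega> A B f (\<omega> N) (S h) (T / N) N UH u0h Uh \<longrightarrow>
     (\<forall>n\<in>{1..N}. l2_norm \<Omega> (\<lambda>x. Uh n x - u (n * (T / N)) x)
        \<le> C * (sqrt (T / N) * H powr (r - 1) + h powr r + T / N))"
proof -
  obtain \<delta> M where \<delta>: "\<delta> > 0" and coarse: "\<forall>H\<in>{0<..1}. \<forall>N u0H UH.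
     1 \<le> N \<longrightarrow> T / real N \<le> \<delta> \<longrightarrow> u0H \<in> S H \<longrightarrow> Hnorm \<Omega> 1 (\<lambda>x. u0H x - V H 0 x) \<le> C0 * H powr r \<longrightarrow>
     coarse_scheme \<Omega> A B f (\<omega> N) (S H) (T / N) N u0H UH \<longrightarrow>
     T / N * (\<Sum>i=1..N. (Hnorm \<Omega> 1 (\<lambda>x. UH i x - V H (i * (T / N)) x))\<^sup>2) \<le> M"
    using coarse_stability[of C0] by (elim exE conjE) (rule that)
  obtain Q where Q: "Q \<ge> 0" and fine: "\<forall>h\<in>{0<..1}. \<forall>H\<in>{0<..1}. \<forall>N u0h UH Uh.
     1 \<le> N \<longrightarrow> u0h \<in> S h \<longrightarrow> Hnorm \<Omega> 1 (\<lambda>x. u0h x - V h 0 x) \<le> C0 * h powr r \<longrightarrow>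
     (\<forall>n\<in>{1..N}. UH n \<in> S H) \<longrightarrow>
     T / N * (\<Sum>i=1..N. (Hnorm \<Omega> 1 (\<lambda>x. UH i x - V H (i * (T / N)) x))\<^sup>2) \<le> M \<longrightarrow>
     fine_scheme \<Omega> A B f (\<omega> N) (S h) (T / N) N UH u0h Uh \<longrightarrow>
     (\<forall>n\<in>{1..N}. l2_norm \<Omega> (\<lambda>x. Uh n x - V h (n * (T / N)) x) \<le> Q * (T / N + h powr r))"
    using fine_error[of C0 M] by (elim exE conjE) (rule that)
  obtain P where P_const: "projection_const P"
    using projection_error by (rule exE)
  note P = conjunct1[OF P_const] and proj = conjunct2[OF P_const]
  have "l2_norm \<Omega> (\<lambda>x. Uh n x - u (n * (T / N)) x)
      \<le> (Q + P + 1) * (sqrt (T / N) * H powr (r - 1) + h powr r + T / N)"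
    if h: "0 < h" "h < H" "H \<le> 1" and N: "1 \<le> N" "T / real N \<le> \<delta>"
      and inith: "u0h \<in> S h" "Hnorm \<Omega> 1 (\<lambda>x. u0h x - V h 0 x) \<le> C0 * h powr r"
      and initH: "u0H \<in> S H" "Hnorm \<Omega> 1 (\<lambda>x. u0H x - V H 0 x) \<le> C0 * H powr r"
      and cs: "coarse_scheme \<Omega> A B f (\<omega> N) (S H) (T / N) N u0H UH"
      and fs: "fine_scheme \<Omega> A B f (\<omega> N) (S h) (T / N) N UH u0h Uh"
      and n: "n \<in> {1..N}" for h H N u0h u0H UH Uh n
  proof -
    have hH: "h \<in> {0<..1}" "H \<in> {0<..1}" using h by auto
    let ?t = "real n * (T / N)"
    have t: "?t \<in> {0..T}" using time_grid[of n N] n by auto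
    have US: "Uh n \<in> S h" "\<forall>n\<in>{1..N}. UH n \<in> S H" using fs cs n unfolding fine_scheme_def coarse_scheme_def by auto
    note mem = S_H1[OF hH(1) US(1), THEN Hs_1_L2] V_H1[OF hH(1) t, THEN Hs_1_L2] u_H1(1)[OF t, THEN Hs_1_L2]
    have "l2_norm \<Omega> (\<lambda>x. Uh n x - u ?t x) \<le> l2_norm \<Omega> (\<lambda>x. Uh n x - V h ?t x) + l2_norm \<Omega> (\<lambda>x. V h ?t x - u ?t x)"
      using l2_norm_triangle[OF L2_diff[OF mem(1,2)] L2_diff[OF mem(2,3)]] by simp
    also have "l2_norm \<Omega> (\<lambda>x. V h ?t x - u ?t x) = l2_norm \<Omega> (\<lambda>x. u ?t x - V h ?t x)"
      using l2_norm_scaleR[of \<Omega> "-1" "\<lambda>x. u ?t x - V h ?t x"] by simp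
    also have "l2_norm \<Omega> (\<lambda>x. Uh n x - V h ?t x) + l2_norm \<Omega> (\<lambda>x. u ?t x - V h ?t x)
        \<le> Q * (T / N + h powr r) + P * h powr r"
      using fine[rule_format, OF hH N(1) inith bspec[OF US(2)]
          coarse[rule_format, OF hH(2) N initH cs] fs n] proj[rule_format, OF hH(1) t]
      by (intro add_mono) auto
    also have "\<dots> \<le> (Q + P + 1) * (T / N + h powr r)"
    proof -
      have "0 \<le> P * (T / N)" "0 \<le> T / N" "0 \<le> h powr r" using P T by auto
      then show ?thesis unfolding distrib_right distrib_left by linarith
    qed
    \<comment> \<open>The coarse grid costs only \<open>\<Delta>t\<close> times a bounded quantity, so the first term is merely added.\<close>
    also have "\<dots> \<le> (Q + P + 1) * (sqrt (T / N) * H powr (r - 1) + h powr r + T / N)"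
      using Q P T by (intro mult_left_mono) auto
    finally show ?thesis .
  qed
  moreover have "Q + P + 1 > 0" using Q P by simp
  ultimately show ?thesis
    using \<delta> by (intro exI[of _ "Q + P + 1"] exI[of _ \<delta>] conjI allI impI ballI) (auto simp del: times_divide_eq_right)
qed

end

section \<open>The error estimate\<close>

theorem theorem4p5:
  fixes \<Omega> :: "(real^'d) set" and T r \<nu>0 \<nu>1 C0 :: real
    and a :: "real^'d \<Rightarrow> real \<Rightarrow> real^'d^'d" and a0 :: "real^'d \<Rightarrow> real \<Rightarrow> real"
    and \<alpha> :: "real^'d \<Rightarrow> real \<Rightarrow> real^'d^'d"
    and \<beta> \<gamma> :: "real^'d \<Rightarrow> real \<Rightarrow> real^'d"
    and g :: "real^'d \<Rightarrow> real \<Rightarrow> real"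
    and K :: "real \<Rightarrow> real"
    and f u ut utt :: "real \<Rightarrow> real^'d \<Rightarrow> real" and u0 :: "real^'d \<Rightarrow> real"
    and S :: "real \<Rightarrow> (real^'d \<Rightarrow> real) set"
    and V Vt :: "real \<Rightarrow> real \<Rightarrow> real^'d \<Rightarrow> real"
    and \<omega> :: "nat \<Rightarrow> nat \<Rightarrow> nat \<Rightarrow> real"
  assumes "polyhedral_domain \<Omega>" and "T > 0" and "r \<ge> 1 + real CARD('d) / 2"
    and kernel: "set_integrable lborel {0..T} K"
    and source: "\<forall>t\<in>{0..T}. f t \<in> L2 \<Omega>"
    and elliptic: "elliptic_coeffs \<Omega> T a a0" "\<nu>0 > 0"
      "\<forall>t\<in>{0..T}. \<forall>v\<in>H10 \<Omega>. A_form \<Omega> a a0 t v v \<ge> \<nu>0 * (Hnorm \<Omega> 1 v)\<^sup>2"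
      "\<forall>t\<in>{0..T}. \<forall>v\<in>H10 \<Omega>. \<forall>w\<in>H10 \<Omega>.
         \<bar>A_form \<Omega> a a0 t v w\<bar> \<le> \<nu>1 * Hnorm \<Omega> 1 v * Hnorm \<Omega> 1 w"
    and coeffs: "smooth_bounded_on (\<Omega> \<times> UNIV) (\<lambda>(x, s). \<alpha> x s)"
      "smooth_bounded_on (\<Omega> \<times> UNIV) (\<lambda>(x, s). \<beta> x s)"
      "smooth_bounded_on (\<Omega> \<times> UNIV) (\<lambda>(x, s). \<gamma> x s)"
      "smooth_bounded_on (\<Omega> \<times> UNIV) (\<lambda>(x, s). g x s)"
      "\<forall>x\<in>\<Omega>. \<beta> x 0 = 0" "\<forall>x\<in>\<Omega>. g x 0 = 0"
    and solution: "weak_solution \<Omega> T (A_form \<Omega> a a0) (B_form \<Omega> \<alpha> \<beta> \<gamma> g) K f u0 u ut"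
    and spaces: "fe_family \<Omega> r S"
    and weights: "quadrature_weights T K \<omega>"
    and projection: "\<forall>h\<in>{0<..1}. ritz_volterra T (A_form \<Omega> a a0) (B1_form \<Omega> \<alpha> \<gamma>) K (S h) u (V h)"
    and regularity: "regular_solution \<Omega> T r u ut utt"
    and projection_regularity: "projection_bounds \<Omega> T r S u ut V Vt"
    and quadrature:
      "\<exists>C. \<forall>h\<in>{0<..1}. \<forall>v\<in>S h. \<forall>N n. 1 \<le> n \<and> n \<le> N \<longrightarrow>
         quad_err T K \<omega> N n (\<lambda>s. B1_form \<Omega> \<alpha> \<gamma> (u s) (V h s) v) \<le> C * (T / N) * Hnorm \<Omega> 1 v"
      "\<exists>C. \<forall>h\<in>{0<..1}. \<forall>v\<in>S h. \<forall>N n. 1 \<le> n \<and> n \<le> N \<longrightarrow>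
         quad_err T K \<omega> N n (\<lambda>s. l2_inner \<Omega> (\<lambda>x. \<beta> x (u s x)) (wgrad \<Omega> v)
                                  + l2_inner \<Omega> (\<lambda>x. g x (u s x)) v) \<le> C * (T / N) * Hnorm \<Omega> 1 v"
  shows "\<exists>C>0. \<exists>\<delta>0>0. \<forall>h H N u0h u0H UH Uh.
           0 < h \<and> h < H \<and> H \<le> 1 \<and> 1 \<le> N \<and> T / real N \<le> \<delta>0 \<and>
           u0h \<in> S h \<and> Hnorm \<Omega> 1 (\<lambda>x. u0h x - V h 0 x) \<le> C0 * h powr r \<and>
           u0H \<in> S H \<and> Hnorm \<Omega> 1 (\<lambda>x. u0H x - V H 0 x) \<le> C0 * H powr r \<and>
           coarse_scheme \<Omega> (A_form \<Omega> a a0) (B_form \<Omega> \<alpha> \<beta> \<gamma> g) f (\<omega> N) (S H) (T / N) N u0H UH \<and>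
           fine_scheme \<Omega> (A_form \<Omega> a a0) (B_form \<Omega> \<alpha> \<beta> \<gamma> g) f (\<omega> N) (S h) (T / N) N UH u0h Uh \<longrightarrow>
           (\<forall>n\<in>{1..N}. l2_norm \<Omega> (\<lambda>x. Uh n x - u (n * (T / N)) x)
              \<le> C * (sqrt (T / N) * H powr (r - 1) + h powr r + T / N))"
proof -
  have \<Omega>: "open \<Omega>" "bounded \<Omega>" "\<Omega> \<noteq> {}"
    using assms(1) by (auto simp: polyhedral_domain_def)
  obtain L1 L2 L3 L4 where "lipschitz_coeff \<Omega> L1 \<alpha>" "lipschitz_coeff \<Omega> L2 \<beta>"
    "lipschitz_coeff \<Omega> L3 \<gamma>" "lipschitz_coeff \<Omega> L4 g"
    using smooth_bounded_imp_lipschitz_coeff[OF \<Omega>(1) coeffs(1)]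
      smooth_bounded_imp_lipschitz_coeff[OF \<Omega>(1) coeffs(2)]
      smooth_bounded_imp_lipschitz_coeff[OF \<Omega>(1) coeffs(3)]
      smooth_bounded_imp_lipschitz_coeff[OF \<Omega>(1) coeffs(4)]
    by (elim exE) (rule that)
  note lipschitz = this[THEN lipschitz_coeff_mono, of "max (max L1 L2) (max L3 L4)"]
  interpret memory_problem \<Omega> T r \<nu>0 "max (max L1 L2) (max L3 L4)" a a0 \<alpha> \<beta> \<gamma> g K f u ut utt u0 S V Vt \<omega>
  proof (rule memory_problem.intro)
    show "lipschitz_coeff \<Omega> (max (max L1 L2) (max L3 L4)) \<alpha>"
      "lipschitz_coeff \<Omega> (max (max L1 L2) (max L3 L4)) \<beta>"
      "lipschitz_coeff \<Omega> (max (max L1 L2) (max L3 L4)) \<gamma>"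
      "lipschitz_coeff \<Omega> (max (max L1 L2) (max L3 L4)) g"
      by (rule lipschitz, simp)+
    show "1 \<le> r"
    proof -
      have "0 \<le> real CARD('d) / 2" by simp
      with assms(3) show ?thesis by linarith
    qed
    show "\<nu>0 * (Hnorm \<Omega> 1 v)\<^sup>2 \<le> A_form \<Omega> a a0 t v v" if "t \<in> {0..T}" "v \<in> H10 \<Omega>" for t v
      using elliptic(3) that by simp
    show "ritz_volterra T (A_form \<Omega> a a0) (B1_form \<Omega> \<alpha> \<gamma>) K (S h) u (V h)" if "h \<in> {0<..1}" for h
      using projection that by simp
  qed (fact \<Omega> assms)+
  show ?thesis by (rule two_grid_error)
qed

end
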